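(* Let $V$ be a Euclidean Jordan algebra and let $E=\{a\in V: 0\leq a\leq 1\}$ be its set of effects. If $\circ'$ is an invariant sequential product on $V$ (i.e. on $E$) that is norm-continuous in its first argument, then $a\circ' b = Q_{\sqrt{a}}\, b$ for all effects $a,b\in E$.
   Context: A (real) vector space $V$ is a Jordan algebra if it has a bilinear commutative operation $*$ with unit $1$ satisfying $a^2*(b*a)=(a^2*b)*a$ for all $a,b$, where $a^2=a*a$. An element $a$ is positive, $a\geq 0$, iff $a=b*b$ for some $b$. $V$ is a Euclidean Jordan algebra (EJA) if it is moreover a real Hilbert space with $\langle a*b,c\rangle=\langle b,a*c\rangle$ for all $a,b,c$ and such that $a\geq 0$ iff $\langle a,b\rangle\geq 0$ for all $b\geq 0$. (Finite-dimensionality is not assumed.) The order is $v\leq w\iff w-v\geq 0$; every positive $a$ has a unique positive square root $\sqrt a$. The quadratic representation of $a$ is $Q_a:V\to V$, $Q_a(b)=2a*(a*b)-a^2*b$. The norm is the order unit norm $\|v\|=\inf\{r>0: -r1\leq v\leq r1\}$. For $a,b\in E$ the sum $a+b$ is regarded as defined in $E$ iff $a+b\leq 1$; write $a^\perp=1-a$. A sequential product on $E$ is a (total) binary operation $\circ: E\times E\to E$ such that, writing $a\mid b$ for $a\circ b=b\circ a$, for all $a,b,c\in E$: (1) $a\circ(b+c)=a\circ b+a\circ c$ whenever $b+c$ is defined in $E$; (2) $1\circ a=a$; (3) $a\circ b=0$ implies $b\circ a=0$; (4) if $a\mid b$ then $a\mid b^\perp$ and $a\circ(b\circ c)=(a\circ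 b)\circ c$ for all $c$; (5) if $c\mid a$ and $c\mid b$ then $c\mid (a\circ b)$, and, if $a+b$ is defined in $E$, $c\mid(a+b)$. A unital order isomorphism $\Phi:V\to V$ is a linear bijection with $\Phi(1)=1$ and $v\geq 0\iff\Phi(v)\geq 0$. The sequential product is invariant if $\Phi(a\circ b)=\Phi(a)\circ\Phi(b)$ for all $a,b\in E$ and all unital order isomorphisms $\Phi$ of $V$. Norm-continuous in its first argument means that for each fixed $b\in E$ the map $a\mapsto a\circ b$ is norm-continuous on $E$. *)

theory Defs
  imports "HOL-Analysis.Analysis"
begin

locale jordan_algebra =
  fixes mult :: "'a::real_vector \<Rightarrow> 'a \<Rightarrow> 'a"  (infixl "\<star>" 70)
    and unit :: 'a
  assumes bilinear_mult: "bilinear mult"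
    and mult_commute: "a \<star> b = b \<star> a"
    and mult_unit: "unit \<star> a = a"
    and jordan_identity: "(a \<star> a) \<star> (b \<star> a) = ((a \<star> a) \<star> b) \<star> a"
begin

definition positive :: "'a \<Rightarrow> bool" where
  "positive a \<longleftrightarrow> (\<exists>b. a = b \<star> b)"

definition jle :: "'a \<Rightarrow> 'a \<Rightarrow> bool"  (infix "\<preceq>" 50) where
  "v \<preceq> w \<longleftrightarrow> positive (w - v)"

definition effects :: "'a set" where
  "effects = {a. 0 \<preceq> a \<and> a \<preceq> unit}"

text \<open>Meaningful on positive elements of a Euclidean Jordan algebra, where the positive square
  root exists and is unique.\<close>

definition jsqrt :: "'a \<Rightarrow> 'a" where
  "jsqrt a = (THE s. positive s \<and> s \<star> s = a)"

definition quad_rep :: "'a \<Rightarrow> 'a \<Rightarrow> 'a" where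
  "quad_rep a b = 2 *\<^sub>R (a \<star> (a \<star> b)) - (a \<star> a) \<star> b"

definition order_unit_norm :: "'a \<Rightarrow> real" where
  "order_unit_norm v = Inf {r. r > 0 \<and> (- (r *\<^sub>R unit)) \<preceq> v \<and> v \<preceq> r *\<^sub>R unit}"

definition unital_order_iso :: "('a \<Rightarrow> 'a) \<Rightarrow> bool" where
  "unital_order_iso \<Phi> \<longleftrightarrow>
     linear \<Phi> \<and> bij \<Phi> \<and> \<Phi> unit = unit \<and> (\<forall>v. positive v \<longleftrightarrow> positive (\<Phi> v))"

end

text \<open>The Hilbert space structure is the one of the type. The norm \<open>norm\<close> of the type is the
  Hilbert norm, not the order unit norm. No continuity of the product is assumed.\<close>

locale euclidean_jordan_algebra = jordan_algebra mult unit
  for mult :: "'a::{real_inner, complete_space} \<Rightarrow> 'a \<Rightarrow> 'a"  (infixl "\<star>" 70)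
    and unit :: 'a +
  assumes mult_self_adjoint: "(a \<star> b) \<bullet> c = b \<bullet> (a \<star> c)"
    and positive_self_dual: "positive a \<longleftrightarrow> (\<forall>b. positive b \<longrightarrow> 0 \<le> a \<bullet> b)"

text \<open>The operation is represented by a function on the whole space, of which only the values on
  pairs of effects are constrained and used. For effects \<open>b\<close> and \<open>c\<close>, the sum being defined
  in the effect algebra means \<open>b + c \<preceq> unit\<close>.\<close>

locale sequential_product = jordan_algebra mult unit
  for mult :: "'a::real_vector \<Rightarrow> 'a \<Rightarrow> 'a"  (infixl "\<star>" 70)
    and unit :: 'a +
  fixes sprod :: "'a \<Rightarrow> 'a \<Rightarrow> 'a"  (infixl "\<diamondop>" 70)
  assumes sprod_closed:
      "\<lbrakk>a \<in> effects; b \<in> effects\<rbrakk> \<Longrightarrow> a \<diamondop> b \<in> effects"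
    and sprod_add:
      "\<lbrakk>a \<in> effects; b \<in> effects; c \<in> effects; b + c \<preceq> unit\<rbrakk>
        \<Longrightarrow> a \<diamondop> (b + c) = a \<diamondop> b + a \<diamondop> c"
    and unit_sprod: "a \<in> effects \<Longrightarrow> unit \<diamondop> a = a"
    and sprod_eq_zero:
      "\<lbrakk>a \<in> effects; b \<in> effects; a \<diamondop> b = 0\<rbrakk> \<Longrightarrow> b \<diamondop> a = 0"
    and commutes_compl:
      "\<lbrakk>a \<in> effects; b \<in> effects; a \<diamondop> b = b \<diamondop> a\<rbrakk>
        \<Longrightarrow> a \<diamondop> (unit - b) = (unit - b) \<diamondop> a"
    and commutes_assoc:
      "\<lbrakk>a \<in> effects; b \<in> effects; c \<in> effects; a \<diamondop> b = b \<diamondop> a\<rbrakk>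
        \<Longrightarrow> a \<diamondop> (b \<diamondop> c) = (a \<diamondop> b) \<diamondop> c"
    and commutes_sprod:
      "\<lbrakk>a \<in> effects; b \<in> effects; c \<in> effects;
        c \<diamondop> a = a \<diamondop> c; c \<diamondop> b = b \<diamondop> c\<rbrakk>
        \<Longrightarrow> c \<diamondop> (a \<diamondop> b) = (a \<diamondop> b) \<diamondop> c"
    and commutes_add:
      "\<lbrakk>a \<in> effects; b \<in> effects; c \<in> effects;
        c \<diamondop> a = a \<diamondop> c; c \<diamondop> b = b \<diamondop> c; a + b \<preceq> unit\<rbrakk>
        \<Longrightarrow> c \<diamondop> (a + b) = (a + b) \<diamondop> c"
begin

definition invariant :: bool where
  "invariant \<longleftrightarrow>
     (\<forall>\<Phi>. unital_order_iso \<Phi> \<longrightarrow>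
       (\<forall>a\<in>effects. \<forall>b\<in>effects. \<Phi> (a \<diamondop> b) = \<Phi> a \<diamondop> \<Phi> b))"

definition norm_continuous_fst :: bool where
  "norm_continuous_fst \<longleftrightarrow>
     (\<forall>b\<in>effects. \<forall>a\<in>effects. \<forall>\<epsilon>>0. \<exists>\<delta>>0. \<forall>a'\<in>effects.
        order_unit_norm (a' - a) < \<delta> \<longrightarrow>
        order_unit_norm (a' \<diamondop> b - a \<diamondop> b) < \<epsilon>)"

end

end

theory Submission
  imports Defs
begin

text \<open>The product is continuous for the Hilbert norm by uniform boundedness. The even powers of a
  suitably scaled element converge to an idempotent, and orthogonal idempotents are bounded in
  number, so every element is diagonal in a finite frame of primitive idempotents. For an
  idempotent \<open>p\<close> the map \<open>b \<mapsto> p \<circ> b\<close> fixes the Peirce space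
  \<open>V\<^sub>1(p)\<close> and kills \<open>V\<^sub>0(p)\<close>; positivity of squares forces it to kill the space for
  eigenvalue \<open>1/2\<close> as well, so it is \<open>Q\<^sub>p\<close>. Hence for \<open>a\<close> diagonal in a frame only the action of
  \<open>s f + t g\<close> on the off-diagonal block of two frame elements \<open>f\<close>, \<open>g\<close> remains. It is multiplicative
  in \<open>(s, t)\<close> and commutes with the automorphisms fixing \<open>f\<close> and \<open>g\<close>. Products of two reflections
  show that it is a scalar, except in blocks of dimension two, where a transposition is needed
  to exclude \<open>a\<^bsup>1/2 + i\<theta>\<^esup> b a\<^bsup>1/2 - i\<theta>\<^esup>\<close>. A
  reflection exchanging \<open>f\<close> and \<open>g\<close> shows that the square of the scalar is \<open>s t\<close>, and it is
  nonnegative because \<open>s\<close> and \<open>t\<close> have square roots.\<close>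

text \<open>The twisted maps are the obstacle because, in a plane, rotations commute with one
  another: equivariance under them leaves a complex scalar undetermined, and only an automorphism
  that reverses the orientation while fixing \<open>f\<close> and \<open>g\<close> removes the
  phase. In a block with a third direction, a half turn of a plane orthogonal to the given vector
  already confines its image. Every automorphism needed is the sign change of a grading into an even
  and an odd part, so all of them are involutions, or products of two, whose multiplicativity is
  checked on blocks. For the transposition the sign change cannot stay inside one block, since
  products of blocks land in further blocks; it has to be extended coherently to all frame elements
  linked to the pair, and this is what the matrix units are for. Rank is finite, but blocks may have
  infinite dimension, as in spin factors; so blocks are handled through inner products with finitely
  many vectors, not through bases.\<close>

lemma scaleR_3: "3 *\<^sub>R x = x + x + (x::'a::real_vector)"
proof -
  have "3 *\<^sub>R x = (1 + 1 + 1) *\<^sub>R x" by simp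
  also have "\<dots> = x + x + x" by (simp only: scaleR_add_left scaleR_one)
  finally show ?thesis .
qed

lemma scaleR_4: "4 *\<^sub>R x = x + x + x + (x::'a::real_vector)"
proof -
  have "4 *\<^sub>R x = (1 + 1 + 1 + 1) *\<^sub>R x" by simp
  also have "\<dots> = x + x + x + x" by (simp only: scaleR_add_left scaleR_one)
  finally show ?thesis by simp
qed

subsection \<open>Jordan algebras and the Peirce decomposition\<close>

context jordan_algebra
begin

lemma mult_add_left: "(x + y) \<star> z = x \<star> z + y \<star> z"
  and mult_add_right: "z \<star> (x + y) = z \<star> x + z \<star> y"
  and mult_diff_left: "(x - y) \<star> z = x \<star> z - y \<star> z"
  and mult_diff_right: "z \<star> (x - y) = z \<star> x - z \<star> y"
  and mult_scaleR_left: "(c *\<^sub>R x) \<star> z = c *\<^sub>R (x \<star> z)"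
  and mult_scaleR_right: "z \<star> (c *\<^sub>R x) = c *\<^sub>R (z \<star> x)"
  and mult_minus_left: "(- x) \<star> z = - (x \<star> z)"
  and mult_minus_right: "z \<star> (- x) = - (z \<star> x)"
  and mult_zero_left [simp]: "0 \<star> z = 0"
  and mult_zero_right [simp]: "z \<star> 0 = 0"
  using bilinear_mult
  by (simp_all add: bilinear_ladd bilinear_radd bilinear_lsub bilinear_rsub bilinear_lmul
      bilinear_rmul bilinear_lneg bilinear_rneg bilinear_lzero bilinear_rzero)

lemmas mult_linear = mult_add_left mult_add_right mult_diff_left mult_diff_right
  mult_scaleR_left mult_scaleR_right mult_minus_left mult_minus_right

lemma linear_mult: "linear (\<lambda>x. z \<star> x)"
  by (rule linearI) (simp_all add: mult_linear)

lemma linear_mult_left: "linear (\<lambda>x. x \<star> z)"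
  by (rule linearI) (simp_all add: mult_linear)

lemma mult_sum_right: "z \<star> sum f A = (\<Sum>i\<in>A. z \<star> f i)"
  using linear_sum[OF linear_mult] .

lemma mult_sum_left: "sum f A \<star> z = (\<Sum>i\<in>A. f i \<star> z)"
  using linear_sum[OF linear_mult_left] .

lemma mult_unit_right [simp]: "x \<star> unit = x"
  using mult_unit mult_commute by metis

declare mult_unit [simp]

text \<open>The Jordan identity is cubic in its repeated variable. Inclusion-exclusion over
  \<open>a\<close>, \<open>b\<close>, \<open>c\<close> isolates the trilinear part, and
  commutativity pairs its six terms, hence the factor 2 in the proof.\<close>

lemma jordan_linearized:
  "(a \<star> b) \<star> (c \<star> d) + (b \<star> c) \<star> (a \<star> d) + (c \<star> a) \<star> (b \<star> d)
    = c \<star> ((a \<star> b) \<star> d) + a \<star> ((b \<star> c) \<star> d) + b \<star> ((c \<star> a) \<star> d)" (is "?L = ?R")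
proof -
  define f where "f x = (x \<star> x) \<star> (d \<star> x) - ((x \<star> x) \<star> d) \<star> x" for x
  have f0: "f x = 0" for x
    by (simp add: f_def jordan_identity)
  have "2 *\<^sub>R (?L - ?R)
      = f (a + b + c) - f (a + b) - f (b + c) - f (a + c) + f a + f b + f c"
    unfolding f_def
    by (simp add: mult_linear scaleR_2 mult_commute algebra_simps)
  then show ?thesis
    by (simp add: f0)
qed

text \<open>Rewrites multiplication by a triple product through multiplications by shorter products;
  this drives the induction on powers.\<close>

lemma power_op_identity:
  "((c \<star> a) \<star> d) \<star> b = (c \<star> d) \<star> (a \<star> b) + (a \<star> d) \<star> (c \<star> b) + (c \<star> a) \<star> (d \<star> b)
     - c \<star> (d \<star> (a \<star> b)) - a \<star> (d \<star> (c \<star> b))"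
  using jordan_linearized[of a b c d]
  by (simp add: mult_commute algebra_simps)

section \<open>Power associativity\<close>

fun jpow :: "'a \<Rightarrow> nat \<Rightarrow> 'a" where
  "jpow x 0 = unit"
| "jpow x (Suc n) = x \<star> jpow x n"

text \<open>Multiplication by a power of \<open>x\<close> is a polynomial in the multiplications by
  \<open>x\<close> and by \<open>x \<star> x\<close>, and these two commute by the Jordan identity.
  The recursion \<open>e\<close> reaches back two exponents and involves both operators, so both
  commutation claims are proved together.\<close>

lemma jpow_commute_aux:
  "jpow x n \<star> (x \<star> b) = x \<star> (jpow x n \<star> b) \<and>
   jpow x n \<star> ((x \<star> x) \<star> b) = (x \<star> x) \<star> (jpow x n \<star> b)"
proof (induction n arbitrary: b rule: less_induct)
  case (less n)
  consider "n = 0" | "n = 1" | m where "n = Suc (Suc m)"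
    by (metis One_nat_def not0_implies_Suc)
  then show ?case
  proof cases
    case 1
    then show ?thesis by simp
  next
    case 2
    have "x \<star> ((x \<star> x) \<star> b) = (x \<star> x) \<star> (x \<star> b)" for b
      using jordan_identity[of x b] by (simp add: mult_commute)
    with 2 show ?thesis by simp
  next
    case (3 m)
    have i0: "jpow x m \<star> (x \<star> b) = x \<star> (jpow x m \<star> b)"
      "jpow x m \<star> ((x \<star> x) \<star> b) = (x \<star> x) \<star> (jpow x m \<star> b)" for b
      using less.IH[of m] 3 by auto
    have i1: "jpow x (Suc m) \<star> (x \<star> b) = x \<star> (jpow x (Suc m) \<star> b)"
      "jpow x (Suc m) \<star> ((x \<star> x) \<star> b) = (x \<star> x) \<star> (jpow x (Suc m) \<star> b)" for b
      using less.IH[of "Suc m"] 3 by auto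
    have x2: "x \<star> ((x \<star> x) \<star> b) = (x \<star> x) \<star> (x \<star> b)" for b
      using jordan_identity[of x b] by (simp add: mult_commute)
    have e: "jpow x n \<star> b = (x \<star> x) \<star> (jpow x m \<star> b) + 2 *\<^sub>R (x \<star> (jpow x (Suc m) \<star> b))
      - x \<star> (x \<star> (jpow x m \<star> b)) - x \<star> (x \<star> (jpow x m \<star> b))" for b
    proof -
      have "jpow x n = (x \<star> jpow x m) \<star> x"
        using 3 mult_commute by simp
      moreover have "(jpow x m \<star> x) = jpow x (Suc m)"
        by (simp add: mult_commute)
      ultimately show ?thesis
        using power_op_identity[of x "jpow x m" x b] i0 i1
        by (simp add: scaleR_2)
    qed
    show ?thesis
      unfolding e using i0 i1 x2 by (simp add: mult_linear)
  qed
qed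

lemma jpow_add: "jpow x m \<star> jpow x n = jpow x (m + n)"
proof (induction n)
  case (Suc n)
  then show ?case using jpow_commute_aux[of x m "jpow x n"] by simp
qed simp

section \<open>Peirce spaces of one idempotent\<close>

definition idem :: "'a \<Rightarrow> bool" where
  "idem p \<longleftrightarrow> p \<star> p = p"

text \<open>For an idempotent \<open>p\<close> only the values \<open>0\<close>, \<open>1/2\<close> and \<open>1\<close> of \<open>i\<close> matter.\<close>

definition peirce :: "real \<Rightarrow> 'a \<Rightarrow> 'a set" where
  "peirce i p = {x. p \<star> x = i *\<^sub>R x}"

lemma subspace_peirce: "subspace (peirce i p)"
  unfolding peirce_def subspace_def
  by (auto simp: mult_linear scaleR_add_right scaleR_left_commute)

text \<open>The linearized identity at \<open>e, e, x, y\<close> becomes \<open>1 - 2 * i\<close>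
  times the defect \<open>e \<star> (x \<star> y) - j *\<^sub>R (x \<star> y)\<close>, which
  explains the single excluded eigenvalue.\<close>

lemma peirce_mult:
  assumes "idem e" "x \<in> peirce i e" "y \<in> peirce j e" "i \<noteq> 1/2"
  shows "x \<star> y \<in> peirce j e"
proof -
  have h: "e \<star> e = e" "e \<star> x = i *\<^sub>R x" "x \<star> e = i *\<^sub>R x" "e \<star> y = j *\<^sub>R y"
    using assms by (auto simp: idem_def peirce_def mult_commute)
  have "e \<star> (x \<star> y) + ((i * j) *\<^sub>R (x \<star> y) + (i * j) *\<^sub>R (x \<star> y))
      = j *\<^sub>R (x \<star> y) + (i *\<^sub>R (e \<star> (x \<star> y)) + i *\<^sub>R (e \<star> (x \<star> y)))"
    using jordan_linearized[of e e x y]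
    by (simp add: h mult_linear mult.commute[of j i] add.assoc)
  then have "e \<star> (x \<star> y) + 2 *\<^sub>R ((i * j) *\<^sub>R (x \<star> y))
      = j *\<^sub>R (x \<star> y) + 2 *\<^sub>R (i *\<^sub>R (e \<star> (x \<star> y)))"
    by (simp only: scaleR_2)
  moreover have "(1 - 2 * i) *\<^sub>R (e \<star> (x \<star> y) - j *\<^sub>R (x \<star> y))
    = (e \<star> (x \<star> y) + 2 *\<^sub>R ((i * j) *\<^sub>R (x \<star> y)))
      - (j *\<^sub>R (x \<star> y) + 2 *\<^sub>R (i *\<^sub>R (e \<star> (x \<star> y))))"
    by (simp add: algebra_simps)
  ultimately have "(1 - 2 * i) *\<^sub>R (e \<star> (x \<star> y) - j *\<^sub>R (x \<star> y)) = 0"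
    by simp
  then show ?thesis
    using assms(4) by (simp add: peirce_def)
qed

lemma peirce_one_mult:
  assumes "idem e" "x \<in> peirce 1 e" "y \<in> peirce j e" shows "x \<star> y \<in> peirce j e"
  using peirce_mult[OF assms] by simp

lemma peirce_zero_mult:
  assumes "idem e" "x \<in> peirce 0 e" "y \<in> peirce j e" shows "x \<star> y \<in> peirce j e"
  using peirce_mult[OF assms] by simp

text \<open>The product lies in the eigenspaces of both factors, and these meet only in 0.\<close>

lemma peirce_one_zero:
  assumes "idem e" "x \<in> peirce 1 e" "y \<in> peirce 0 e"
  shows "x \<star> y = 0"
  using peirce_one_mult[OF assms] peirce_zero_mult[OF assms(1,3,2)]
  by (simp add: peirce_def mult_commute)

text \<open>In other words, the product has no component for eigenvalue 1/2: linearization makes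
  multiplication by \<open>e\<close> idempotent on it.\<close>

lemma peirce_half_mult:
  assumes "idem e" "x \<in> peirce (1/2) e" "y \<in> peirce (1/2) e"
  shows "e \<star> (x \<star> y) \<in> peirce 1 e" "x \<star> y - e \<star> (x \<star> y) \<in> peirce 0 e"
proof -
  have h: "e \<star> e = e" "e \<star> x = (1/2) *\<^sub>R x" "y \<star> e = (1/2) *\<^sub>R y"
    "e \<star> y = (1/2) *\<^sub>R y"
    using assms by (auto simp: idem_def peirce_def mult_commute)
  have "(1/4) *\<^sub>R (x \<star> y) + (x \<star> y) \<star> e + (1/4) *\<^sub>R (x \<star> y)
     = (1/4) *\<^sub>R (x \<star> y) + e \<star> ((x \<star> y) \<star> e) + (1/4) *\<^sub>R (x \<star> y)"
    using jordan_linearized[of e x y e]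
    by (simp add: h mult_linear mult_commute)
  then have "e \<star> (x \<star> y) = e \<star> (e \<star> (x \<star> y))"
    by (simp add: mult_commute)
  then show "e \<star> (x \<star> y) \<in> peirce 1 e" "x \<star> y - e \<star> (x \<star> y) \<in> peirce 0 e"
    by (simp_all add: peirce_def mult_linear)
qed

text \<open>Multiplication by \<open>e\<close> is a root of t(2t - 1)(t - 1), so its only
  eigenvalues are 0, 1/2 and 1.\<close>

lemma idem_cubic:
  assumes "idem e"
  shows "2 *\<^sub>R (e \<star> (e \<star> (e \<star> x))) = 3 *\<^sub>R (e \<star> (e \<star> x)) - e \<star> x"
proof -
  have "3 *\<^sub>R (e \<star> (e \<star> x)) = 2 *\<^sub>R (e \<star> (e \<star> (e \<star> x))) + e \<star> x"
    using jordan_linearized[of e x e e] assms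
    by (simp add: idem_def mult_linear mult_commute scaleR_2 scaleR_3 algebra_simps)
  then show ?thesis by simp
qed

lemma idem_compl: "idem p \<Longrightarrow> idem (unit - p)"
  by (simp add: idem_def mult_linear)

lemma idem_add: "idem p \<Longrightarrow> idem q \<Longrightarrow> p \<star> q = 0 \<Longrightarrow> idem (p + q)"
  by (simp add: idem_def mult_linear mult_commute[of q p])

text \<open>In the linearized identity at \<open>p, p, q, x\<close> every other term contains the
  factor \<open>p \<star> q\<close>.\<close>

lemma orthogonal_idem_commute:
  assumes "idem p" "p \<star> q = 0"
  shows "p \<star> (q \<star> x) = q \<star> (p \<star> x)"
  using jordan_linearized[of p p q x] assms
  by (simp add: idem_def mult_commute[of q p])

lemma quad_rep_idem: "idem p \<Longrightarrow> quad_rep p x = 2 *\<^sub>R (p \<star> (p \<star> x)) - p \<star> x"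
  by (simp add: quad_rep_def idem_def)

lemma linear_quad_rep: "linear (quad_rep p)"
  by (rule linearI) (simp_all add: quad_rep_def mult_linear algebra_simps)

lemma peirce_compl_iff: "x \<in> peirce i (unit - p) \<longleftrightarrow> x \<in> peirce (1 - i) p"
  by (auto simp: peirce_def mult_linear algebra_simps)

text \<open>On an eigenvector for t the operator is 2t^2 - t, with values 1, 0, 0 at t = 1, 1/2, 0.
  Hence it is the projection onto the Peirce space for 1.\<close>

lemma quad_rep_peirce:
  assumes "idem p"
  shows quad_rep_peirce_one: "x \<in> peirce 1 p \<Longrightarrow> quad_rep p x = x"
    and quad_rep_peirce_half: "x \<in> peirce (1/2) p \<Longrightarrow> quad_rep p x = 0"
    and "x \<in> peirce 0 p \<Longrightarrow> quad_rep p x = 0"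
  using assms by (simp_all add: quad_rep_idem peirce_def mult_linear scaleR_2)

lemma peirce_decomposition:
  assumes "idem p"
  obtains x1 xh x0 where "x = x1 + xh + x0"
    "x1 \<in> peirce 1 p" "xh \<in> peirce (1/2) p" "x0 \<in> peirce 0 p"
proof
  define u v where "u = p \<star> x" and "v = p \<star> (p \<star> x)"
  have pu: "p \<star> x = u" "p \<star> u = v" by (simp_all add: u_def v_def)
  have "2 *\<^sub>R (p \<star> v) = 3 *\<^sub>R v - u"
    using idem_cubic[OF assms, of x] by (simp add: pu)
  then have c: "p \<star> v + p \<star> v = v + v + v - u"
    by (simp only: scaleR_2 scaleR_3)
  have c': "p \<star> v = (1/2) *\<^sub>R (v + v + v - u)"
    by (metis (no_types) c scaleR_half_double)
  have half: "(1/2) *\<^sub>R (2 *\<^sub>R y) = y" for y :: 'a by simp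
  \<comment> \<open>The summands are the Lagrange interpolation polynomials 2t^2 - t, 4t - 4t^2 and
    1 - 3t + 2t^2 for the nodes 1, 1/2, 0, evaluated at multiplication by \<open>p\<close>.\<close>
  show "x = (2 *\<^sub>R v - u) + (4 *\<^sub>R u - 4 *\<^sub>R v) + (x - 3 *\<^sub>R u + 2 *\<^sub>R v)"
    by (simp add: scaleR_2 scaleR_3 scaleR_4)
  show "2 *\<^sub>R v - u \<in> peirce 1 p"
    using c by (simp add: peirce_def mult_linear pu scaleR_2)
  have "p \<star> (4 *\<^sub>R u - 4 *\<^sub>R v) = 2 *\<^sub>R (v + v - (p \<star> v + p \<star> v))"
    by (simp add: mult_linear pu scaleR_2 scaleR_4)
  also have "\<dots> = (1/2) *\<^sub>R (4 *\<^sub>R u - 4 *\<^sub>R v)"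
    by (simp add: c scaleR_diff_right scaleR_2)
  finally show "4 *\<^sub>R u - 4 *\<^sub>R v \<in> peirce (1/2) p"
    by (simp add: peirce_def)
  show "x - 3 *\<^sub>R u + 2 *\<^sub>R v \<in> peirce 0 p"
    using c by (simp add: peirce_def mult_linear pu scaleR_2 scaleR_3)
qed

lemma quad_rep_in_peirce_one:
  assumes "idem p" shows "quad_rep p x \<in> peirce 1 p"
proof -
  obtain x1 xh x0 where "x = x1 + xh + x0"
    "x1 \<in> peirce 1 p" "xh \<in> peirce (1/2) p" "x0 \<in> peirce 0 p"
    using peirce_decomposition[OF assms] .
  then show ?thesis
    using quad_rep_peirce[OF assms] by (simp add: linear_add[OF linear_quad_rep])
qed

end

section \<open>The self-dual cone and uniqueness of positive square roots\<close>

context euclidean_jordan_algebra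
begin

lemma inner_mult_swap: "(a \<star> x) \<bullet> y = x \<bullet> (a \<star> y)"
  by (rule mult_self_adjoint)

lemma positive_square: "positive (x \<star> x)"
  by (auto simp: positive_def)

lemma positive_inner: "positive x \<Longrightarrow> positive y \<Longrightarrow> 0 \<le> x \<bullet> y"
  using positive_self_dual by blast

lemma positiveI: "(\<And>y. positive y \<Longrightarrow> 0 \<le> x \<bullet> y) \<Longrightarrow> positive x"
  using positive_self_dual by blast

lemma positive_add: "positive x \<Longrightarrow> positive y \<Longrightarrow> positive (x + y)"
  by (rule positiveI) (simp add: inner_add_left positive_inner)

lemma positive_scaleR: "0 \<le> c \<Longrightarrow> positive x \<Longrightarrow> positive (c *\<^sub>R x)"
  by (rule positiveI) (simp add: positive_inner)

lemma positive_zero [simp]: "positive 0"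
  by (rule positiveI) simp

lemma positive_sum: "(\<And>i. i \<in> A \<Longrightarrow> positive (f i)) \<Longrightarrow> positive (sum f A)"
  by (induction A rule: infinite_finite_induct) (simp_all add: positive_add)

lemma positive_antisym: "positive x \<Longrightarrow> positive (- x) \<Longrightarrow> x = 0"
  using positive_inner[of x "- x"] by simp (metis inner_ge_zero inner_eq_zero_iff order_antisym)

lemma positive_idem: "idem p \<Longrightarrow> positive p"
  by (metis idem_def positive_square)

lemma idem_unit [simp]: "idem unit"
  by (simp add: idem_def)

lemma positive_unit [simp]: "positive unit"
  by (simp add: positive_idem)

lemma inner_square_unit: "(x \<star> x) \<bullet> unit = x \<bullet> x"
  by (simp add: mult_self_adjoint)

lemma positive_inner_unit_zero:
  assumes "positive x" "x \<bullet> unit = 0" shows "x = 0"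
proof -
  obtain b where "x = b \<star> b" using assms(1) positive_def by blast
  then show ?thesis using assms(2) by (simp add: inner_square_unit)
qed

lemma peirce_orthogonal:
  assumes "x \<in> peirce i p" "y \<in> peirce j p" "i \<noteq> j" shows "x \<bullet> y = 0"
  using inner_mult_swap[of p x y] assms by (simp add: peirce_def)

lemma effects_iff: "a \<in> effects \<longleftrightarrow> positive a \<and> positive (unit - a)"
  by (simp add: effects_def jle_def)

lemma idem_effect: "idem p \<Longrightarrow> p \<in> effects"
  by (simp add: effects_iff positive_idem idem_compl)

text \<open>A positive \<open>s\<close> acts as a positive semidefinite operator, which turns \<open>s \<bullet> (d \<star> d) = 0\<close>
  into \<open>s \<star> d = 0\<close>.\<close>

lemma positive_mult_eq_zero:
  assumes "positive s" "s \<bullet> (d \<star> d) = 0" shows "s \<star> d = 0"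
proof -
  have q: "s \<bullet> (z \<star> z) = (s \<star> z) \<bullet> z" for z
    using inner_mult_swap[of z s z] by (simp add: mult_commute)
  have nn: "0 \<le> (s \<star> z) \<bullet> z" for z
    using positive_inner[OF assms(1) positive_square[of z]] by (simp add: q)
  define z where "z = s \<star> d"
  \<comment> \<open>The nonnegative form of \<open>s\<close> at \<open>d + t z\<close> is a
    quadratic in \<open>t\<close> without constant term, so its linear coefficient must
    vanish.\<close>
  have "0 \<le> 2 * t * (z \<bullet> z) + t\<^sup>2 * ((s \<star> z) \<bullet> z)" for t
    using nn[of "d + t *\<^sub>R z"] assms(2) inner_mult_swap[of s z d]
    by (simp add: q z_def mult_linear inner_simps inner_commute power2_eq_square algebra_simps)
  note h = this
  have "z \<bullet> z = 0"
  proof (rule ccontr)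
    assume "z \<bullet> z \<noteq> 0"
    then have p: "0 < z \<bullet> z" by simp
    define k where "k = (s \<star> z) \<bullet> z"
    have k: "0 \<le> k" using nn k_def by simp
    \<comment> \<open>At \<open>t = -r\<close> the linear term outweighs the quadratic one; the
      summand 1 in the denominator covers \<open>k = 0\<close>.\<close>
    define r where "r = (z \<bullet> z) / (k + 1)"
    have r: "0 < r" "r * (k + 1) = z \<bullet> z" using p k by (simp_all add: r_def)
    have "r * (2 * (z \<bullet> z)) \<le> r * (r * k)"
      using h[of "- r"] unfolding k_def[symmetric] by (simp add: power2_eq_square)
    then have "2 * (z \<bullet> z) \<le> r * k" using r(1) by simp
    also have "\<dots> \<le> z \<bullet> z" using r by (simp add: algebra_simps)
    finally show False using p by simp
  qed
  then show ?thesis by (simp add: z_def)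
qed

text \<open>For \<open>d = s - t\<close> commutativity gives \<open>d \<star> (s + t) = 0\<close>.
  Hence the nonnegative numbers \<open>s \<bullet> (d \<star> d)\<close> and
  \<open>t \<bullet> (d \<star> d)\<close> add up to 0, so both \<open>s\<close> and
  \<open>t\<close> annihilate \<open>d\<close>.\<close>

lemma positive_sqrt_unique:
  assumes "positive s" "positive t" "s \<star> s = t \<star> t" shows "s = t"
proof -
  define d where "d = s - t"
  have "d \<star> (s + t) = 0"
    using assms(3) by (simp add: d_def mult_linear mult_commute)
  then have "(s + t) \<bullet> (d \<star> d) = 0"
    using inner_mult_swap[of d "s + t" d] by simp
  then have "s \<bullet> (d \<star> d) = 0" "t \<bullet> (d \<star> d) = 0"
    using positive_inner[OF assms(1) positive_square[of d]]
      positive_inner[OF assms(2) positive_square[of d]]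
    by (simp_all add: inner_add_left)
  then have "s \<star> d = 0" "t \<star> d = 0"
    using positive_mult_eq_zero assms(1,2) by blast+
  then have "d \<star> d = 0"
    by (simp add: d_def mult_linear)
  then show ?thesis
    using inner_square_unit[of d] by (simp add: d_def)
qed

lemma jsqrt_eqI: "positive s \<Longrightarrow> s \<star> s = a \<Longrightarrow> jsqrt a = s"
  unfolding jsqrt_def using positive_sqrt_unique by blast

end

subsection \<open>Boundedness of the product and diagonalization\<close>

text \<open>Banach-Steinhaus for the functionals \<open>y \<bullet> s\<close>. By Baire's theorem
  some \<open>T n\<close> contains a ball.\<close>

lemma uniform_boundedness_inner:
  fixes S :: "'a::{real_inner, complete_space} set"
  assumes "\<And>y. \<exists>B. \<forall>s\<in>S. \<bar>y \<bullet> s\<bar> \<le> B"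
  shows "\<exists>B. \<forall>s\<in>S. norm s \<le> B"
proof -
  define T where "T n = {y. \<forall>s\<in>S. \<bar>y \<bullet> s\<bar> \<le> real n}" for n :: nat
  have cl: "closed (T n)" for n
  proof -
    have "T n = (\<Inter>s\<in>S. {y. \<bar>y \<bullet> s\<bar> \<le> real n})" by (auto simp: T_def)
    moreover have "closed {y. \<bar>y \<bullet> s\<bar> \<le> real n}" for s :: 'a
      by (intro closed_Collect_le continuous_intros)
    ultimately show ?thesis by auto
  qed
  have un: "\<Union>(range T) = UNIV"
  proof -
    have "\<exists>n. y \<in> T n" for y
    proof -
      obtain B where "\<forall>s\<in>S. \<bar>y \<bullet> s\<bar> \<le> B" using assms by blast
      moreover obtain n where "B \<le> real n" using real_arch_simple by blast
      ultimately have "y \<in> T n" unfolding T_def using order_trans by blast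
      then show ?thesis ..
    qed
    then show ?thesis by blast
  qed
  have "\<exists>n. interior (T n) \<noteq> {}"
  proof (rule ccontr)
    assume "\<not> ?thesis"
    then have emp: "interior (T n) = {}" for n by blast
    have "Met_TC.mtopology interior_of \<Union>(range T) = {}"
    proof (rule Met_TC.metric_Baire_category_alt)
      show "Met_TC.mcomplete TYPE('a)"
        using complete_UNIV mcomplete_iff_complete by blast
    next
      fix U assume "U \<in> range T"
      then obtain n where "U = T n" by blast
      then show "closedin Met_TC.mtopology U \<and> Met_TC.mtopology interior_of U = {}"
        using cl[of n] emp[of n] by simp
    qed simp
    then show False by (simp add: un)
  qed
  then obtain n x e where e: "e > 0" "ball x e \<subseteq> T n"
    by (meson all_not_in_conv mem_interior)
  have "norm s \<le> 4 * real n / e" if s: "s \<in> S" for s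
  proof (cases "s = 0")
    case False
    \<comment> \<open>Half a radius from the centre in the direction of \<open>s\<close>: the
      functional changes by \<open>e * norm s / 2\<close> there, while both of its values are
      bounded by \<open>n\<close>.\<close>
    define y where "y = x + (e / (2 * norm s)) *\<^sub>R s"
    have "dist x y < e" using e False by (simp add: y_def dist_norm)
    then have "y \<in> T n" "x \<in> T n" using e by auto
    then have b: "\<bar>y \<bullet> s\<bar> \<le> real n" "\<bar>x \<bullet> s\<bar> \<le> real n" using s
      by (auto simp: T_def)
    have "(e / (2 * norm s)) * (s \<bullet> s) = y \<bullet> s - x \<bullet> s" by (simp add: y_def inner_add_left)
    also have "\<dots> \<le> 2 * real n" using b by linarith
    finally have "e * norm s / 2 \<le> 2 * real n"
      using False by (simp add: dot_square_norm power2_eq_square)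
    then show ?thesis using e by (simp add: field_simps)
  qed (use e in auto)
  then show ?thesis by blast
qed

context euclidean_jordan_algebra
begin

text \<open>The Hellinger-Toeplitz argument: a symmetric operator defined on the whole Hilbert space
  is bounded, since each test vector can be moved under the operator.\<close>

lemma mult_bounded_right: "\<exists>B. \<forall>y. norm y \<le> 1 \<longrightarrow> norm (x \<star> y) \<le> B"
proof -
  have "\<exists>B. \<forall>s \<in> (\<star>) x ` cball 0 1. norm s \<le> B"
  proof (rule uniform_boundedness_inner)
    fix y
    have "\<bar>y \<bullet> (x \<star> z)\<bar> \<le> norm (x \<star> y)" if "norm z \<le> 1" for z
    proof -
      have "\<bar>y \<bullet> (x \<star> z)\<bar> \<le> norm (x \<star> y) * norm z"
        unfolding inner_mult_swap[symmetric] by (rule Cauchy_Schwarz_ineq2)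
      also have "\<dots> \<le> norm (x \<star> y)" using that by (simp add: mult_left_le)
      finally show ?thesis .
    qed
    then show "\<exists>B. \<forall>s\<in>(\<star>) x ` cball 0 1. \<bar>y \<bullet> s\<bar> \<le> B"
      by (auto intro!: exI[of _ "norm (x \<star> y)"])
  qed
  then obtain B where "\<And>s. s \<in> (\<star>) x ` cball 0 1 \<Longrightarrow> norm s \<le> B" by blast
  then have "norm (x \<star> y) \<le> B" if "norm y \<le> 1" for y using that by simp
  then show ?thesis by blast
qed

text \<open>Separate boundedness becomes joint boundedness by a second use of uniform boundedness:
  against a fixed \<open>z\<close> the product \<open>x \<star> y\<close> pairs like
  \<open>z \<star> x\<close> with \<open>y\<close>.\<close>

lemma mult_bounded_ball: "\<exists>B. \<forall>x y. norm x \<le> 1 \<longrightarrow> norm y \<le> 1 \<longrightarrow> norm (x \<star> y) \<le> B"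
proof -
  have "\<exists>B. \<forall>s \<in> (\<lambda>(x, y). x \<star> y) ` (cball 0 1 \<times> cball 0 1). norm s \<le> B"
  proof (rule uniform_boundedness_inner)
    fix z
    obtain B where B: "\<And>y. norm y \<le> 1 \<Longrightarrow> norm (z \<star> y) \<le> B"
      using mult_bounded_right by blast
    have "\<bar>z \<bullet> (x \<star> y)\<bar> \<le> B" if "norm x \<le> 1" "norm y \<le> 1" for x y
    proof -
      have "z \<bullet> (x \<star> y) = (z \<star> x) \<bullet> y"
        using inner_mult_swap[of x z y] by (simp add: mult_commute)
      also have "\<bar>\<dots>\<bar> \<le> norm (z \<star> x) * norm y" by (rule Cauchy_Schwarz_ineq2)
      also have "\<dots> \<le> norm (z \<star> x)" using that by (simp add: mult_left_le)
      also have "\<dots> \<le> B" using B that by blast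
      finally show ?thesis .
    qed
    then show "\<exists>B. \<forall>s\<in>(\<lambda>(x, y). x \<star> y) ` (cball 0 1 \<times> cball 0 1). \<bar>z \<bullet> s\<bar> \<le> B"
      by (auto intro!: exI[of _ B])
  qed
  then obtain B where "\<And>s. s \<in> (\<lambda>(x, y). x \<star> y) ` (cball 0 1 \<times> cball 0 1) \<Longrightarrow> norm s \<le> B" by blast
  then have "norm (x \<star> y) \<le> B" if "norm x \<le> 1" "norm y \<le> 1" for x y using that by force
  then show ?thesis by blast
qed

lemma mult_bounded: "\<exists>C>0. \<forall>x y. norm (x \<star> y) \<le> C * norm x * norm y"
proof -
  obtain B where B: "\<And>x y. norm x \<le> 1 \<Longrightarrow> norm y \<le> 1 \<Longrightarrow> norm (x \<star> y) \<le> B"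
    using mult_bounded_ball by blast
  define C where "C = max B 1"
  have "norm (x \<star> y) \<le> C * norm x * norm y" for x y
  proof (cases "x = 0 \<or> y = 0")
    case False
    have "norm ((x /\<^sub>R norm x) \<star> (y /\<^sub>R norm y)) \<le> B" using False by (intro B) auto
    then have "norm (x \<star> y) \<le> B * norm x * norm y"
      using False by (simp add: mult_scaleR_left mult_scaleR_right field_simps)
    also have "\<dots> \<le> C * norm x * norm y" by (intro mult_right_mono) (auto simp: C_def)
    finally show ?thesis .
  qed auto
  then show ?thesis by (intro exI[of _ C]) (auto simp: C_def)
qed

definition mult_const :: real where
  "mult_const = (SOME C. C > 0 \<and> (\<forall>x y. norm (x \<star> y) \<le> C * norm x * norm y))"

lemma mult_const_pos: "0 < mult_const"
  and norm_mult_le: "norm (x \<star> y) \<le> mult_const * norm x * norm y"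
  using someI_ex[OF mult_bounded] unfolding mult_const_def by blast+

lemma bounded_bilinear_mult: "bounded_bilinear (\<star>)"
  using norm_mult_le
  by (intro bounded_bilinear.intro exI[of _ mult_const])
    (auto simp: mult_linear mult.commute mult.left_commute)

lemma tendsto_mult_jordan:
  "(f \<longlongrightarrow> a) F \<Longrightarrow> (g \<longlongrightarrow> b) F \<Longrightarrow> ((\<lambda>x. f x \<star> g x) \<longlongrightarrow> a \<star> b) F"
  using bounded_bilinear.tendsto[OF bounded_bilinear_mult] .

lemma closed_peirce: "closed (peirce i p)"
proof -
  have "continuous_on UNIV ((\<star>) p)"
    using bounded_bilinear.bounded_linear_right[OF bounded_bilinear_mult]
    by (rule linear_continuous_on)
  then show ?thesis
    unfolding peirce_def by (intro closed_Collect_eq continuous_intros) auto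
qed

text \<open>Nonzero idempotents stay away from 0; this is what limits the size of an orthogonal
  family.\<close>

lemma norm_idem_ge: "idem p \<Longrightarrow> p \<noteq> 0 \<Longrightarrow> 1 \<le> mult_const * norm p"
  using norm_mult_le[of p p] by (simp add: idem_def)

section \<open>Idempotents as limits of powers\<close>

lemma inner_jpow: "jpow x m \<bullet> jpow x n = jpow x (m + n) \<bullet> unit"
  using inner_mult_swap[of "jpow x n" unit "jpow x m"] jpow_add[of x n m]
  by (simp add: inner_commute add.commute)

lemma jpow_mult_assoc:
  assumes "y \<in> span (range (jpow x))"
  shows "jpow x m \<star> (jpow x n \<star> y) = jpow x (m + n) \<star> y"
  using assms
proof (induction rule: span_induct_alt)
  case (step c b y)
  then obtain k where "b = jpow x k" by blast
  with step show ?case by (simp add: mult_linear jpow_add add.assoc)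
qed simp

text \<open>The powers of \<open>x\<close> are rescaled by the operator norm of multiplication by \<open>x\<close> on their
  span, rather than on the whole space, because only there is it multiplicative under squaring.\<close>

lemma exists_scaling:
  assumes "x \<noteq> 0"
  obtains K where "0 < K" "\<And>y. y \<in> span (range (jpow x)) \<Longrightarrow> norm (x \<star> y) \<le> K * norm y"
    "\<And>M. (\<And>y. y \<in> span (range (jpow x)) \<Longrightarrow> norm (x \<star> y) \<le> M * norm y) \<Longrightarrow> K \<le> M"
proof -
  define A where "A = span (range (jpow x))"
  define Y where "Y = {norm (x \<star> y) / norm y | y. y \<in> A \<and> y \<noteq> 0}"
  have uA: "unit \<in> A" unfolding A_def by (metis jpow.simps(1) rangeI span_base)
  have un: "unit \<noteq> 0" using assms mult_unit mult_zero_left by metis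
  \<comment> \<open>The vector \<open>unit\<close> is the witness that the supremum is taken over a
    nonempty set and is positive.\<close>
  have mem: "norm x / norm unit \<in> Y" using uA un unfolding Y_def by force
  have bdd: "bdd_above Y"
  proof (rule bdd_aboveI[of _ "mult_const * norm x"])
    fix r assume "r \<in> Y"
    then obtain y where "r = norm (x \<star> y) / norm y" "y \<noteq> 0" unfolding Y_def by blast
    then show "r \<le> mult_const * norm x" using norm_mult_le[of x y] by (simp add: pos_divide_le_eq)
  qed
  show thesis
  proof
    have "0 < norm x / norm unit" using assms un by simp
    also have "\<dots> \<le> Sup Y" using mem bdd by (rule cSup_upper)
    finally show "0 < Sup Y" .
  next
    fix y assume y: "y \<in> span (range (jpow x))"
    show "norm (x \<star> y) \<le> Sup Y * norm y"
    proof (cases "y = 0")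
      case False
      then have "norm (x \<star> y) / norm y \<le> Sup Y"
        using y bdd by (intro cSup_upper) (auto simp: Y_def A_def)
      then show ?thesis using False by (simp add: pos_divide_le_eq)
    qed simp
  next
    fix M assume M: "\<And>y. y \<in> span (range (jpow x)) \<Longrightarrow> norm (x \<star> y) \<le> M * norm y"
    show "Sup Y \<le> M"
    proof (rule cSup_least)
      show "Y \<noteq> {}" using mem by blast
      fix r assume "r \<in> Y"
      then show "r \<le> M" using M by (auto simp: Y_def A_def pos_divide_le_eq)
    qed
  qed
qed

lemma jpow_scaleR: "jpow (c *\<^sub>R x) n = c ^ n *\<^sub>R jpow x n"
  by (induction n) (simp_all add: mult_linear mult.commute)

lemma span_jpow_scaleR: "span (range (jpow (c *\<^sub>R x))) \<subseteq> span (range (jpow x))"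
  by (rule span_minimal) (auto simp: jpow_scaleR span_base span_scale)

text \<open>Exponent 0 is excluded because \<open>S\<close> need not contain \<open>unit\<close>; it
  will be a Peirce space or an intersection of such.\<close>

lemma jpow_closed:
  assumes "\<And>u v. u \<in> S \<Longrightarrow> v \<in> S \<Longrightarrow> u \<star> v \<in> S" "x \<in> S" "0 < n"
  shows "jpow x n \<in> S"
  using assms(3)
proof (induction n)
  case (Suc n)
  then show ?case using assms by (cases "n = 0") auto
qed simp

text \<open>By \<open>le\<close> and \<open>ge\<close> multiplication by \<open>x\<close> has
  operator norm exactly 1 on the span of its powers. The limit \<open>e\<close> plays the role of
  the spectral projection for the eigenvalues 1 and -1 together: the powers lose the part of the
  spectrum of modulus below 1, and even powers forget the sign.\<close>

lemma exists_idem_eigen_normalized: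
  assumes S: "subspace S" "closed S" "\<And>u v. u \<in> S \<Longrightarrow> v \<in> S \<Longrightarrow> u \<star> v \<in> S" and "x \<in> S"
    and le: "\<And>y. y \<in> span (range (jpow x)) \<Longrightarrow> norm (x \<star> y) \<le> norm y"
    and ge: "\<And>M. (\<And>y. y \<in> span (range (jpow x)) \<Longrightarrow> norm (x \<star> y) \<le> M * norm y) \<Longrightarrow> 1 \<le> M"
  obtains e where "e \<in> S" "idem e" "e \<noteq> 0" "x \<star> (x \<star> e) = e" "e \<star> (x \<star> e) = x \<star> e"
    "(x \<star> e) \<star> (x \<star> e) = e"
proof -
  define A where "A = span (range (jpow x))"
  have pA: "jpow x n \<in> A" for n unfolding A_def by (simp add: span_base)
  have dec: "norm (jpow x (Suc n)) \<le> norm (jpow x n)" for n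
    using le pA by (simp add: A_def)
  then have anti: "decseq (\<lambda>n. norm (jpow x n))" by (rule decseq_SucI)
  \<comment> \<open>For the symmetric multiplication T by \<open>jpow x (2 ^ j)\<close> the square
    of the norm of Ty is the pairing of y with TTy, so a bound M for TT gives the bound
    \<open>sqrt M\<close> for T. The operator norm therefore cannot fall below 1 under repeated
    squaring.\<close>
  have two: "1 \<le> M" if "\<And>y. y \<in> A \<Longrightarrow> norm (jpow x (2 ^ j) \<star> y) \<le> M * norm y" for j M
    using that
  proof (induction j arbitrary: M)
    case 0
    then show ?case by (intro ge) (simp add: A_def)
  next
    case (Suc j)
    have sq: "(norm (jpow x (2 ^ j) \<star> y))\<^sup>2 \<le> M * (norm y)\<^sup>2" if y: "y \<in> A" for y
    proof -
      have "(norm (jpow x (2 ^ j) \<star> y))\<^sup>2 = y \<bullet> (jpow x (2 ^ Suc j) \<star> y)"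
        unfolding power2_norm_eq_inner inner_mult_swap
        using jpow_mult_assoc[of y x "2 ^ j" "2 ^ j"] y by (simp add: A_def mult_2)
      also have "\<dots> \<le> norm y * norm (jpow x (2 ^ Suc j) \<star> y)" by (rule norm_cauchy_schwarz)
      also have "\<dots> \<le> norm y * (M * norm y)" by (intro mult_left_mono Suc.prems y) auto
      finally show ?thesis by (simp add: power2_eq_square mult_ac)
    qed
    have "norm (jpow x (2 ^ j) \<star> y) \<le> sqrt M * norm y" if y: "y \<in> A" for y
      using real_sqrt_le_mono[OF sq[OF y]] by (simp add: real_sqrt_mult)
    then have "1 \<le> sqrt M" by (rule Suc.IH)
    then show ?case by simp
  qed
  have low2: "1 \<le> mult_const * norm (jpow x (2 ^ j))" for j
    by (rule two[of j]) (rule norm_mult_le)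
  \<comment> \<open>As n < 2^n and the norms decrease, the bound at powers of two reaches every
    exponent.\<close>
  have low: "1 \<le> mult_const * norm (jpow x n)" for n
  proof -
    have "norm (jpow x (2 ^ n)) \<le> norm (jpow x n)"
      using anti less_exp[of n] by (simp add: decseq_def)
    then show ?thesis
      using low2[of n] mult_const_pos by (meson mult_left_mono order.trans less_imp_le)
  qed
  define m where "m n = jpow x (2 * n) \<bullet> unit" for n
  have mn: "m n = (norm (jpow x n))\<^sup>2" for n
    unfolding m_def power2_norm_eq_inner inner_jpow by (simp add: mult_2)
  have "decseq m"
    unfolding decseq_def mn using anti by (auto simp: decseq_def intro!: power_mono)
  moreover have "0 \<le> m n" for n by (simp add: mn)
  ultimately obtain L where L: "m \<longlonglongrightarrow> L" using decseq_convergent by metis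
  define s where "s n = jpow x (2 * n)" for n
  \<comment> \<open>Inner products of powers depend only on the sum of the exponents, so the
    distance is a second difference of the convergent sequence \<open>m\<close>.\<close>
  have sd: "(norm (s i - s j))\<^sup>2 = m (2 * i) + m (2 * j) - 2 * m (i + j)" for i j
    unfolding power2_norm_eq_inner s_def m_def
    by (simp add: inner_diff_left inner_diff_right inner_jpow algebra_simps mult_2[symmetric])
  have "Cauchy s"
  proof (rule metric_CauchyI)
    fix e :: real assume e: "0 < e"
    \<comment> \<open>A quarter, because the limit is compared with four values of \<open>m\<close>,
      the mixed one being counted twice.\<close>
    have "\<exists>N. \<forall>n\<ge>N. norm (m n - L) < e\<^sup>2 / 4"
      using L e by (intro LIMSEQ_D) auto
    then obtain N where N: "\<And>n. n \<ge> N \<Longrightarrow> \<bar>m n - L\<bar> < e\<^sup>2 / 4" by auto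
    have "dist (s i) (s j) < e" if "i \<ge> N" "j \<ge> N" for i j
    proof -
      have "(norm (s i - s j))\<^sup>2 < e\<^sup>2"
        using N[of "2 * i"] N[of "2 * j"] N[of "i + j"] that unfolding sd by linarith
      then show ?thesis using e by (simp add: dist_norm power2_less_imp_less)
    qed
    then show "\<exists>M. \<forall>i\<ge>M. \<forall>j\<ge>M. dist (s i) (s j) < e" by blast
  qed
  then obtain e where e: "s \<longlonglongrightarrow> e"
    using Cauchy_convergent convergent_def by blast
  have s2: "(\<lambda>n. s (2 * n)) \<longlonglongrightarrow> e"
    "(\<lambda>n. s (2 * n + 1)) \<longlonglongrightarrow> e" "(\<lambda>n. s (Suc n)) \<longlonglongrightarrow> e"
    using LIMSEQ_subseq_LIMSEQ[OF e, of "\<lambda>n. 2 * n"]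
      LIMSEQ_subseq_LIMSEQ[OF e, of "\<lambda>n. 2 * n + 1"] LIMSEQ_Suc[OF e]
    by (simp_all add: o_def strict_mono_def)
  have xs: "(\<lambda>n. x \<star> s n) \<longlonglongrightarrow> x \<star> e"
    by (intro tendsto_mult_jordan e tendsto_const)
  have xs_eq: "x \<star> s n = jpow x (2 * n + 1)" for n by (simp add: s_def)
  show thesis
  proof
    \<comment> \<open>The shifted sequence is used because \<open>s 0\<close> is
      \<open>unit\<close>, which may lie outside \<open>S\<close>.\<close>
    show "e \<in> S"
    proof (rule closed_sequentially[OF S(2) _ s2(3)])
      show "s (Suc n) \<in> S" for n unfolding s_def by (rule jpow_closed) (use S assms(4) in auto)
    qed
    have "e \<star> e = e"
    proof (rule LIMSEQ_unique)
      show "(\<lambda>n. s n \<star> s n) \<longlonglongrightarrow> e \<star> e" by (intro tendsto_mult_jordan e)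
      show "(\<lambda>n. s n \<star> s n) \<longlonglongrightarrow> e" using s2(1) by (simp add: s_def jpow_add mult_2)
    qed
    then show "idem e" by (simp add: idem_def)
    have "1 \<le> mult_const * norm e"
    proof (rule LIMSEQ_le_const)
      show "(\<lambda>n. mult_const * norm (s n)) \<longlonglongrightarrow> mult_const * norm e"
        by (intro tendsto_intros e)
      show "\<exists>N. \<forall>n\<ge>N. 1 \<le> mult_const * norm (s n)" using low by (simp add: s_def)
    qed
    then show "e \<noteq> 0" by auto
    show "x \<star> (x \<star> e) = e"
    proof (rule LIMSEQ_unique)
      show "(\<lambda>n. x \<star> (x \<star> s n)) \<longlonglongrightarrow> x \<star> (x \<star> e)"
        by (intro tendsto_mult_jordan xs tendsto_const)
      show "(\<lambda>n. x \<star> (x \<star> s n)) \<longlonglongrightarrow> e" using s2(3) by (simp add: s_def)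
    qed
    show "e \<star> (x \<star> e) = x \<star> e"
    proof (rule LIMSEQ_unique)
      show "(\<lambda>n. s n \<star> (x \<star> s n)) \<longlonglongrightarrow> e \<star> (x \<star> e)"
        by (intro tendsto_mult_jordan xs e)
      have "(\<lambda>n. x \<star> s (2 * n)) \<longlonglongrightarrow> x \<star> e"
        by (intro tendsto_mult_jordan s2 tendsto_const)
      moreover have "s n \<star> (x \<star> s n) = x \<star> s (2 * n)" for n
        unfolding xs_eq unfolding s_def jpow_add by (simp add: mult_2)
      ultimately show "(\<lambda>n. s n \<star> (x \<star> s n)) \<longlonglongrightarrow> x \<star> e" by simp
    qed
    show "(x \<star> e) \<star> (x \<star> e) = e"
    proof (rule LIMSEQ_unique)
      show "(\<lambda>n. (x \<star> s n) \<star> (x \<star> s n)) \<longlonglongrightarrow> (x \<star> e) \<star> (x \<star> e)" by (intro tendsto_mult_jordan xs)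
      have "(x \<star> s n) \<star> (x \<star> s n) = s (2 * n + 1)" for n
        unfolding xs_eq unfolding s_def jpow_add by (simp add: mult_2)
      then show "(\<lambda>n. (x \<star> s n) \<star> (x \<star> s n)) \<longlonglongrightarrow> e" using s2(2) by simp
    qed
  qed
qed

lemma exists_idem_eigen:
  assumes S: "subspace S" "closed S" "\<And>u v. u \<in> S \<Longrightarrow> v \<in> S \<Longrightarrow> u \<star> v \<in> S"
    and y: "y \<in> S" "y \<noteq> 0"
  obtains f c where "f \<in> S" "idem f" "f \<noteq> 0" "y \<star> f = c *\<^sub>R f" "c \<noteq> 0"
proof -
  obtain K where K: "0 < K" "\<And>z. z \<in> span (range (jpow y)) \<Longrightarrow> norm (y \<star> z) \<le> K * norm z"
    "\<And>M. (\<And>z. z \<in> span (range (jpow y)) \<Longrightarrow> norm (y \<star> z) \<le> M * norm z) \<Longrightarrow> K \<le> M"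
    using exists_scaling[OF y(2)] by metis
  define x where "x = (1 / K) *\<^sub>R y"
  have yx: "y = K *\<^sub>R x" using K(1) by (simp add: x_def)
  have sp1: "span (range (jpow x)) \<subseteq> span (range (jpow y))"
    unfolding x_def by (rule span_jpow_scaleR)
  have sp2: "span (range (jpow y)) \<subseteq> span (range (jpow x))"
    unfolding yx by (rule span_jpow_scaleR)
  have nxy: "norm (y \<star> z) = K * norm (x \<star> z)" for z
    using K(1) by (simp add: yx mult_scaleR_left)
  have xS: "x \<in> S" using S(1) y(1) by (simp add: x_def subspace_scale)
  have le: "norm (x \<star> z) \<le> norm z" if "z \<in> span (range (jpow x))" for z
    using K(1) K(2)[of z] sp1 that by (auto simp: nxy)
  have ge: "1 \<le> M" if M: "\<And>z. z \<in> span (range (jpow x)) \<Longrightarrow> norm (x \<star> z) \<le> M * norm z" for M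
  proof -
    have "K \<le> K * M"
      using K(1) M sp2 by (intro K(3)) (auto simp: nxy mult.assoc)
    then show ?thesis using K(1) by simp
  qed
  obtain e where e: "e \<in> S" "idem e" "e \<noteq> 0" "x \<star> (x \<star> e) = e" "e \<star> (x \<star> e) = x \<star> e"
    "(x \<star> e) \<star> (x \<star> e) = e"
    using exists_idem_eigen_normalized[OF S xS le ge] by metis
  \<comment> \<open>Multiplication by \<open>x\<close> acts on \<open>e\<close> as an involution, so
    \<open>e\<close> splits into idempotents for the eigenvalues 1 and -1. They add up to
    \<open>e\<close>, so one of them is nonzero.\<close>
  define f where "f c = (1/2) *\<^sub>R (e + c *\<^sub>R (x \<star> e))" for c :: real
  have f: "f c \<in> S" "idem (f c)" "y \<star> f c = (c * K) *\<^sub>R f c" if c: "c = 1 \<or> c = -1" for c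
  proof -
    have cc: "c * c = 1" using c by auto
    show "f c \<in> S"
      unfolding f_def using S xS e(1) by (intro subspace_scale subspace_add) auto
    define z where "z = e + c *\<^sub>R (x \<star> e)"
    have "z \<star> z = z + z"
      using e(2,5,6) cc mult_commute[of "x \<star> e" e]
      by (simp add: idem_def z_def mult_linear scaleR_add_right)
    then show "idem (f c)"
      by (simp add: idem_def f_def mult_scaleR_left mult_scaleR_right flip: z_def scaleR_2)
    have "x \<star> f c = c *\<^sub>R f c"
      using cc e(4) by (simp add: f_def mult_linear scaleR_add_right)
    then show "y \<star> f c = (c * K) *\<^sub>R f c"
      by (simp add: yx mult_scaleR_left mult.commute)
  qed
  have "f 1 + f (-1) = e"
    by (simp add: f_def scaleR_add_right scaleR_diff_right flip: scaleR_add_left)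
  then consider "f 1 \<noteq> 0" | "f (-1) \<noteq> 0" using e(3) by fastforce
  then show thesis
  proof cases
    case 1
    then show ?thesis using that[OF f(1)[of 1] f(2)[of 1] _ f(3)[of 1]] K(1) by simp
  next
    case 2
    then show ?thesis using that[OF f(1)[of "-1"] f(2)[of "-1"] _ f(3)[of "-1"]] K(1) by simp
  qed
qed

section \<open>Orthogonal families of idempotents and frames\<close>

definition orth_idems :: "'a set \<Rightarrow> bool" where
  "orth_idems F \<longleftrightarrow> finite F \<and> (\<forall>p\<in>F. idem p \<and> p \<noteq> 0) \<and> (\<forall>p\<in>F. \<forall>q\<in>F. p \<noteq> q \<longrightarrow> p \<star> q = 0)"

lemma orth_idems_mult_sum:
  assumes "orth_idems F" "G \<subseteq> F" "p \<in> F"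
  shows "p \<star> (\<Sum>q\<in>G. c q *\<^sub>R q) = (if p \<in> G then c p *\<^sub>R p else 0)"
proof -
  have "finite G" using assms finite_subset unfolding orth_idems_def by blast
  have "p \<star> (\<Sum>q\<in>G. c q *\<^sub>R q) = (\<Sum>q\<in>G. if q = p then c p *\<^sub>R p else 0)"
    unfolding mult_sum_right
    by (rule sum.cong[OF refl])
      (use assms in \<open>auto simp: orth_idems_def idem_def mult_linear\<close>)
  then show ?thesis using \<open>finite G\<close> by simp
qed

lemma orth_idems_mult_sum_one:
  assumes "orth_idems F" "p \<in> F" shows "p \<star> \<Sum>F = p"
  using orth_idems_mult_sum[OF assms(1) order_refl assms(2), of "\<lambda>_. 1"] assms(2) by simp

text \<open>The sum of the family is idempotent, so its squared norm is its pairing with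
  \<open>unit\<close>, and Cauchy-Schwarz bounds it by the norm of \<open>unit\<close>. Each member
  contributes at least \<open>1 / mult_const\<^sup>2\<close> to this pairing.\<close>

lemma orth_idems_card:
  assumes "orth_idems F"
  shows "real (card F) \<le> (mult_const * norm unit)\<^sup>2"
proof -
  have i: "p \<bullet> p = p \<bullet> unit" if "idem p" for p
    using inner_square_unit[of p] that by (simp add: idem_def)
  have "\<Sum>F \<star> \<Sum>F = (\<Sum>p\<in>F. p \<star> \<Sum>F)" by (rule mult_sum_left)
  then have "idem (\<Sum>F)" using orth_idems_mult_sum_one[OF assms] by (simp add: idem_def)
  then have s: "(norm (\<Sum>F))\<^sup>2 = \<Sum>F \<bullet> unit" by (simp add: power2_norm_eq_inner i)
  have "\<Sum>F \<bullet> unit \<le> norm (\<Sum>F) * norm unit" by (rule norm_cauchy_schwarz)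
  then have "norm (\<Sum>F) * norm (\<Sum>F) \<le> norm (\<Sum>F) * norm unit"
    using s by (simp add: power2_eq_square)
  then have "norm (\<Sum>F) \<le> norm unit"
    by (cases "\<Sum>F = 0") (auto simp: mult_le_cancel_left)
  then have "\<Sum>F \<bullet> unit \<le> (norm unit)\<^sup>2"
    unfolding s[symmetric] by (rule power_mono) simp
  moreover have "real (card F) \<le> mult_const\<^sup>2 * (\<Sum>F \<bullet> unit)"
  proof -
    have "real (card F) = (\<Sum>p\<in>F. 1)" by simp
    also have "\<dots> \<le> (\<Sum>p\<in>F. mult_const\<^sup>2 * (p \<bullet> unit))"
    proof (rule sum_mono)
      fix p assume "p \<in> F"
      then have p: "idem p" "p \<noteq> 0" using assms by (auto simp: orth_idems_def)
      have "1 \<le> (mult_const * norm p)\<^sup>2" using norm_idem_ge[OF p] by simp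
      then show "1 \<le> mult_const\<^sup>2 * (p \<bullet> unit)"
        using i[OF p(1)] by (simp add: power_mult_distrib power2_norm_eq_inner)
    qed
    also have "\<dots> = mult_const\<^sup>2 * (\<Sum>F \<bullet> unit)" by (simp add: inner_sum_left sum_distrib_left)
    finally show ?thesis .
  qed
  moreover have "mult_const\<^sup>2 * (\<Sum>F \<bullet> unit) \<le> mult_const\<^sup>2 * (norm unit)\<^sup>2"
    using calculation(1) by (rule mult_left_mono) simp
  ultimately show ?thesis by (simp add: power_mult_distrib)
qed

lemma orth_idems_insert:
  assumes "orth_idems F" "idem h" "h \<noteq> 0" "\<And>p. p \<in> F \<Longrightarrow> p \<star> h = 0"
  shows "orth_idems (insert h F)" "h \<notin> F"
proof -
  have "h \<star> p = 0" if "p \<in> F" for p using assms(4)[OF that] by (simp add: mult_commute)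
  then show "orth_idems (insert h F)" using assms by (auto simp: orth_idems_def)
  show "h \<notin> F" using assms(2-4) by (auto simp: idem_def)
qed

text \<open>One-dimensionality of the Peirce space, rather than minimality, is required, because the
  block computations read off scalars from it. An idempotent without it splits, by
  \<open>exists_idem_eigen\<close>.\<close>

definition primitive :: "'a \<Rightarrow> bool" where
  "primitive p \<longleftrightarrow> idem p \<and> p \<noteq> 0 \<and> (\<forall>x\<in>peirce 1 p. \<exists>c. x = c *\<^sub>R p)"

definition frame :: "'a set \<Rightarrow> bool" where
  "frame F \<longleftrightarrow> orth_idems F \<and> (\<forall>p\<in>F. primitive p) \<and> \<Sum>F = unit"

text \<open>An orthogonal family of eigenvectors of maximal cardinality is the required frame: what is
  left over contains a further eigenvector, and a non-primitive member splits.\<close>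

theorem exists_frame:
  obtains F c where "frame F" "a = (\<Sum>p\<in>F. c p *\<^sub>R p)"
proof -
  define P where "P F \<longleftrightarrow> orth_idems F \<and> (\<forall>p\<in>F. \<exists>c. a \<star> p = c *\<^sub>R p)" for F
  have "P {}" by (simp add: P_def orth_idems_def)
  moreover have "\<forall>F. P F \<longrightarrow> card F < Suc (nat \<lceil>(mult_const * norm unit)\<^sup>2\<rceil>)"
  proof (intro allI impI)
    fix F assume "P F"
    then have "real (card F) \<le> (mult_const * norm unit)\<^sup>2" using orth_idems_card P_def by blast
    then show "card F < Suc (nat \<lceil>(mult_const * norm unit)\<^sup>2\<rceil>)" by linarith
  qed
  ultimately obtain F where F: "P F" and max: "\<And>G. P G \<Longrightarrow> card G \<le> card F"
    using ex_has_greatest_nat[of P "{}" card] by metis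
  have o: "orth_idems F" and fin: "finite F" using F by (auto simp: P_def orth_idems_def)
  obtain c where c: "\<And>p. p \<in> F \<Longrightarrow> a \<star> p = c p *\<^sub>R p" using F unfolding P_def by metis
  \<comment> \<open>Idempotents in this closed subalgebra are exactly those that can be appended to
    \<open>F\<close> as far as orthogonality goes.\<close>
  define S where "S = (\<Inter>p\<in>F. peirce 0 p)"
  have no: "h = 0" if h: "h \<in> S" "idem h" "\<exists>c. a \<star> h = c *\<^sub>R h" for h
  proof (rule ccontr)
    assume "h \<noteq> 0"
    moreover have "p \<star> h = 0" if "p \<in> F" for p using h(1) that by (auto simp: S_def peirce_def)
    ultimately have "orth_idems (insert h F)" "h \<notin> F" using orth_idems_insert[OF o h(2)] by blast+
    then have "P (insert h F)" using h F by (auto simp: P_def)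
    then have "card (insert h F) \<le> card F" by (rule max)
    then show False using \<open>h \<notin> F\<close> fin by simp
  qed
  \<comment> \<open>What the family lacks to \<open>unit\<close>. Multiplying it by \<open>a\<close>
    gives the undiagonalized remainder \<open>y\<close>.\<close>
  define g where "g = unit - \<Sum>F"
  have gS: "p \<star> g = 0" if "p \<in> F" for p
    using orth_idems_mult_sum_one[OF o that] by (simp add: g_def mult_linear)
  define y where "y = a - (\<Sum>p\<in>F. c p *\<^sub>R p)"
  have ag: "a \<star> g = y" by (simp add: g_def y_def mult_linear mult_sum_right c)
  have yS: "y \<in> S"
    unfolding S_def
  proof
    fix p assume p: "p \<in> F"
    have "p \<star> y = p \<star> a - p \<star> (\<Sum>p\<in>F. c p *\<^sub>R p)" by (simp add: y_def mult_diff_right)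
    also have "\<dots> = 0"
      using orth_idems_mult_sum[OF o order_refl p, of c] c[OF p] p by (simp add: mult_commute[of p a])
    finally show "y \<in> peirce 0 p" by (simp add: peirce_def)
  qed
  have y0: "y = 0"
  proof (rule ccontr)
    assume "y \<noteq> 0"
    have sub: "subspace S" unfolding S_def by (intro subspace_Inter) (auto simp: subspace_peirce)
    have cl: "closed S" unfolding S_def by (intro closed_INT) (auto simp: closed_peirce)
    have mul: "u \<star> v \<in> S" if "u \<in> S" "v \<in> S" for u v
      unfolding S_def
    proof
      fix p assume p: "p \<in> F"
      have "idem p" using o p by (simp add: orth_idems_def)
      moreover have "u \<in> peirce 0 p" "v \<in> peirce 0 p" using that p by (auto simp: S_def)
      ultimately show "u \<star> v \<in> peirce 0 p" by (rule peirce_zero_mult)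
    qed
    \<comment> \<open>An eigen-idempotent of the remainder is also one of \<open>a\<close>, since
      \<open>F\<close> annihilates it, and it would enlarge the family.\<close>
    obtain f d where f: "f \<in> S" "idem f" "f \<noteq> 0" "y \<star> f = d *\<^sub>R f" "d \<noteq> 0"
      using exists_idem_eigen[OF sub cl mul yS \<open>y \<noteq> 0\<close>] .
    have "p \<star> f = 0" if "p \<in> F" for p using f(1) that by (auto simp: S_def peirce_def)
    then have "y \<star> f = a \<star> f" by (simp add: y_def mult_linear mult_sum_left)
    then have "a \<star> f = d *\<^sub>R f" using f(4) by simp
    then show False using no[OF f(1,2)] f(3) by blast
  qed
  have "g \<star> g = g"
  proof -
    have "g \<star> \<Sum>F = 0" using gS by (simp add: mult_sum_right mult_commute[of g])
    then show ?thesis by (subst (2) g_def) (simp add: mult_diff_right)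
  qed
  \<comment> \<open>With \<open>y = 0\<close> the idempotent \<open>g\<close> is itself an
    eigenvector of \<open>a\<close>, for eigenvalue 0, so maximality excludes it unless it
    vanishes.\<close>
  then have "g = 0" using no[of g] gS ag y0 by (auto simp: S_def peirce_def idem_def)
  then have sumF: "\<Sum>F = unit" by (simp add: g_def)
  have prim: "primitive p" if p: "p \<in> F" for p
  proof (rule ccontr)
    have ip: "idem p" "p \<noteq> 0" using o p by (auto simp: orth_idems_def)
    assume "\<not> primitive p"
    then obtain x where x: "x \<in> peirce 1 p" "\<And>d. x \<noteq> d *\<^sub>R p" using ip by (auto simp: primitive_def)
    have "x \<noteq> 0" using x(2)[of 0] by auto
    obtain h d where h: "h \<in> peirce 1 p" "idem h" "h \<noteq> 0" "x \<star> h = d *\<^sub>R h" "d \<noteq> 0"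
      using exists_idem_eigen[OF subspace_peirce closed_peirce peirce_one_mult[OF ip(1)] x(1) \<open>x \<noteq> 0\<close>] .
    have ph: "p \<star> h = h" "h \<star> p = h" using h(1) by (auto simp: peirce_def mult_commute)
    have "h \<noteq> p"
    proof
      assume "h = p"
      then have "x = d *\<^sub>R p" using x(1) h(4) by (simp add: peirce_def mult_commute)
      then show False using x(2) by blast
    qed
    define k where "k = p - h"
    have k: "idem k" "k \<noteq> 0" "h \<star> k = 0" "p \<star> k = k"
      using \<open>h \<noteq> p\<close> ip h(2) ph unfolding idem_def by (simp_all add: k_def mult_linear)
    \<comment> \<open>On the Peirce space of \<open>p\<close> the element \<open>a\<close> acts as
      the scalar \<open>c p\<close>, so both parts of the splitting \<open>p = h + k\<close> are
      eigenvectors again and replacing \<open>p\<close> by them enlarges the family.\<close>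
    have "a - c p *\<^sub>R p \<in> peirce 0 p"
      using c[OF p] ip by (simp add: peirce_def idem_def mult_linear mult_commute)
    then have "h \<star> (a - c p *\<^sub>R p) = 0" using peirce_one_zero[OF ip(1) h(1)] by blast
    then have ah: "a \<star> h = c p *\<^sub>R h" by (simp add: mult_linear ph mult_commute)
    then have ak: "a \<star> k = c p *\<^sub>R k" using c[OF p] by (simp add: k_def mult_linear scaleR_diff_right)
    define G where "G = F - {p}"
    have G: "orth_idems G" using o by (auto simp: G_def orth_idems_def)
    have qh: "q \<star> h = 0" "q \<star> k = 0" if "q \<in> G" for q
    proof -
      have "q \<star> p = 0" "q \<in> peirce 0 p" using that o p by (auto simp: G_def orth_idems_def peirce_def)
      then show "q \<star> h = 0" using peirce_one_zero[OF ip(1) h(1)] by (simp add: mult_commute[of q h])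
      then show "q \<star> k = 0" using \<open>q \<star> p = 0\<close> by (simp add: k_def mult_linear)
    qed
    have 1: "orth_idems (insert k G)" "k \<notin> G"
      using orth_idems_insert[OF G k(1,2)] qh by blast+
    have 2: "orth_idems (insert h (insert k G))" "h \<notin> insert k G"
      using orth_idems_insert[OF 1(1) h(2,3)] qh k(3) mult_commute[of k h] by auto
    have "P (insert h (insert k G))" using 2 ah ak F by (auto simp: P_def G_def)
    then have "card (insert h (insert k G)) \<le> card F" by (rule max)
    moreover have "card F = Suc (card G)" using p fin by (simp add: G_def card_Suc_Diff1 del: card_Diff_insert)
    ultimately show False using 1 2 fin by (simp add: G_def)
  qed
  show thesis
  proof
    show "frame F" using o prim sumF by (simp add: frame_def)
    show "a = (\<Sum>p\<in>F. c p *\<^sub>R p)" using y0 by (simp add: y_def)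
  qed
qed

subsection \<open>Off-diagonal blocks of a frame\<close>

definition offdiag :: "'a \<Rightarrow> 'a \<Rightarrow> 'a set" where
  "offdiag p q = peirce (1/2) p \<inter> peirce (1/2) q"

lemma offdiag_commute: "offdiag p q = offdiag q p"
  by (auto simp: offdiag_def)

lemma subspace_offdiag: "subspace (offdiag p q)"
  unfolding offdiag_def by (intro subspace_inter subspace_peirce)

lemma offdiag_mult:
  assumes "x \<in> offdiag p q"
  shows "p \<star> x = (1/2) *\<^sub>R x" "q \<star> x = (1/2) *\<^sub>R x" "(p + q) \<star> x = x"
  using assms by (simp_all add: offdiag_def peirce_def mult_linear flip: scaleR_add_left)

text \<open>Since \<open>b\<close> has eigenvalue 0 for \<open>a\<close>, multiplication by it
  annihilates the Peirce space for 1 and preserves the others. Only the 1/2 part of \<open>x\<close>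
  survives both multiplications.\<close>

lemma idem_mult_mult_offdiag:
  assumes "idem p" "idem q" "p \<star> q = 0" shows "p \<star> (q \<star> x) \<in> offdiag p q"
proof -
  have half: "a \<star> (b \<star> x) \<in> peirce (1/2) a" if ab: "idem a" "a \<star> b = 0" for a b
  proof -
    obtain x1 xh x0 where x: "x = x1 + xh + x0"
      "x1 \<in> peirce 1 a" "xh \<in> peirce (1/2) a" "x0 \<in> peirce 0 a"
      using peirce_decomposition[OF ab(1)] .
    have b: "b \<in> peirce 0 a" using ab by (simp add: peirce_def)
    have "a \<star> (b \<star> x) = b \<star> (a \<star> x)" by (rule orthogonal_idem_commute[OF ab])
    also have "\<dots> = (1/2) *\<^sub>R (b \<star> xh)"
      using x peirce_one_zero[OF ab(1) x(2) b]
      by (simp add: peirce_def mult_linear mult_commute[of b x1])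
    finally show ?thesis
      using peirce_zero_mult[OF ab(1) b x(3)] subspace_peirce by (simp add: subspace_scale)
  qed
  show ?thesis
    using half[OF assms(1,3)] half[of q p] orthogonal_idem_commute[OF assms(1,3), of x] assms
      mult_commute[of q p]
    by (simp add: offdiag_def)
qed

lemma frame_idem: "frame F \<Longrightarrow> p \<in> F \<Longrightarrow> idem p"
  and frame_nonzero: "frame F \<Longrightarrow> p \<in> F \<Longrightarrow> p \<noteq> 0"
  and frame_primitive: "frame F \<Longrightarrow> p \<in> F \<Longrightarrow> primitive p"
  and frame_orthogonal: "frame F \<Longrightarrow> p \<in> F \<Longrightarrow> q \<in> F \<Longrightarrow> p \<noteq> q \<Longrightarrow> p \<star> q = 0"
  and frame_finite: "frame F \<Longrightarrow> finite F"
  and frame_sum: "frame F \<Longrightarrow> \<Sum>F = unit"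
  by (auto simp: frame_def orth_idems_def)

lemma frame_idem_add:
  assumes "frame F" "p \<in> F" "q \<in> F" "p \<noteq> q" shows "idem (p + q)"
  using idem_add frame_idem frame_orthogonal assms by blast

text \<open>For each \<open>p\<close> the terms that involve it first add up to
  \<open>p \<star> x\<close>. The double sum runs over ordered pairs, so each block occurs twice;
  hence 2 instead of the factor 4 of the block projection.\<close>

lemma frame_decomposition:
  assumes "frame F"
  shows "x = (\<Sum>p\<in>F. quad_rep p x) + (\<Sum>p\<in>F. \<Sum>q\<in>F - {p}. 2 *\<^sub>R (p \<star> (q \<star> x)))"
proof -
  have i: "(\<Sum>p\<in>F. p \<star> y) = y" for y
    using mult_sum_left[of "\<lambda>p. p" F y] frame_sum[OF assms] by simp
  have "quad_rep p x + (\<Sum>q\<in>F - {p}. 2 *\<^sub>R (p \<star> (q \<star> x))) = 2 *\<^sub>R (p \<star> x) - p \<star> x"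
    if "p \<in> F" for p
  proof -
    have "(\<Sum>q\<in>F. 2 *\<^sub>R (p \<star> (q \<star> x)))
        = 2 *\<^sub>R (p \<star> (p \<star> x)) + (\<Sum>q\<in>F - {p}. 2 *\<^sub>R (p \<star> (q \<star> x)))"
      using that frame_finite[OF assms] by (rule sum.remove[rotated])
    moreover have "(\<Sum>q\<in>F. 2 *\<^sub>R (p \<star> (q \<star> x))) = 2 *\<^sub>R (p \<star> x)"
      by (simp add: i flip: scaleR_sum_right mult_sum_right)
    ultimately show ?thesis
      using frame_idem[OF assms that] by (simp add: quad_rep_idem algebra_simps)
  qed
  then have "(\<Sum>p\<in>F. quad_rep p x) + (\<Sum>p\<in>F. \<Sum>q\<in>F - {p}. 2 *\<^sub>R (p \<star> (q \<star> x)))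
      = (\<Sum>p\<in>F. 2 *\<^sub>R (p \<star> x) - p \<star> x)"
    by (simp flip: sum.distrib)
  also have "\<dots> = x"
    by (simp add: sum_subtractf i scaleR_2 flip: scaleR_sum_right)
  finally show ?thesis by simp
qed

lemma frame_subspace_eq_UNIV:
  assumes F: "frame F" and T: "subspace T"
    and "\<And>p. p \<in> F \<Longrightarrow> p \<in> T"
    and "\<And>p q x. p \<in> F \<Longrightarrow> q \<in> F \<Longrightarrow> p \<noteq> q \<Longrightarrow> x \<in> offdiag p q \<Longrightarrow> x \<in> T"
  shows "x \<in> T"
proof -
  have "quad_rep p x \<in> T" if p: "p \<in> F" for p
  proof -
    obtain c where "quad_rep p x = c *\<^sub>R p"
      using frame_primitive[OF F p] quad_rep_in_peirce_one unfolding primitive_def by blast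
    then show ?thesis using assms(3)[OF p] T by (simp add: subspace_scale)
  qed
  moreover have "2 *\<^sub>R (p \<star> (q \<star> x)) \<in> T" if "p \<in> F" "q \<in> F - {p}" for p q
    using that assms(4)[of p q "p \<star> (q \<star> x)"] idem_mult_mult_offdiag[of p q x]
      frame_idem[OF F] frame_orthogonal[OF F, of p q] T
    by (auto intro: subspace_scale)
  ultimately have "(\<Sum>p\<in>F. quad_rep p x) + (\<Sum>p\<in>F. \<Sum>q\<in>F - {p}. 2 *\<^sub>R (p \<star> (q \<star> x))) \<in> T"
    using T by (intro subspace_add subspace_sum) auto
  then show ?thesis using frame_decomposition[OF F, of x] by simp
qed

lemma frame_linear_eqI:
  assumes F: "frame F" and f: "linear f" and g: "linear (g :: 'a \<Rightarrow> 'a)"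
    and "\<And>p. p \<in> F \<Longrightarrow> f p = g p"
    and "\<And>p q x. p \<in> F \<Longrightarrow> q \<in> F \<Longrightarrow> p \<noteq> q \<Longrightarrow> x \<in> offdiag p q \<Longrightarrow> f x = g x"
  shows "f x = g x"
proof -
  have "subspace {x. f x = g x}"
    using f g by (simp add: subspace_def linear_0 linear_add linear_scale)
  then have "x \<in> {x. f x = g x}"
    by (rule frame_subspace_eq_UNIV[OF F]) (use assms in auto)
  then show ?thesis by simp
qed

text \<open>The square has no 1/2 part and both idempotents are primitive, so it is
  \<open>a p + b q\<close>. Computing the fourth power of \<open>x\<close> in two ways forces
  \<open>a = b\<close>, and pairing with \<open>p\<close> yields the constant.\<close>

lemma offdiag_square:
  assumes p: "primitive p" and q: "primitive q" and pq: "p \<star> q = 0" and x: "x \<in> offdiag p q"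
  shows "x \<star> x = (x \<bullet> x / (2 * (p \<bullet> p))) *\<^sub>R (p + q)"
proof -
  note px = offdiag_mult[OF x]
  have ip: "idem p" "p \<star> p = p" and iq: "idem q" "q \<star> q = q" and nz: "p \<noteq> 0" "q \<noteq> 0"
    using p q by (auto simp: primitive_def idem_def)
  have qp: "q \<star> p = 0" using pq by (simp add: mult_commute)
  have ie: "idem (p + q)" using ip iq pq by (simp add: idem_add)
  have xh: "x \<in> peirce (1/2) p" using x by (simp add: offdiag_def)
  obtain a where a: "p \<star> (x \<star> x) = a *\<^sub>R p"
    using peirce_half_mult(1)[OF ip(1) xh xh] p unfolding primitive_def by blast
  define y where "y = x \<star> x - a *\<^sub>R p"
  have "p \<star> y = 0"
    using a by (simp add: y_def mult_linear ip)
  moreover have "(p + q) \<star> y = y"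
  proof -
    have "x \<star> x \<in> peirce 1 (p + q)"
      using px(3) by (intro peirce_one_mult[OF ie]) (simp_all add: peirce_def)
    then show ?thesis by (simp add: y_def peirce_def mult_linear ip qp)
  qed
  ultimately have "q \<star> y = y" by (simp add: mult_linear)
  then obtain b where b: "y = b *\<^sub>R q" using q unfolding primitive_def peirce_def by auto
  have xx: "x \<star> x = a *\<^sub>R p + b *\<^sub>R q" using b by (simp add: y_def algebra_simps)
  have x3: "x \<star> (x \<star> x) = ((a + b) / 2) *\<^sub>R x"
    using px by (simp add: xx mult_linear mult_commute[of x p] mult_commute[of x q] add_divide_distrib scaleR_add_left)
  have "(x \<star> x) \<star> (x \<star> x) = x \<star> (x \<star> (x \<star> x))"
    using jpow_add[of x "Suc (Suc 0)" "Suc (Suc 0)"] by simp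
  also have "\<dots> = ((a + b) / 2) *\<^sub>R (x \<star> x)" by (simp only: x3 mult_scaleR_right)
  also have "\<dots> = ((a + b) / 2) *\<^sub>R (a *\<^sub>R p + b *\<^sub>R q)" by (simp only: xx)
  finally have x4: "(a * a) *\<^sub>R p + (b * b) *\<^sub>R q = ((a + b) / 2 * a) *\<^sub>R p + ((a + b) / 2 * b) *\<^sub>R q"
    by (simp add: xx mult_linear ip iq pq qp scaleR_add_right)
  have "(a * a) *\<^sub>R p = ((a + b) / 2 * a) *\<^sub>R p" "(b * b) *\<^sub>R q = ((a + b) / 2 * b) *\<^sub>R q"
    using arg_cong[OF x4, of "\<lambda>z. p \<star> z"] arg_cong[OF x4, of "\<lambda>z. q \<star> z"]
    by (simp_all add: mult_linear ip iq pq qp)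
  then have "a * a = (a + b) / 2 * a" "b * b = (a + b) / 2 * b"
    using nz scaleR_cancel_right by blast+
  then have ab: "a = b" by (auto simp: field_simps)
  have "a * (p \<bullet> p) = (p \<star> (x \<star> x)) \<bullet> p" by (simp add: a)
  also have "\<dots> = (x \<star> x) \<bullet> p" by (simp add: inner_mult_swap ip)
  also have "\<dots> = x \<bullet> (x \<star> p)" by (rule inner_mult_swap)
  also have "\<dots> = (x \<bullet> x) / 2" by (simp add: mult_commute[of x p] px)
  finally have "a = x \<bullet> x / (2 * (p \<bullet> p))" using nz by (simp add: field_simps)
  then show ?thesis using xx ab by (simp add: scaleR_add_right)
qed

text \<open>Polarization of \<open>offdiag_square\<close>. It makes the algebra of \<open>p\<close>,
  \<open>q\<close> and their block a spin factor.\<close>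

lemma offdiag_product:
  assumes "primitive p" "primitive q" "p \<star> q = 0" "x \<in> offdiag p q" "y \<in> offdiag p q"
  shows "x \<star> y = (x \<bullet> y / (2 * (p \<bullet> p))) *\<^sub>R (p + q)"
proof -
  note sq = offdiag_square[OF assms(1-3)]
  have "x + y \<in> offdiag p q" using assms subspace_offdiag subspace_add by blast
  then have xy: "(x + y) \<star> (x + y) = ((x + y) \<bullet> (x + y) / (2 * (p \<bullet> p))) *\<^sub>R (p + q)"
    by (rule sq)
  define t where "t = x \<bullet> y / (2 * (p \<bullet> p))"
  have t: "(x + y) \<bullet> (x + y) / (2 * (p \<bullet> p))
      = x \<bullet> x / (2 * (p \<bullet> p)) + y \<bullet> y / (2 * (p \<bullet> p)) + (t + t)"
    by (simp add: t_def inner_add_left inner_add_right inner_commute[of y x] add_divide_distrib)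
  have "(x + y) \<star> (x + y) = x \<star> x + y \<star> y + (t *\<^sub>R (p + q) + t *\<^sub>R (p + q))"
    unfolding xy t sq[OF assms(4)] sq[OF assms(5)] by (simp only: scaleR_add_left)
  moreover have "(x + y) \<star> (x + y) = x \<star> x + y \<star> y + (x \<star> y + x \<star> y)"
    by (simp add: mult_add_left mult_add_right mult_commute[of y x])
  ultimately have "x \<star> y + x \<star> y = t *\<^sub>R (p + q) + t *\<^sub>R (p + q)" by simp
  then have "2 *\<^sub>R (x \<star> y) = 2 *\<^sub>R (t *\<^sub>R (p + q))" by (simp only: scaleR_2)
  then have "x \<star> y = t *\<^sub>R (p + q)" by (metis scaleR_cancel_left zero_neq_numeral)
  then show ?thesis by (simp only: t_def)
qed

text \<open>\<open>offdiag_square\<close> is symmetric in the two idempotents except for the norm in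
  its constant.\<close>

lemma offdiag_primitive_norm:
  assumes "primitive p" "primitive q" "p \<star> q = 0" "x \<in> offdiag p q" "x \<noteq> 0"
  shows "q \<bullet> q = p \<bullet> p"
proof -
  have nz: "p \<noteq> 0" "q \<noteq> 0" using assms by (auto simp: primitive_def)
  have "(x \<bullet> x / (2 * (p \<bullet> p))) *\<^sub>R (p + q) = (x \<bullet> x / (2 * (q \<bullet> q))) *\<^sub>R (q + p)"
    using offdiag_square[OF assms(1-4)] offdiag_square[OF assms(2,1), of x] assms
    by (simp add: mult_commute offdiag_commute)
  moreover have "p + q \<noteq> 0"
  proof
    assume "p + q = 0"
    then have "p \<star> (p + q) = 0" by simp
    then show False using assms nz by (simp add: mult_linear primitive_def idem_def)
  qed
  ultimately have "x \<bullet> x / (2 * (p \<bullet> p)) = x \<bullet> x / (2 * (q \<bullet> q))"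
    by (simp add: add.commute)
  then show ?thesis using assms(5) nz by (simp add: field_simps)
qed

lemma offdiag_annihilate:
  assumes F: "frame F" "p \<in> F" "q \<in> F" "r \<in> F" "p \<noteq> q" "r \<noteq> p" "r \<noteq> q"
    and x: "x \<in> offdiag p q"
  shows "r \<star> x = 0"
proof -
  have "x \<in> peirce 1 (p + q)" using offdiag_mult[OF x] by (simp add: peirce_def)
  moreover have "r \<in> peirce 0 (p + q)"
    using F by (simp add: peirce_def mult_linear frame_orthogonal)
  ultimately show ?thesis
    using peirce_one_zero[OF frame_idem_add[OF F(1,2,3,5)]] by (simp add: mult_commute[of r x])
qed

text \<open>The index rule of matrix multiplication: \<open>y\<close> has eigenvalue 0 for
  \<open>p\<close> and \<open>x\<close> has it for \<open>r\<close>, so each factor preserves the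
  1/2 space of the other's outer index.\<close>

lemma offdiag_chain:
  assumes F: "frame F" "p \<in> F" "q \<in> F" "r \<in> F" "p \<noteq> q" "q \<noteq> r" "p \<noteq> r"
    and x: "x \<in> offdiag p q" and y: "y \<in> offdiag q r"
  shows "x \<star> y \<in> offdiag p r"
proof -
  have "y \<in> peirce 0 p" "x \<in> peirce 0 r"
    using offdiag_annihilate[OF F(1,3,4,2) _ _ _ y] offdiag_annihilate[OF F(1,2,3,4) _ _ _ x] F
    by (auto simp: peirce_def)
  then have "y \<star> x \<in> peirce (1/2) p" "x \<star> y \<in> peirce (1/2) r"
    using x y F by (auto simp: offdiag_def intro!: peirce_zero_mult frame_idem)
  then show ?thesis by (simp add: offdiag_def mult_commute)
qed

lemma offdiag_disjoint:
  assumes F: "frame F" "p \<in> F" "q \<in> F" "r \<in> F" "s \<in> F" "p \<noteq> q" "r \<noteq> s"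
    "{p, q} \<inter> {r, s} = {}"
    and x: "x \<in> offdiag p q" and y: "y \<in> offdiag r s"
  shows "x \<star> y = 0"
proof -
  have "y \<in> peirce 0 (p + q)"
    using offdiag_annihilate[OF F(1,4,5,2) _ _ _ y] offdiag_annihilate[OF F(1,4,5,3) _ _ _ y] F
    by (auto simp: peirce_def mult_linear)
  moreover have "x \<in> peirce 1 (p + q)" using offdiag_mult[OF x] by (simp add: peirce_def)
  ultimately show ?thesis using peirce_one_zero[OF frame_idem_add[OF F(1,2,3,6)]] by blast
qed

text \<open>In matrix terms each Jordan product along a chain is half of the matrix product, whence
  1/4. Thus a normalized \<open>u\<close> identifies the blocks of \<open>q, r\<close> and
  \<open>p, r\<close> up to scale.\<close>

lemma offdiag_twice:
  assumes F: "frame F" "p \<in> F" "q \<in> F" "r \<in> F" "p \<noteq> q" "q \<noteq> r" "p \<noteq> r"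
    and u: "u \<in> offdiag p q" "u \<star> u = c *\<^sub>R (p + q)" and x: "x \<in> offdiag q r"
  shows "u \<star> (u \<star> x) = (c / 4) *\<^sub>R x"
proof -
  have h: "u \<star> q = (1/2) *\<^sub>R u" "x \<star> q = (1/2) *\<^sub>R x" "p \<star> x = 0"
    "q \<star> x = (1/2) *\<^sub>R x"
    "p \<star> q = 0" "q \<star> q = q" "x \<star> p = 0" "x \<star> q = (1/2) *\<^sub>R x"
    using offdiag_mult[OF u(1)] offdiag_mult[OF x] offdiag_annihilate[OF F(1,3,4,2) _ _ _ x] F
      frame_idem[OF F(1,3)] frame_orthogonal[OF F(1,2,3)]
    by (auto simp: mult_commute mult_linear idem_def)
  have uxq: "(u \<star> x) \<star> q = 0"
    using offdiag_annihilate[OF F(1,2,4,3) _ _ _ offdiag_chain[OF F u(1) x]] F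
    by (auto simp: mult_commute)
  have "(1/2) *\<^sub>R ((u \<star> x) \<star> u) + (1/2) *\<^sub>R ((x \<star> u) \<star> u) + (c / 4) *\<^sub>R x = (c / 2) *\<^sub>R x"
    using jordan_linearized[of u x u q] uxq
    by (simp add: u(2) h mult_linear mult_commute[of x u])
  then have "u \<star> (u \<star> x) + (c / 4) *\<^sub>R x = (c / 2) *\<^sub>R x"
    by (simp add: mult_commute[of x u] mult_commute[of "u \<star> x" u] flip: scaleR_add_left)
  then have "u \<star> (u \<star> x) = (c / 2 - c / 4) *\<^sub>R x"
    by (simp only: scaleR_left_diff_distrib eq_diff_eq)
  then show ?thesis by (simp add: field_simps)
qed

text \<open>With four distinct indices only one order of the matrix product survives, so both
  bracketings agree. Applying the linearized identity to the end index \<open>p\<close> leaves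
  exactly the two terms needed.\<close>

lemma offdiag_assoc:
  assumes F: "frame F" "p \<in> F" "q \<in> F" "r \<in> F" "s \<in> F" "distinct [p, q, r, s]"
    and x: "x \<in> offdiag p q" and y: "y \<in> offdiag q r" and z: "z \<in> offdiag r s"
  shows "(x \<star> y) \<star> z = x \<star> (y \<star> z)"
proof -
  have d: "p \<noteq> q" "p \<noteq> r" "p \<noteq> s" "q \<noteq> r" "q \<noteq> s" "r \<noteq> s" using F(6) by auto
  have h: "z \<star> p = 0" "x \<star> p = (1/2) *\<^sub>R x" "y \<star> p = 0" "z \<star> x = 0"
    using offdiag_annihilate[OF F(1,4,5,2) _ _ _ z] offdiag_annihilate[OF F(1,3,4,2) _ _ _ y]
      offdiag_mult[OF x] offdiag_disjoint[OF F(1,2,3,4,5) _ _ _ x z] d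
    by (auto simp: mult_commute)
  have "(x \<star> y) \<star> p = (1/2) *\<^sub>R (x \<star> y)"
    using offdiag_mult(1)[OF offdiag_chain[OF F(1,2,3,4) _ _ _ x y]] d by (simp add: mult_commute)
  moreover have "(y \<star> z) \<star> p = 0"
    using offdiag_annihilate[OF F(1,3,5,2) _ _ _ offdiag_chain[OF F(1,3,4,5) _ _ _ y z]] d
    by (simp add: mult_commute)
  ultimately have "(1/2) *\<^sub>R ((y \<star> z) \<star> x) = (1/2) *\<^sub>R (z \<star> (x \<star> y))"
    using jordan_linearized[of x y z p] h by (simp add: mult_linear)
  then show ?thesis by (simp add: mult_commute)
qed

text \<open>The sign change on the odd part of a grading is multiplicative, and a bijective
  homomorphism preserves squares in both directions, hence the order. All automorphisms below are
  obtained from this.\<close>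

lemma grading_order_iso:
  assumes R: "subspace R" and S: "subspace S" and RS0: "R \<inter> S \<subseteq> {0}"
    and dec: "\<And>x. \<exists>r\<in>R. \<exists>s\<in>S. x = r + s"
    and RR: "\<And>x y. x \<in> R \<Longrightarrow> y \<in> R \<Longrightarrow> x \<star> y \<in> R"
    and RS: "\<And>x y. x \<in> R \<Longrightarrow> y \<in> S \<Longrightarrow> x \<star> y \<in> S"
    and SS: "\<And>x y. x \<in> S \<Longrightarrow> y \<in> S \<Longrightarrow> x \<star> y \<in> R"
  obtains \<Psi> where "unital_order_iso \<Psi>" "\<And>x. x \<in> R \<Longrightarrow> \<Psi> x = x"
    "\<And>x. x \<in> S \<Longrightarrow> \<Psi> x = - x"
proof -
  obtain r s where r: "\<And>x. r x \<in> R" and s: "\<And>x. s x \<in> S" and rs: "\<And>x. x = r x + s x"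
    using dec by metis
  define \<Psi> where "\<Psi> x = r x - s x" for x
  \<comment> \<open>The components \<open>r\<close> and \<open>s\<close> are merely chosen; the
    trivial intersection makes them unique, so any decomposition may be used to evaluate the
    map.\<close>
  have un: "\<Psi> (a + b) = a - b" if "a \<in> R" "b \<in> S" for a b
  proof -
    have e: "a + b = r (a + b) + s (a + b)" by (rule rs)
    have "r (a + b) - a \<in> R" using R r that by (simp add: subspace_diff)
    moreover have "r (a + b) - a = b - s (a + b)" using e by (simp add: algebra_simps)
    moreover have "b - s (a + b) \<in> S" using S s that by (simp add: subspace_diff)
    ultimately have "r (a + b) - a \<in> R \<inter> S" by simp
    then have "r (a + b) = a" using RS0 by auto
    moreover from this have "s (a + b) = b" using e by simp
    ultimately show ?thesis by (simp add: \<Psi>_def)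
  qed
  have R0: "0 \<in> R" and S0: "0 \<in> S" using R S by (simp_all add: subspace_0)
  have on_R: "\<Psi> x = x" if "x \<in> R" for x using un[OF that S0] by simp
  have on_S: "\<Psi> x = - x" if "x \<in> S" for x using un[OF R0 that] by simp
  have lin: "linear \<Psi>"
  proof (rule linearI)
    fix x y
    have "x + y = (r x + r y) + (s x + s y)" using rs[of x] rs[of y] by (simp add: algebra_simps)
    moreover have "r x + r y \<in> R" "s x + s y \<in> S" using R S r s by (simp_all add: subspace_add)
    ultimately show "\<Psi> (x + y) = \<Psi> x + \<Psi> y" using un by (simp add: \<Psi>_def)
  next
    fix c x
    have "c *\<^sub>R x = c *\<^sub>R r x + c *\<^sub>R s x" using rs[of x] by (metis scaleR_add_right)
    moreover have "c *\<^sub>R r x \<in> R" "c *\<^sub>R s x \<in> S" using R S r s by (simp_all add: subspace_scale)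
    ultimately show "\<Psi> (c *\<^sub>R x) = c *\<^sub>R \<Psi> x" using un by (simp add: \<Psi>_def scaleR_diff_right)
  qed
  have invol: "\<Psi> (\<Psi> x) = x" for x
    using linear_diff[OF lin, of "r x" "s x"] on_R[OF r] on_S[OF s] rs[of x] by (simp add: \<Psi>_def)
  have hom: "\<Psi> (x \<star> y) = \<Psi> x \<star> \<Psi> y" for x y
  proof -
    have "x \<star> y = (r x \<star> r y + s x \<star> s y) + (r x \<star> s y + r y \<star> s x)"
      by (subst rs[of x], subst rs[of y]) (simp add: mult_linear mult_commute[of "s x" "r y"])
    moreover have "r x \<star> r y + s x \<star> s y \<in> R" "r x \<star> s y + r y \<star> s x \<in> S"
      using R S r s RR RS SS by (simp_all add: subspace_add)
    ultimately have "\<Psi> (x \<star> y) = (r x \<star> r y + s x \<star> s y) - (r x \<star> s y + r y \<star> s x)" using un by simp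
    then show ?thesis by (simp add: \<Psi>_def mult_linear mult_commute[of "s x" "r y"])
  qed
  have "\<Psi> unit = unit" using hom[of unit "\<Psi> unit"] by (simp add: invol)
  moreover have "bij \<Psi>" by (rule involuntory_imp_bij) (rule invol)
  moreover have "positive v \<longleftrightarrow> positive (\<Psi> v)" for v
    unfolding positive_def using hom invol by metis
  ultimately have "unital_order_iso \<Psi>" using lin by (simp add: unital_order_iso_def)
  then show thesis using that on_R on_S by blast
qed

text \<open>The Peirce symmetry, which for matrices is conjugation by \<open>2 e - unit\<close>. Its
  even part consists of the spaces for 1 and 0, encoded by t^2 = t.\<close>

lemma exists_symmetry:
  assumes e: "idem e"
  obtains \<Psi> where "unital_order_iso \<Psi>"
    "\<And>x. e \<star> (e \<star> x) = e \<star> x \<Longrightarrow> \<Psi> x = x"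
    "\<And>x. x \<in> peirce (1/2) e \<Longrightarrow> \<Psi> x = - x"
proof -
  define R where "R = {x. e \<star> (e \<star> x) = e \<star> x}"
  have R: "e \<star> x \<in> peirce 1 e" "x - e \<star> x \<in> peirce 0 e" if "x \<in> R" for x
    using that by (simp_all add: R_def peirce_def mult_linear)
  have R1: "x \<in> R" if "x \<in> peirce 1 e" for x using that by (simp add: R_def peirce_def)
  have R0: "x \<in> R" if "x \<in> peirce 0 e" for x using that by (simp add: R_def peirce_def)
  have sR: "subspace R" by (simp add: R_def subspace_def mult_linear)
  have "\<exists>\<Psi>. unital_order_iso \<Psi> \<and> (\<forall>x\<in>R. \<Psi> x = x) \<and> (\<forall>x\<in>peirce (1/2) e. \<Psi> x = - x)"
  proof (rule grading_order_iso[OF sR subspace_peirce])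
    show "R \<inter> peirce (1/2) e \<subseteq> {0}" by (auto simp: R_def peirce_def mult_linear)
    show "\<exists>r\<in>R. \<exists>s\<in>peirce (1/2) e. x = r + s" for x
    proof -
      obtain x1 xh x0 where x: "x = x1 + xh + x0"
        "x1 \<in> peirce 1 e" "xh \<in> peirce (1/2) e" "x0 \<in> peirce 0 e"
        using peirce_decomposition[OF e] .
      then have "x1 + x0 \<in> R" using R1 R0 sR by (simp add: subspace_add)
      moreover have "x = (x1 + x0) + xh" using x(1) by simp
      ultimately show ?thesis using x(3) by blast
    qed
    show "x \<star> y \<in> R" if "x \<in> peirce (1/2) e" "y \<in> peirce (1/2) e" for x y
      using peirce_half_mult(1)[OF e that] by (simp add: R_def peirce_def)
    show "x \<star> y \<in> peirce (1/2) e" if x: "x \<in> R" and y: "y \<in> peirce (1/2) e" for x y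
    proof -
      have "x \<star> y = (e \<star> x) \<star> y + (x - e \<star> x) \<star> y" by (simp add: mult_linear)
      then show ?thesis
        using peirce_one_mult[OF e R(1)[OF x] y] peirce_zero_mult[OF e R(2)[OF x] y]
        by (metis subspace_add subspace_peirce)
    qed
    show "x \<star> y \<in> R" if x: "x \<in> R" and y: "y \<in> R" for x y
    proof -
      have "(e \<star> x) \<star> (y - e \<star> y) = 0" "(x - e \<star> x) \<star> (e \<star> y) = 0"
        using peirce_one_zero[OF e R(1)[OF x] R(2)[OF y]] peirce_one_zero[OF e R(1)[OF y] R(2)[OF x]]
        by (simp_all add: mult_commute)
      then have "x \<star> y = (e \<star> x) \<star> (e \<star> y) + (x - e \<star> x) \<star> (y - e \<star> y)"
        by (simp add: mult_linear)
      then show ?thesis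
        using R1[OF peirce_one_mult[OF e R(1)[OF x] R(1)[OF y]]]
          R0[OF peirce_zero_mult[OF e R(2)[OF x] R(2)[OF y]]] sR by (metis subspace_add)
    qed
  qed blast
  then show thesis using that by (auto simp: R_def)
qed

text \<open>For matrices this is conjugation by the swap of two basis vectors, extended by the
  identity. Inside the block it is the reflection that keeps the line of \<open>u\<close> and
  negates its complement.\<close>

lemma offdiag_reflection:
  assumes p: "primitive p" and q: "primitive q" and pq: "p \<star> q = 0"
    and u: "u \<in> offdiag p q" "u \<noteq> 0"
  obtains \<Psi> where "unital_order_iso \<Psi>" "\<Psi> p = q" "\<Psi> q = p" "\<Psi> u = u"
    "\<And>v. v \<in> offdiag p q \<Longrightarrow> v \<bullet> u = 0 \<Longrightarrow> \<Psi> v = - v"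
proof -
  have ip: "p \<star> p = p" "q \<star> q = q" "q \<star> p = 0" and pn: "0 < p \<bullet> p"
    using p q pq by (auto simp: primitive_def idem_def mult_commute)
  \<comment> \<open>Scales \<open>u\<close> to an element whose square is
    \<open>p + q\<close>.\<close>
  define c where "c = 1 / sqrt (u \<bullet> u / (2 * (p \<bullet> p)))"
  define w where "w = c *\<^sub>R u"
  have pos: "0 < u \<bullet> u / (2 * (p \<bullet> p))" using u(2) pn by simp
  have c0: "c \<noteq> 0" and cc: "c * c * (u \<bullet> u / (2 * (p \<bullet> p))) = 1"
  proof -
    define t where "t = u \<bullet> u / (2 * (p \<bullet> p))"
    have "0 < t" "c = 1 / sqrt t" using pos by (simp_all add: t_def c_def)
    then show "c \<noteq> 0" "c * c * (u \<bullet> u / (2 * (p \<bullet> p))) = 1" by (simp_all flip: t_def)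
  qed
  have "w \<star> w = (c * c * (u \<bullet> u / (2 * (p \<bullet> p)))) *\<^sub>R (p + q)"
    using offdiag_square[OF p q pq u(1)] by (simp add: w_def mult_scaleR_left mult_scaleR_right)
  then have ww: "w \<star> w = p + q" by (simp only: cc scaleR_one)
  have wo: "w \<in> offdiag p q" using u(1) subspace_offdiag by (simp add: w_def subspace_scale)
  have pw: "p \<star> w = (1/2) *\<^sub>R w" "q \<star> w = (1/2) *\<^sub>R w"
    "w \<star> p = (1/2) *\<^sub>R w" "w \<star> q = (1/2) *\<^sub>R w"
    using offdiag_mult[OF wo] by (simp_all add: mult_commute)
  \<comment> \<open>The swap on the block together with the identity on the rest; it squares to
    \<open>unit\<close>, so \<open>e\<close> is idempotent. The Peirce spaces of \<open>e\<close>
    can then be tested through multiplication by \<open>s\<close>.\<close>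
  define s where "s = w + (unit - (p + q))"
  define e where "e = (1/2) *\<^sub>R (unit + s)"
  have sw: "s \<star> w = p + q" by (simp add: s_def mult_linear ww pw flip: scaleR_add_left)
  have spq: "s \<star> (p + q) = w"
    by (simp add: s_def mult_linear pw ip pq flip: scaleR_add_left)
  have smq: "s \<star> (p - q) = 0" by (simp add: s_def mult_linear pw ip pq)
  have "s \<star> s = s \<star> w + (s - s \<star> (p + q))"
    by (subst (2) s_def) (simp add: mult_linear)
  then have ss: "s \<star> s = unit" unfolding sw spq by (simp add: s_def)
  have es: "e \<star> x = (1/2) *\<^sub>R (x + s \<star> x)" for x by (simp add: e_def mult_linear)
  have "e \<star> e = (1/2) *\<^sub>R (e + e)"
    unfolding es by (simp add: e_def mult_linear ss scaleR_add_right add.commute)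
  then have ide: "idem e" by (simp add: idem_def flip: scaleR_2)
  obtain \<Psi> where \<Psi>: "unital_order_iso \<Psi>"
    "\<And>x. e \<star> (e \<star> x) = e \<star> x \<Longrightarrow> \<Psi> x = x"
    "\<And>x. x \<in> peirce (1/2) e \<Longrightarrow> \<Psi> x = - x"
    using exists_symmetry[OF ide] by blast
  have lin: "linear \<Psi>" using \<Psi>(1) by (simp add: unital_order_iso_def)
  have fixed: "\<Psi> x = x" if "s \<star> (s \<star> x) = x" for x
  proof (rule \<Psi>(2))
    have "e \<star> (e \<star> x) = (1/2) *\<^sub>R (e \<star> x + e \<star> x)"
      by (subst es) (simp add: es mult_linear that scaleR_add_right add.commute)
    then show "e \<star> (e \<star> x) = e \<star> x" by (simp flip: scaleR_2)
  qed
  have neg: "\<Psi> x = - x" if "s \<star> x = 0" for x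
    using that by (intro \<Psi>(3)) (simp add: peirce_def es)
  have "\<Psi> w = w" by (rule fixed) (simp add: sw spq)
  then have "\<Psi> u = u" using c0 by (simp add: w_def linear_scale[OF lin])
  have a: "\<Psi> (p + q) = p + q" by (rule fixed) (simp add: sw spq)
  have b: "\<Psi> (p - q) = q - p" using neg[OF smq] by simp
  have "2 *\<^sub>R \<Psi> p = \<Psi> (p + q) + \<Psi> (p - q)"
    by (simp add: linear_add[OF lin] linear_diff[OF lin] scaleR_2)
  also have "\<dots> = 2 *\<^sub>R q" unfolding a b by (simp add: scaleR_2)
  finally have "\<Psi> p = q" by simp
  moreover from this have "\<Psi> q = p" using a by (simp add: linear_add[OF lin])
  moreover have "\<Psi> v = - v" if v: "v \<in> offdiag p q" "v \<bullet> u = 0" for v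
  proof (rule neg)
    have "w \<star> v = 0"
      using offdiag_product[OF p q pq wo v(1)] v(2) by (simp add: w_def inner_commute)
    moreover have "(p + q) \<star> v = v" by (rule offdiag_mult(3)[OF v(1)])
    ultimately show "s \<star> v = 0" by (simp add: s_def mult_add_left mult_diff_left)
  qed
  ultimately show thesis using that \<Psi>(1) \<open>\<Psi> u = u\<close> by blast
qed

subsection \<open>Transposition\<close>

lemma span_mult_closed:
  assumes "subspace T" "\<And>x y. x \<in> A \<Longrightarrow> y \<in> B \<Longrightarrow> x \<star> y \<in> T"
    "x \<in> span A" "y \<in> span B"
  shows "x \<star> y \<in> T"
proof -
  have sub: "subspace {x. x \<star> y \<in> T}" "subspace {y. x \<star> y \<in> T}" for x y
    using assms(1) by (auto simp: subspace_def mult_linear)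
  have "x \<star> y \<in> T" if "x \<in> A" for x
  proof -
    have "span B \<subseteq> {y. x \<star> y \<in> T}" using assms(2)[OF that] by (intro span_minimal sub) auto
    then show ?thesis using assms(4) by blast
  qed
  then have "span A \<subseteq> {x. x \<star> y \<in> T}" by (intro span_minimal sub) auto
  then show ?thesis using assms(3) by blast
qed

text \<open>Matrix units: \<open>U p q\<close> generate a copy of the real symmetric matrices inside the block of
  the frame elements in \<open>D\<close>.\<close>

definition matrix_units :: "'a set \<Rightarrow> ('a \<Rightarrow> 'a \<Rightarrow> 'a) \<Rightarrow> bool" where
  "matrix_units D U \<longleftrightarrow>
     (\<forall>p\<in>D. U p p = p) \<and>
     (\<forall>p\<in>D. \<forall>q\<in>D. U p q = U q p \<and> (p \<noteq> q \<longrightarrow> U p q \<in> offdiag p q \<and> U p q \<star> U p q = p + q)) \<and>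
     (\<forall>p\<in>D. \<forall>q\<in>D. \<forall>r\<in>D. distinct [p, q, r] \<longrightarrow> U p q \<star> U q r = (1/2) *\<^sub>R U p r)"

text \<open>The set \<open>D\<close> collects the frame elements linked to \<open>p\<close>. The
  units in the row of \<open>p\<close> are chosen freely, up to normalization and the prescribed
  direction for \<open>q\<close>; all others are products of two of them.\<close>

lemma exists_matrix_units:
  assumes F: "frame F" and p: "p \<in> F" and q: "q \<in> F" "p \<noteq> q" and u: "u \<in> offdiag p q" "u \<noteq> 0"
  defines "D \<equiv> {h \<in> F. h = p \<or> offdiag p h \<noteq> {0}}"
  obtains U c where "matrix_units D U" "u = c *\<^sub>R U p q" "q \<in> D"
proof -
  have DF: "D \<subseteq> F" by (auto simp: D_def)
  have pD: "p \<in> D" using p by (simp add: D_def)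
  note prim = frame_primitive[OF F] and orth = frame_orthogonal[OF F]
  have nn: "0 < h \<bullet> h" if "h \<in> F" for h using frame_nonzero[OF F that] by simp
  have normalize: "\<exists>v c. v \<in> offdiag p h \<and> v \<star> v = p + h \<and> x = c *\<^sub>R v"
    if h: "h \<in> F" "h \<noteq> p" and x: "x \<in> offdiag p h" "x \<noteq> 0" for h x
  proof -
    define t where "t = x \<bullet> x / (2 * (p \<bullet> p))"
    have t: "0 < t" using x nn[OF p] by (simp add: t_def)
    have xx: "x \<star> x = t *\<^sub>R (p + h)"
      using offdiag_square[OF prim[OF p] prim[OF h(1)] _ x(1)] orth[OF p h(1)] h(2)
      by (simp add: t_def)
    have "((1 / sqrt t) *\<^sub>R x) \<star> ((1 / sqrt t) *\<^sub>R x) = (1 / sqrt t * (1 / sqrt t) * t) *\<^sub>R (p + h)"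
      by (simp only: mult_scaleR_left mult_scaleR_right xx scaleR_scaleR mult.assoc)
    also have "1 / sqrt t * (1 / sqrt t) * t = 1" using t by simp
    finally have "((1 / sqrt t) *\<^sub>R x) \<star> ((1 / sqrt t) *\<^sub>R x) = p + h" by simp
    moreover have "x = sqrt t *\<^sub>R ((1 / sqrt t) *\<^sub>R x)" using t by simp
    moreover have "(1 / sqrt t) *\<^sub>R x \<in> offdiag p h" using x(1) subspace_offdiag subspace_scale by blast
    ultimately show ?thesis by blast
  qed
  have "\<exists>v. v \<in> offdiag p h \<and> v \<star> v = p + h \<and> (h = q \<longrightarrow> (\<exists>c. u = c *\<^sub>R v))" if h: "h \<in> D" "h \<noteq> p" for h
  proof (cases "h = q")
    case True
    then show ?thesis using normalize[OF q(1) _ u] q(2) by auto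
  next
    case False
    have "offdiag p h \<noteq> {0}" using h by (simp add: D_def)
    moreover have "0 \<in> offdiag p h" using subspace_offdiag by (rule subspace_0)
    ultimately obtain x where "x \<in> offdiag p h" "x \<noteq> 0" by blast
    then show ?thesis using normalize[of h x] h DF False by blast
  qed
  then have "\<exists>v. h \<in> D \<longrightarrow> h \<noteq> p \<longrightarrow>
      v \<in> offdiag p h \<and> v \<star> v = p + h \<and> (h = q \<longrightarrow> (\<exists>c. u = c *\<^sub>R v))" for h by blast
  then obtain V where V0: "\<forall>h. h \<in> D \<longrightarrow> h \<noteq> p \<longrightarrow>
      V h \<in> offdiag p h \<and> V h \<star> V h = p + h \<and> (h = q \<longrightarrow> (\<exists>c. u = c *\<^sub>R V h))" by metis
  have V: "V h \<in> offdiag p h" "V h \<in> offdiag h p" "V h \<star> V h = p + h" "V h \<star> V h = h + p"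
    if "h \<in> D" "h \<noteq> p" for h
    using V0 that offdiag_commute by (auto simp: add.commute)
  have qD: "q \<in> D" using q u by (auto simp: D_def)
  obtain c where c: "u = c *\<^sub>R V q" using V0 qD q(2) by blast
  \<comment> \<open>The unit of \<open>h, k\<close> goes through \<open>p\<close>, and the factor 2
    undoes the Jordan half.\<close>
  define U where "U h k = (if h = k then h else if h = p then V k else if k = p then V h
      else 2 *\<^sub>R (V h \<star> V k))" for h k
  have Ucomm: "U h k = U k h" for h k by (auto simp: U_def mult_commute)
  have VV: "V h \<star> (V h \<star> V k) = (1/4) *\<^sub>R V k"
    if "h \<in> D" "k \<in> D" "h \<noteq> p" "k \<noteq> p" "h \<noteq> k" for h k
    using offdiag_twice[OF F, of h p k "V h" 1 "V k"] V that p DF by auto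
  have VVin: "V h \<star> V k \<in> offdiag h k"
    if "h \<in> D" "k \<in> D" "h \<noteq> p" "k \<noteq> p" "h \<noteq> k" for h k
    using offdiag_chain[OF F, of h p k "V h" "V k"] V that p DF by auto
  have pp: "h \<bullet> h = p \<bullet> p" if "h \<in> D" "h \<noteq> p" for h
  proof (rule offdiag_primitive_norm)
    show "primitive p" "primitive h" "p \<star> h = 0"
      using prim p that DF orth[OF p] by auto
    show "V h \<in> offdiag p h" using V that by blast
    show "V h \<noteq> 0"
    proof
      assume "V h = 0"
      then have "p \<star> (p + h) = 0" using V(3)[OF that] by simp
      then show False
        using \<open>p \<star> h = 0\<close> frame_nonzero[OF F p] frame_idem[OF F p] by (simp add: mult_linear idem_def)
    qed
  qed
  have hu: "h \<bullet> unit = h \<bullet> h" if "h \<in> F" for h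
    using frame_idem[OF F that] inner_square_unit[of h] by (simp add: idem_def)
  have V2: "V h \<bullet> V h = 2 * (p \<bullet> p)" if "h \<in> D" "h \<noteq> p" for h
    using inner_square_unit[of "V h"] V(3)[OF that] pp[OF that] hu p that DF
    by (auto simp: inner_add_left)
  have U2: "U h k \<in> offdiag h k \<and> U h k \<star> U h k = h + k" if hk: "h \<in> D" "k \<in> D" "h \<noteq> k" for h k
  proof (cases "h = p \<or> k = p")
    case True
    then show ?thesis using V hk by (auto simp: U_def)
  next
    case False
    define w where "w = V h \<star> V k"
    have w: "w \<in> offdiag h k" using VVin False hk by (simp add: w_def)
    have "w \<bullet> w = V k \<bullet> (V h \<star> (V h \<star> V k))" by (simp add: w_def inner_mult_swap)
    also have "\<dots> = (p \<bullet> p) / 2" using VV V2 False hk by simp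
    finally have ww: "w \<bullet> w = (h \<bullet> h) / 2" using pp False hk by simp
    have "w \<star> w = (w \<bullet> w / (2 * (h \<bullet> h))) *\<^sub>R (h + k)"
      using hk DF by (intro offdiag_square[OF prim prim _ w] orth) auto
    also have "w \<bullet> w / (2 * (h \<bullet> h)) = 1/4" using ww nn[of h] hk DF by auto
    finally have "U h k \<star> U h k = h + k"
      using False hk by (simp add: U_def mult_scaleR_left mult_scaleR_right flip: w_def)
    moreover have "U h k \<in> offdiag h k"
      using False hk w subspace_offdiag by (auto simp: U_def subspace_scale simp flip: w_def)
    ultimately show ?thesis by blast
  qed
  have U3: "U h k \<star> U k l = (1/2) *\<^sub>R U h l" if D: "h \<in> D" "k \<in> D" "l \<in> D"
    and d: "distinct [h, k, l]" for h k l
  proof -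
    have V3: "V k \<star> (2 *\<^sub>R (V k \<star> V l)) = (1/2) *\<^sub>R V l"
      if "k \<in> D" "l \<in> D" "k \<noteq> p" "l \<noteq> p" "k \<noteq> l" for k l
      using VV[OF that] by (simp add: mult_scaleR_right)
    consider "h = p" | "k = p" | "l = p" | "h \<noteq> p" "k \<noteq> p" "l \<noteq> p" by blast
    then show ?thesis
    proof cases
      case 1
      then show ?thesis using V3[of k l] D d by (auto simp: U_def)
    next
      case 2
      then show ?thesis using d by (auto simp: U_def)
    next
      case 3
      then have "V k \<star> (2 *\<^sub>R (V k \<star> V h)) = (1/2) *\<^sub>R V h" using V3[of k h] D d by auto
      then show ?thesis using 3 d
        by (auto simp: U_def mult_commute[of "2 *\<^sub>R (V k \<star> V h)" "V k"] mult_commute[of "V h" "V k"])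
    next
      case 4
      have "V k \<star> V l \<in> offdiag k l" using VVin D d 4 by auto
      \<comment> \<open>The chain \<open>h, p, k, l\<close> has four distinct indices, so the
        factors can be rebracketed and \<open>V k\<close> cancelled.\<close>
      then have "(V h \<star> V k) \<star> (V k \<star> V l) = V h \<star> (V k \<star> (V k \<star> V l))"
        using V(1,2)[OF D(1) 4(1)] V(1)[OF D(2) 4(2)] D DF d 4 p
        by (intro offdiag_assoc[OF F, of h p k l]) auto
      also have "\<dots> = (1/4) *\<^sub>R (V h \<star> V l)" using VV[of k l] D d 4 by (simp add: mult_scaleR_right)
      finally show ?thesis using 4 d by (auto simp: U_def mult_scaleR_left mult_scaleR_right)
    qed
  qed
  have "matrix_units D U"
    unfolding matrix_units_def using Ucomm U2 U3 by (auto simp: U_def)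
  moreover have "u = c *\<^sub>R U p q" using c q(2) by (simp add: U_def)
  ultimately show thesis using that qD by blast
qed

text \<open>The odd part of a block for transposition; for complex Hermitian matrices, the imaginary
  entries when the matrix units are real.\<close>

definition skew :: "('a \<Rightarrow> 'a \<Rightarrow> 'a) \<Rightarrow> 'a \<Rightarrow> 'a \<Rightarrow> 'a set" where
  "skew U h k = {w \<in> offdiag h k. w \<bullet> U h k = 0}"

definition planar :: "('a \<Rightarrow> 'a \<Rightarrow> 'a) \<Rightarrow> 'a \<Rightarrow> 'a \<Rightarrow> bool" where
  "planar U h k \<longleftrightarrow> (\<exists>g\<in>skew U h k. \<forall>x\<in>offdiag h k. \<exists>a b. x = a *\<^sub>R U h k + b *\<^sub>R g)"

context
  fixes F D :: "'a set" and U :: "'a \<Rightarrow> 'a \<Rightarrow> 'a"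
  assumes F: "frame F" and D_sub: "D \<subseteq> F" and MU: "matrix_units D U"
begin

private lemmas prim = frame_primitive[OF F]
private lemmas orth = frame_orthogonal[OF F]

private lemma frame_member: "h \<in> D \<Longrightarrow> h \<in> F"
  using D_sub by blast

private lemma matrix_units_self: "h \<in> D \<Longrightarrow> U h h = h"
  using MU by (simp add: matrix_units_def)

private lemma matrix_units_commute: "h \<in> D \<Longrightarrow> k \<in> D \<Longrightarrow> U h k = U k h"
  using MU by (simp add: matrix_units_def)

lemma matrix_units_offdiag:
  assumes "h \<in> D" "k \<in> D" "h \<noteq> k"
  shows "U h k \<in> offdiag h k" "U h k \<star> U h k = h + k"
  using MU assms by (auto simp: matrix_units_def)

private lemma matrix_units_mult:
  assumes "h \<in> D" "k \<in> D" "l \<in> D" "distinct [h, k, l]"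
  shows "U h k \<star> U k l = (1/2) *\<^sub>R U h l"
  using MU assms unfolding matrix_units_def by blast

lemma matrix_units_twice:
  assumes "h \<in> D" "k \<in> D" "l \<in> F" "distinct [h, k, l]" "x \<in> offdiag k l"
  shows "U k h \<star> (U h k \<star> x) = (1/4) *\<^sub>R x"
  using offdiag_twice[OF F, of h k l "U h k" 1 x] matrix_units_offdiag[of h k] matrix_units_commute[of h k] assms frame_member by auto

private lemma offdiag_product_member:
  assumes "h \<in> D" "k \<in> D" "h \<noteq> k" "x \<in> offdiag h k" "y \<in> offdiag h k"
  shows "x \<star> y = (x \<bullet> y / (2 * (h \<bullet> h))) *\<^sub>R (h + k)"
  using assms frame_member by (intro offdiag_product prim orth) auto

private lemma offdiag_chain_member:
  assumes "h \<in> D" "k \<in> D" "l \<in> D" "distinct [h, k, l]" "x \<in> offdiag h k" "y \<in> offdiag k l"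
  shows "x \<star> y \<in> offdiag h l"
  using assms frame_member by (intro offdiag_chain[OF F, of h k l]) auto

private lemma skew_commute:
  assumes "h \<in> D" "k \<in> D"
  shows "skew U h k = skew U k h"
  using matrix_units_commute[OF assms] by (simp add: skew_def offdiag_commute)

text \<open>Moved to the other side of the inner product, the matrix unit turns \<open>U h l\<close>
  into a multiple of \<open>U h k\<close>.\<close>

private lemma matrix_units_mult_skew:
  assumes "h \<in> D" "k \<in> D" "l \<in> D" "distinct [h, k, l]" "w \<in> skew U h k"
  shows "U l k \<star> w \<in> skew U h l"
proof -
  have w: "w \<in> offdiag h k" "w \<bullet> U h k = 0" using assms by (auto simp: skew_def)
  have "w \<star> U k l \<in> offdiag h l" using assms w matrix_units_offdiag(1)[of k l] by (intro offdiag_chain_member) auto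
  moreover have "(U l k \<star> w) \<bullet> U h l = 0"
  proof -
    have "(U l k \<star> w) \<bullet> U h l = w \<bullet> (U k l \<star> U l h)"
      using matrix_units_commute[of l k] matrix_units_commute[of h l] assms by (simp add: inner_mult_swap)
    also have "\<dots> = 0" using matrix_units_mult[of k l h] matrix_units_commute[of k h] assms w by auto
    finally show ?thesis .
  qed
  ultimately show ?thesis using matrix_units_commute[of l k] assms by (simp add: skew_def mult_commute)
qed

text \<open>Multiplication by \<open>U l k\<close> identifies the blocks of \<open>h, k\<close> and
  \<open>h, l\<close>; its inverse is 4 times the same multiplication, by
  \<open>matrix_units_twice\<close>.\<close>

lemma planar_step:
  assumes D: "h \<in> D" "k \<in> D" "l \<in> D" and d: "distinct [h, k, l]" and e: "planar U h k"
  shows "planar U h l"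
proof -
  obtain g where g: "g \<in> skew U h k" "\<And>x. x \<in> offdiag h k \<Longrightarrow> \<exists>a b. x = a *\<^sub>R U h k + b *\<^sub>R g"
    using e by (auto simp: planar_def)
  have "\<exists>a b. x = a *\<^sub>R U h l + b *\<^sub>R (U l k \<star> g)" if x: "x \<in> offdiag h l" for x
  proof -
    have "x \<star> U l k \<in> offdiag h k" using D d x matrix_units_offdiag(1)[of l k] by (intro offdiag_chain_member) auto
    then obtain a b where ab: "x \<star> U l k = a *\<^sub>R U h k + b *\<^sub>R g" using g(2) by blast
    have "(1/4) *\<^sub>R x = U l k \<star> (U k l \<star> x)"
      using matrix_units_twice[of k l h x] D d x frame_member by (auto simp: offdiag_commute)
    also have "\<dots> = U l k \<star> (a *\<^sub>R U h k + b *\<^sub>R g)"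
      using ab matrix_units_commute[of k l] D by (simp add: mult_commute[of x])
    also have "U l k \<star> U h k = (1/2) *\<^sub>R U h l"
      using matrix_units_mult[of l k h] matrix_units_commute[of h k] matrix_units_commute[of l h] D d by auto
    then have "U l k \<star> (a *\<^sub>R U h k + b *\<^sub>R g) = (a / 2) *\<^sub>R U h l + b *\<^sub>R (U l k \<star> g)"
      by (simp add: mult_add_right mult_scaleR_right)
    finally have "4 *\<^sub>R ((1/4) *\<^sub>R x) = 4 *\<^sub>R ((a / 2) *\<^sub>R U h l + b *\<^sub>R (U l k \<star> g))" by simp
    then have "x = (4 * (a / 2)) *\<^sub>R U h l + (4 * b) *\<^sub>R (U l k \<star> g)"
      by (simp add: scaleR_add_right)
    then show ?thesis by blast
  qed
  then show ?thesis using matrix_units_mult_skew[OF D d g(1)] by (auto simp: planar_def)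
qed

lemma planar_commute:
  assumes "planar U h k" "h \<in> D" "k \<in> D"
  shows "planar U k h"
  using assms skew_commute[of h k] matrix_units_commute[of h k] by (simp add: planar_def offdiag_commute)

text \<open>Odd times odd is even only because blocks are planar: for quaternionic matrices the
  product of two imaginary units can be imaginary again. Planarity leaves one skew direction in the
  block of \<open>h, l\<close>, spanned by a translate \<open>z\<close> of \<open>w\<close>.\<close>

private lemma skew_mult_skew:
  assumes D: "h \<in> D" "k \<in> D" "l \<in> D" and d: "distinct [h, k, l]"
    and w: "w \<in> skew U h k" and w': "w' \<in> skew U k l" and e: "planar U h l"
  shows "\<exists>a. w \<star> w' = a *\<^sub>R U h l"

proof (cases "w = 0")
  case True
  then show ?thesis by (auto intro: exI[of _ 0])
next
  case False
  have wo: "w \<in> offdiag h k" "w' \<in> offdiag k l" using w w' by (auto simp: skew_def)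
  obtain g where g: "g \<in> skew U h l" "\<And>x. x \<in> offdiag h l \<Longrightarrow> \<exists>a b. x = a *\<^sub>R U h l + b *\<^sub>R g"
    using e by (auto simp: planar_def)
  have Unz: "U h l \<bullet> U h l \<noteq> 0"
  proof
    assume "U h l \<bullet> U h l = 0"
    then have "h + l = 0" using matrix_units_offdiag(2)[of h l] D d by auto
    then have "h \<star> (h + l) = 0" by simp
    then show False
      using orth[of h l] frame_idem[OF F, of h] frame_nonzero[OF F, of h] D d frame_member
      by (simp add: mult_linear idem_def)
  qed
  define z where "z = U l k \<star> w"
  have zA: "z \<in> skew U h l" unfolding z_def using matrix_units_mult_skew D d w by blast
  have "U k l \<star> z = (1/4) *\<^sub>R w"
    using matrix_units_twice[of l k h w] D d wo frame_member by (auto simp: z_def offdiag_commute)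
  then have "z \<noteq> 0" using False by auto
  have "z \<in> offdiag h l" using zA by (simp add: skew_def)
  then obtain a b where z: "z = a *\<^sub>R U h l + b *\<^sub>R g" using g(2) by blast
  have "g \<bullet> U h l = 0" "z \<bullet> U h l = 0" using g(1) zA by (auto simp: skew_def)
  then have "a = 0" using z Unz by (simp add: inner_add_left)
  with z \<open>z \<noteq> 0\<close> have zg: "z = b *\<^sub>R g" "b \<noteq> 0" by auto
  have hk: "h \<noteq> k" using d by simp
  have ww: "w \<star> (w \<star> w') = ((w \<bullet> w / (2 * (h \<bullet> h))) / 4) *\<^sub>R w'"
    using offdiag_product_member[OF D(1,2) hk wo(1,1)] d D frame_member wo by (intro offdiag_twice[OF F, of h k l]) auto
  \<comment> \<open>Moving \<open>w\<close> across produces \<open>w \<star> (w \<star> w')\<close>,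
    a multiple of \<open>w'\<close>, which is orthogonal to the matrix unit. So the product has no
    skew component.\<close>
  have "(w \<star> w') \<bullet> (w \<star> U k l) = (w \<star> (w \<star> w')) \<bullet> U k l"
    using inner_mult_swap[of w "w \<star> w'" "U k l"] by simp
  also have "\<dots> = 0" using w' by (simp add: ww skew_def)
  finally have "(w \<star> w') \<bullet> z = 0"
    using matrix_units_commute[of k l] D by (simp add: z_def mult_commute[of w "U l k"])
  then have wg: "(w \<star> w') \<bullet> g = 0" using zg by simp
  have "w \<star> w' \<in> offdiag h l" using offdiag_chain_member D d wo by blast
  then obtain a' b' where ab: "w \<star> w' = a' *\<^sub>R U h l + b' *\<^sub>R g" using g(2) by blast
  have "b' * (g \<bullet> g) = 0"
    using wg ab \<open>g \<bullet> U h l = 0\<close> by (simp add: inner_add_left inner_commute[of "U h l" g])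
  then have "b' *\<^sub>R g = 0" by auto
  then show ?thesis using ab by auto
qed

text \<open>The conditional is the idempotent that supports the unit; on the diagonal
  \<open>h + k\<close> would be \<open>2 h\<close>, which is not idempotent.\<close>

private lemma matrix_unit_block:
  assumes "h \<in> D" "k \<in> D"
  shows "U h k \<in> peirce 1 (if h = k then h else h + k)"
proof (cases "h = k")
  case True
  then show ?thesis using matrix_units_self frame_idem[OF F] frame_member assms by (auto simp: peirce_def idem_def)
next
  case False
  then show ?thesis using offdiag_mult(3)[OF matrix_units_offdiag(1)] assms by (simp add: peirce_def)
qed

private lemma skew_block:
  assumes "w \<in> skew U h k"
  shows "w \<in> peirce 1 (h + k)"
  using assms offdiag_mult(3)[of w h k] by (simp add: skew_def peirce_def)

private lemma idem_block:
  assumes "h \<in> D" "k \<in> D"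
  shows "idem (if h = k then h else h + k)"
  using assms frame_member frame_idem[OF F] frame_idem_add[OF F] by auto

private lemma block_mult_zero:
  assumes "x \<in> peirce 1 (if h = k then h else h + k)" "y \<in> peirce 0 (if h = k then h else h + k)"
    "h \<in> D" "k \<in> D"
  shows "x \<star> y = 0"
  using peirce_one_zero[OF idem_block assms(1,2)] assms by blast

private lemma block_annihilate:
  assumes "h \<in> D" "k \<in> D" "r \<in> D" "r \<noteq> h" "r \<noteq> k" "x \<in> peirce 1 (if h = k then h else h + k)"
  shows "r \<star> x = 0"
proof -
  have "r \<in> peirce 0 (if h = k then h else h + k)"
    using assms orth[of h r] orth[of k r] frame_member by (auto simp: peirce_def mult_linear)
  then show ?thesis using block_mult_zero[OF assms(6)] assms by (simp add: mult_commute[of r])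
qed

private lemma block_disjoint:
  assumes "h \<in> D" "k \<in> D" "l \<in> D" "m \<in> D" "{h, k} \<inter> {l, m} = {}"
    "x \<in> peirce 1 (if h = k then h else h + k)" "y \<in> peirce 1 (if l = m then l else l + m)"
  shows "x \<star> y = 0"
proof -
  have "h \<star> y = 0" by (rule block_annihilate[OF assms(3,4,1) _ _ assms(7)]) (use assms(5) in auto)
  moreover have "k \<star> y = 0" by (rule block_annihilate[OF assms(3,4,2) _ _ assms(7)]) (use assms(5) in auto)
  ultimately have "y \<in> peirce 0 (if h = k then h else h + k)" by (simp add: peirce_def mult_linear)
  then show ?thesis using block_mult_zero[OF assms(6)] assms by blast
qed

text \<open>By \<open>con\<close> no block links \<open>D\<close> with the rest of the frame. The
  part of the algebra away from \<open>D\<close> therefore splits off and may be left fixed.\<close>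

lemma matrix_units_transposition:
  assumes pl: "\<And>h k. h \<in> D \<Longrightarrow> k \<in> D \<Longrightarrow> h \<noteq> k \<Longrightarrow> planar U h k"
    and con: "\<And>h k. h \<in> D \<Longrightarrow> k \<in> F \<Longrightarrow> k \<notin> D \<Longrightarrow> offdiag h k = {0}"
  obtains \<Psi> where "unital_order_iso \<Psi>"
    "\<And>h k. h \<in> D \<Longrightarrow> k \<in> D \<Longrightarrow> \<Psi> (U h k) = U h k"
    "\<And>h k w. h \<in> D \<Longrightarrow> k \<in> D \<Longrightarrow> h \<noteq> k \<Longrightarrow> w \<in> skew U h k \<Longrightarrow> \<Psi> w = - w"
proof -
  \<comment> \<open>The annihilator of \<open>D\<close>, which joins the even part so that the two
    parts exhaust the algebra.\<close>
  define Z where "Z = {x. \<forall>h\<in>D. h \<star> x = 0}"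
  have sZ: "subspace Z" by (auto simp: Z_def subspace_def mult_linear)
  define R where "R = span ({U h k | h k. h \<in> D \<and> k \<in> D} \<union> Z)"
  define S where "S = span {w. \<exists>h k. h \<in> D \<and> k \<in> D \<and> h \<noteq> k \<and> w \<in> skew U h k}"
  have UR: "U h k \<in> R" if "h \<in> D" "k \<in> D" for h k
    unfolding R_def using that by (intro span_base) auto
  have ZR: "x \<in> R" if "x \<in> Z" for x unfolding R_def using that by (intro span_base) auto
  have AS: "w \<in> S" if "w \<in> skew U h k" "h \<in> D" "k \<in> D" "h \<noteq> k" for w h k
    unfolding S_def using that by (intro span_base) auto
  have sR: "subspace R" and sS: "subspace S" by (simp_all add: R_def S_def)
  have DR: "h \<in> R" if "h \<in> D" for h using UR[OF that that] matrix_units_self[OF that] by simp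
  have Zblk: "z \<in> peirce 0 (if h = k then h else h + k)" if "z \<in> Z" "h \<in> D" "k \<in> D" for z h k
    using that by (auto simp: Z_def peirce_def mult_linear)
  have UUR: "U h k \<star> U k m \<in> R" if D: "h \<in> D" "k \<in> D" "m \<in> D" for h k m
  proof -
    have diag: "h \<star> U h m \<in> R" if "h \<in> D" "m \<in> D" for h m
    proof (cases "h = m")
      case True
      then show ?thesis using matrix_units_self DR that frame_idem[OF F] frame_member by (simp add: idem_def)
    next
      case False
      then show ?thesis
        using offdiag_mult(1)[OF matrix_units_offdiag(1)] UR that sR by (simp add: subspace_scale)
    qed
    consider "h = k" | "k = m" | "h \<noteq> k" "h = m" | "distinct [h, k, m]" by auto
    then show ?thesis
    proof cases
      case 1
      then show ?thesis using diag D matrix_units_self by auto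
    next
      case 2
      then show ?thesis using diag[of k h] D matrix_units_self matrix_units_commute[of h k] by (auto simp: mult_commute)
    next
      case 3
      then show ?thesis using matrix_units_offdiag(2)[of h k] matrix_units_commute[of h k] D DR sR
        by (auto simp: subspace_add)
    next
      case 4
      then show ?thesis using matrix_units_mult D UR sR by (auto simp: subspace_scale)
    qed
  qed
  have UAS: "U h k \<star> w \<in> S" if D: "h \<in> D" "k \<in> D" "m \<in> D" "k \<noteq> m"
    and w: "w \<in> skew U k m" for h k m w
  proof -
    consider "h = k" | "h \<noteq> k" "h = m" | "distinct [m, k, h]" using D by auto
    then show ?thesis
    proof cases
      case 1
      then show ?thesis
        using matrix_units_self D w AS[OF w] offdiag_mult(1)[of w k m] sS by (auto simp: skew_def subspace_scale)
    next
      case 2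
      have "U k h \<star> w = 0"
        using offdiag_product_member[of k h "U k h" w] matrix_units_offdiag(1)[of k h] D w 2
          by (auto simp: skew_def inner_commute)
      then show ?thesis using matrix_units_commute[of h k] D sS by (simp add: subspace_0)
    next
      case 3
      have "w \<in> skew U m k" using skew_commute[of k m] D w by simp
      then have "U h k \<star> w \<in> skew U m h" using matrix_units_mult_skew[of m k h w] D 3 by blast
      then show ?thesis using AS D 3 by auto
    qed
  qed
  have AAR: "w \<star> w' \<in> R" if D: "h \<in> D" "k \<in> D" "m \<in> D" "h \<noteq> k" "k \<noteq> m"
    and w: "w \<in> skew U h k" "w' \<in> skew U k m" for h k m w w'
  proof (cases "h = m")
    case True
    then have "w' \<in> offdiag h k" using w by (simp add: skew_def offdiag_commute)
    then have "w \<star> w' = (w \<bullet> w' / (2 * (h \<bullet> h))) *\<^sub>R (h + k)"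
      using w D by (intro offdiag_product_member) (auto simp: skew_def)
    then show ?thesis using D DR sR by (simp add: subspace_add subspace_scale)
  next
    case False
    then obtain a where "w \<star> w' = a *\<^sub>R U h m" using skew_mult_skew[of h k m w w'] pl D w by auto
    then show ?thesis using UR D sR by (simp add: subspace_scale)
  qed
  have RR: "x \<star> y \<in> R" if "x \<in> R" "y \<in> R" for x y
  proof (rule span_mult_closed[OF sR _ that[unfolded R_def]])
    fix x y
    assume x: "x \<in> {U h k |h k. h \<in> D \<and> k \<in> D} \<union> Z"
      and y: "y \<in> {U h k |h k. h \<in> D \<and> k \<in> D} \<union> Z"
    have UZ: "U h k \<star> z = 0" "z \<star> U h k = 0" if "h \<in> D" "k \<in> D" "z \<in> Z" for h k z
    proof -
      show "U h k \<star> z = 0" using block_mult_zero[OF matrix_unit_block Zblk] that by blast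
      then show "z \<star> U h k = 0" by (simp add: mult_commute)
    qed
    have ZZ: "z \<star> z' \<in> Z" if "z \<in> Z" "z' \<in> Z" for z z'
    proof -
      have "h \<star> (z \<star> z') = 0" if "h \<in> D" for h
        using peirce_zero_mult[OF frame_idem[OF F frame_member[OF that]], of z z' 0] \<open>z \<in> Z\<close> \<open>z' \<in> Z\<close> that
        by (simp add: Z_def peirce_def)
      then show ?thesis by (simp add: Z_def)
    qed
    have uu: "U h k \<star> U l m \<in> R" if D: "h \<in> D" "k \<in> D" "l \<in> D" "m \<in> D" for h k l m
    proof -
      \<comment> \<open>Either a common index exists, which the symmetry of \<open>U\<close> moves
        to the middle, or the supports are orthogonal and the product vanishes. The same split is
        used for the skew elements.\<close>
      consider "k = l" | "k = m" | "h = l" | "h = m" | "{h, k} \<inter> {l, m} = {}" by blast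
      then show ?thesis
      proof cases
        case 5
        then show ?thesis using block_disjoint[OF D 5 matrix_unit_block matrix_unit_block] D sR by (simp add: subspace_0)
      qed (use UUR[of h k m] UUR[of h k l] UUR[of k h m] UUR[of k h l] matrix_units_commute[of l m] matrix_units_commute[of h k] D in auto)
    qed
    have z0: "0 \<in> R" using sR by (rule subspace_0)
    show "x \<star> y \<in> R"
      using x y UZ ZZ uu z0 ZR by (elim UnE CollectE exE conjE) simp_all
  qed
  have RS: "x \<star> y \<in> S" if "x \<in> R" "y \<in> S" for x y
  proof (rule span_mult_closed[OF sS _ that[unfolded R_def S_def]])
    fix x y
    assume x: "x \<in> {U h k |h k. h \<in> D \<and> k \<in> D} \<union> Z"
      and "y \<in> {w. \<exists>h k. h \<in> D \<and> k \<in> D \<and> h \<noteq> k \<and> w \<in> skew U h k}"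
    then obtain l m where y: "l \<in> D" "m \<in> D" "l \<noteq> m" "y \<in> skew U l m" by blast
    have y': "y \<in> skew U m l" using skew_commute[of l m] y by simp
    have yb: "y \<in> peirce 1 (if l = m then l else l + m)" using skew_block[OF y(4)] y(3) by simp
    have z0: "0 \<in> S" using sS by (rule subspace_0)
    show "x \<star> y \<in> S"
    proof (cases "x \<in> Z")
      case True
      then have "y \<star> x = 0" using block_mult_zero[OF yb Zblk] y by blast
      then show ?thesis using z0 by (simp add: mult_commute)
    next
      case False
      then obtain h k where hk: "x = U h k" "h \<in> D" "k \<in> D" using x by blast
      consider "k = l" | "k = m" | "h = l" | "h = m" | "{h, k} \<inter> {l, m} = {}" by blast
      then show ?thesis
      proof cases
        case 1
        then show ?thesis using UAS[of h l m y] hk y by simp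
      next
        case 2
        then show ?thesis using UAS[of h m l y] hk y y' by simp
      next
        case 3
        then show ?thesis using UAS[of k l m y] hk y matrix_units_commute[of h k] by simp
      next
        case 4
        then show ?thesis using UAS[of k m l y] hk y y' matrix_units_commute[of h k] by simp
      next
        case 5
        then show ?thesis using block_disjoint[OF _ _ _ _ 5 matrix_unit_block yb] hk y z0 by simp
      qed
    qed
  qed
  have SS: "x \<star> y \<in> R" if "x \<in> S" "y \<in> S" for x y
  proof (rule span_mult_closed[OF sR _ that[unfolded S_def]])
    fix x y
    assume "x \<in> {w. \<exists>h k. h \<in> D \<and> k \<in> D \<and> h \<noteq> k \<and> w \<in> skew U h k}"
      "y \<in> {w. \<exists>h k. h \<in> D \<and> k \<in> D \<and> h \<noteq> k \<and> w \<in> skew U h k}"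
    then obtain h k l m where x: "h \<in> D" "k \<in> D" "h \<noteq> k" "x \<in> skew U h k"
      and y: "l \<in> D" "m \<in> D" "l \<noteq> m" "y \<in> skew U l m" by blast
    have x': "x \<in> skew U k h" and y': "y \<in> skew U m l" using skew_commute[of l m] skew_commute[of h k] x y by auto
    have yb: "y \<in> peirce 1 (if l = m then l else l + m)" using skew_block[OF y(4)] y(3) by simp
    have xb: "x \<in> peirce 1 (if h = k then h else h + k)" using skew_block[OF x(4)] x(3) by simp
    consider "k = l" | "k = m" | "h = l" | "h = m" | "{h, k} \<inter> {l, m} = {}" by blast
    then show "x \<star> y \<in> R"
    proof cases
      case 1
      then show ?thesis using AAR[of h l m x y] x y by simp
    next
      case 2
      then show ?thesis using AAR[of h m l x y] x y y' by simp
    next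
      case 3
      then show ?thesis using AAR[of k l m x y] x x' y by simp
    next
      case 4
      then show ?thesis using AAR[of k m l x y] x x' y y' by simp
    next
      case 5
      then show ?thesis using block_disjoint[OF _ _ _ _ 5 xb yb] x y sR by (simp add: subspace_0)
    qed
  qed
  have perp: "x \<bullet> y = 0" if "x \<in> R" "y \<in> S" for x y
  proof -
    have gen: "x \<bullet> w = 0" if x: "x \<in> {U h k |h k. h \<in> D \<and> k \<in> D} \<union> Z"
        and w: "l \<in> D" "m \<in> D" "l \<noteq> m" "w \<in> skew U l m" for x w l m
    proof -
      have wh: "w \<in> peirce (1/2) l" "w \<in> peirce (1/2) m" using w by (auto simp: skew_def offdiag_def)
      have p0: "x \<bullet> w = 0" if "x \<in> peirce 0 l \<or> x \<in> peirce 0 m"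
        using that peirce_orthogonal[of x 0 _ w "1/2"] wh by auto
      show ?thesis
      proof (cases "x \<in> Z")
        case True
        then show ?thesis using w by (intro p0) (auto simp: Z_def peirce_def)
      next
        case False
        then obtain h k where hk: "x = U h k" "h \<in> D" "k \<in> D" using x by blast
        have p00: "x \<bullet> w = 0" if "(l \<noteq> h \<and> l \<noteq> k) \<or> (m \<noteq> h \<and> m \<noteq> k)"
          using that block_annihilate[OF hk(2,3) _ _ _ matrix_unit_block[OF hk(2,3)]] w hk(1)
          by (intro p0) (auto simp: peirce_def)
        then show ?thesis
        proof (cases "(l \<noteq> h \<and> l \<noteq> k) \<or> (m \<noteq> h \<and> m \<noteq> k)")
          case False
          then have "(l = h \<and> m = k) \<or> (l = k \<and> m = h)" using w(3) by auto
          then have "x = U l m" using hk matrix_units_commute by auto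
          then show ?thesis using w(4) by (simp add: skew_def inner_commute)
        qed (rule p00)
      qed
    qed
    have "span {w. \<exists>h k. h \<in> D \<and> k \<in> D \<and> h \<noteq> k \<and> w \<in> skew U h k} \<subseteq> {y. x \<bullet> y = 0}"
      if "x \<in> {U h k |h k. h \<in> D \<and> k \<in> D} \<union> Z" for x
      using gen[OF that] by (intro span_minimal subspace_hyperplane) auto
    then have "span ({U h k |h k. h \<in> D \<and> k \<in> D} \<union> Z) \<subseteq> {x. x \<bullet> y = 0}"
      using \<open>y \<in> S\<close> unfolding S_def
      by (intro span_minimal subspace_hyperplane2) auto
    then show ?thesis using \<open>x \<in> R\<close> by (auto simp: R_def)
  qed
  have RS0: "R \<inter> S \<subseteq> {0}" using perp by force
  define T where "T = {x. \<exists>r\<in>R. \<exists>s\<in>S. x = r + s}"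
  have sT: "subspace T"
    using subspace_sums[OF sR sS] by (simp add: T_def Bex_def conj_ac)
  have R0: "0 \<in> R" and S0: "0 \<in> S" using sR sS by (simp_all add: subspace_0)
  have RT: "x \<in> T" if "x \<in> R" for x
  proof -
    have "x = x + 0" by simp
    then show ?thesis using that S0 unfolding T_def by blast
  qed
  have dec: "x \<in> T" for x
  proof (rule frame_subspace_eq_UNIV[OF F sT])
    fix h assume h: "h \<in> F"
    show "h \<in> T"
    proof (cases "h \<in> D")
      case True
      then show ?thesis using DR RT by blast
    next
      case False
      then have "k \<star> h = 0" if "k \<in> D" for k using orth[of k h] that frame_member h by auto
      then show ?thesis using ZR RT by (auto simp: Z_def)
    qed
  next
    fix h k x assume hk: "h \<in> F" "k \<in> F" "h \<noteq> k" and x: "x \<in> offdiag h k"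
    show "x \<in> T"
    proof (cases "h \<in> D"; cases "k \<in> D")
      assume D: "h \<in> D" "k \<in> D"
      define s where "s = x - (x \<bullet> U h k / (U h k \<bullet> U h k)) *\<^sub>R U h k"
      have "s \<bullet> U h k = 0"
        by (cases "U h k = 0") (simp_all add: s_def inner_diff_left)
      moreover have "s \<in> offdiag h k"
        using x matrix_units_offdiag(1)[OF D hk(3)] subspace_offdiag[of h k]
          by (simp add: s_def subspace_diff subspace_scale)
      ultimately have "s \<in> S" using AS D hk(3) by (auto simp: skew_def)
      moreover have "(x \<bullet> U h k / (U h k \<bullet> U h k)) *\<^sub>R U h k \<in> R" using UR D sR
        by (simp add: subspace_scale)
      moreover have "x = (x \<bullet> U h k / (U h k \<bullet> U h k)) *\<^sub>R U h k + s" by (simp add: s_def)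
      ultimately show ?thesis unfolding T_def by blast
    next
      assume "h \<in> D" "k \<notin> D"
      then show ?thesis using con[of h k] x hk R0 RT by auto
    next
      assume "h \<notin> D" "k \<in> D"
      then show ?thesis using con[of k h] x hk R0 RT by (auto simp: offdiag_commute)
    next
      assume "h \<notin> D" "k \<notin> D"
      then have "r \<star> x = 0" if "r \<in> D" for r
        using offdiag_annihilate[OF F, of h k r x] that hk x frame_member by auto
      then show ?thesis using ZR RT by (auto simp: Z_def)
    qed
  qed
  have dec': "\<exists>r\<in>R. \<exists>s\<in>S. x = r + s" for x using dec[of x] by (simp add: T_def)
  obtain \<Psi> where \<Psi>: "unital_order_iso \<Psi>" "\<And>x. x \<in> R \<Longrightarrow> \<Psi> x = x"
    "\<And>x. x \<in> S \<Longrightarrow> \<Psi> x = - x"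
    using grading_order_iso[OF sR sS RS0 dec' RR RS SS] by blast
  show thesis
  proof (rule that[OF \<Psi>(1)])
    show "\<Psi> (U h k) = U h k" if "h \<in> D" "k \<in> D" for h k
      by (rule \<Psi>(2)[OF UR[OF that]])
    show "\<Psi> w = - w" if "h \<in> D" "k \<in> D" "h \<noteq> k" "w \<in> skew U h k" for h k w
      by (rule \<Psi>(3)[OF AS[OF that(4,1,2,3)]])
  qed
qed

end

text \<open>When the off-diagonal blocks are two-dimensional, transposition with respect to matrix units
  is an automorphism. Its eigenspaces form a grading: \<open>R\<close> is spanned by the matrix units and
  \<open>S\<close> by the part of the off-diagonal blocks orthogonal to them.\<close>

lemma offdiag_transposition:
  assumes F: "frame F" and pq: "p \<in> F" "q \<in> F" "p \<noteq> q"
    and u: "u \<in> offdiag p q" "u \<noteq> 0" and v: "v \<in> offdiag p q" "v \<bullet> u = 0"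
    and two: "\<And>x. x \<in> offdiag p q \<Longrightarrow> \<exists>a b. x = a *\<^sub>R u + b *\<^sub>R v"
  obtains \<Psi> where "unital_order_iso \<Psi>" "\<Psi> p = p" "\<Psi> q = q" "\<Psi> u = u" "\<Psi> v = - v"
proof -
  define D where "D = {h \<in> F. h = p \<or> offdiag p h \<noteq> {0}}"
  obtain U c where MU: "matrix_units D U" and c: "u = c *\<^sub>R U p q" and qD: "q \<in> D"
    using exists_matrix_units[OF F pq u, folded D_def] by blast
  have D_sub: "D \<subseteq> F" and pD: "p \<in> D" using pq by (auto simp: D_def)
  note ctx = F D_sub MU
  have vA: "v \<in> skew U p q"
    using v u(2) c by (auto simp: skew_def)
  have pl_pq: "planar U p q"
  proof -
    have "\<exists>a b. x = a *\<^sub>R U p q + b *\<^sub>R v" if x: "x \<in> offdiag p q" for x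
    proof -
      obtain a b where "x = a *\<^sub>R u + b *\<^sub>R v" using two[OF x] by blast
      then have "x = (a * c) *\<^sub>R U p q + b *\<^sub>R v" by (simp add: c)
      then show ?thesis by blast
    qed
    then show ?thesis using vA by (auto simp: planar_def)
  qed
  \<comment> \<open>Planarity spreads from the pair \<open>p, q\<close> to the row of
    \<open>p\<close>, and from there to every pair in \<open>D\<close>.\<close>
  have pl_p: "planar U p h" if "h \<in> D" "h \<noteq> p" for h
    using pl_pq planar_step[OF ctx pD qD that(1) _ pl_pq] that pq(3) by (cases "h = q") auto
  have pl: "planar U h k" if hk: "h \<in> D" "k \<in> D" "h \<noteq> k" for h k
  proof (cases "h = p \<or> k = p")
    case True
    then show ?thesis using pl_p planar_commute[OF ctx] hk pD by auto
  next
    case False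
    then have "planar U h p" using pl_p planar_commute[OF ctx] hk pD by auto
    then show ?thesis using planar_step[OF ctx hk(1) pD hk(2)] False hk by auto
  qed
  \<comment> \<open>An element linked to \<open>h\<close> is linked to \<open>p\<close> through
    \<open>U p h\<close>, so it would belong to \<open>D\<close>.\<close>
  have con: "offdiag h k = {0}" if h: "h \<in> D" and k: "k \<in> F" "k \<notin> D" for h k
  proof (cases "h = p")
    case True
    then show ?thesis using k by (simp add: D_def)
  next
    case False
    have ne: "h \<noteq> k" "k \<noteq> p" using h k pD by auto
    have W0: "offdiag p k = {0}" using k by (simp add: D_def)
    have "x = 0" if x: "x \<in> offdiag h k" for x
    proof -
      have U: "U p h \<in> offdiag p h" "U h p \<in> offdiag h p"
        using matrix_units_offdiag[OF ctx] pD h False by auto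
      have "U p h \<star> x \<in> offdiag p k"
        using offdiag_chain[OF F, of p h k "U p h" x] U pD h k D_sub False ne x by auto
      then have "U p h \<star> x = 0" using W0 by simp
      then show ?thesis using matrix_units_twice[OF ctx pD h k(1) _ x] False ne by auto
    qed
    then show ?thesis using subspace_0[OF subspace_offdiag] by blast
  qed
  obtain \<Psi> where \<Psi>: "unital_order_iso \<Psi>"
    "\<And>h k. h \<in> D \<Longrightarrow> k \<in> D \<Longrightarrow> \<Psi> (U h k) = U h k"
    "\<And>h k w. h \<in> D \<Longrightarrow> k \<in> D \<Longrightarrow> h \<noteq> k \<Longrightarrow> w \<in> skew U h k \<Longrightarrow> \<Psi> w = - w"
    using matrix_units_transposition[OF ctx pl con] by blast
  have lin: "linear \<Psi>" using \<Psi>(1) by (simp add: unital_order_iso_def)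
  have matrix_units_self: "U h h = h" if "h \<in> D" for h using MU that by (simp add: matrix_units_def)
  show thesis
  proof
    show "\<Psi> p = p" "\<Psi> q = q" using \<Psi>(2)[OF pD pD] \<Psi>(2)[OF qD qD] matrix_units_self pD qD by auto
    show "\<Psi> u = u" using \<Psi>(2)[OF pD qD] by (simp add: c linear_scale[OF lin])
    show "\<Psi> v = - v" using \<Psi>(3)[OF pD qD pq(3) vA] .
  qed (rule \<Psi>(1))
qed

end

subsection \<open>Additive maps on effects\<close>

text \<open>Cauchy's equation, solved through the monotonicity that nonnegativity provides:
  multiples of 1/N approximate from below.\<close>

lemma additive_on_unit_interval:
  fixes h :: "real \<Rightarrow> real"
  assumes add: "\<And>s t. 0 \<le> s \<Longrightarrow> 0 \<le> t \<Longrightarrow> s + t \<le> 1 \<Longrightarrow> h (s + t) = h s + h t"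
    and nonneg: "\<And>t. 0 \<le> t \<Longrightarrow> t \<le> 1 \<Longrightarrow> 0 \<le> h t"
    and t: "0 \<le> t" "t \<le> 1"
  shows "h t = t * h 1"
proof -
  have mono: "h r \<le> h s" if "0 \<le> r" "r \<le> s" "s \<le> 1" for r s
    using add[of r "s - r"] nonneg[of "s - r"] that by simp
  have h1: "0 \<le> h 1" using nonneg[of 1] by simp
  have mult: "h (real k * r) = real k * h r" if "0 \<le> r" "real k * r \<le> 1" for k r
    using that
  proof (induction k)
    case 0
    then show ?case using add[of 0 0] by simp
  next
    case (Suc k)
    have "real k * r \<le> 1" "0 \<le> real k * r" using Suc.prems by (auto simp: algebra_simps)
    then show ?case using Suc add[of "real k * r" r] by (simp add: algebra_simps)
  qed
  have low: "(s - 1 / real (Suc n)) * h 1 \<le> h s" if s: "0 \<le> s" "s \<le> 1" for s n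
  proof -
    define N where "N = real (Suc n)"
    have N: "0 < N" by (simp add: N_def)
    define k where "k = nat \<lfloor>s * N\<rfloor>"
    have k: "real k \<le> s * N" "s * N - 1 \<le> real k" using s N by (auto simp: k_def)
    have kN: "real k * (1 / N) \<le> s" using k(1) N by (simp add: field_simps)
    have "h 1 = N * h (1 / N)" using mult[of "1 / N" "Suc n"] N by (simp add: N_def)
    moreover have "h (real k * (1 / N)) = real k * h (1 / N)"
    proof (rule mult)
      show "real k * (1 / N) \<le> 1" using kN s by linarith
    qed (use N in simp)
    ultimately have hk: "h (real k * (1 / N)) = real k / N * h 1" using N by simp
    have "(s * N - 1) / N \<le> real k / N" using k(2) N by (intro divide_right_mono) auto
    then have "s - 1 / N \<le> real k / N" using N by (simp add: diff_divide_distrib)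
    then have "(s - 1 / N) * h 1 \<le> real k / N * h 1" using h1 by (rule mult_right_mono)
    also have "\<dots> \<le> h s" unfolding hk[symmetric] using kN s N by (intro mono) auto
    finally show ?thesis by (simp add: N_def)
  qed
  \<comment> \<open>The upper estimate at \<open>t\<close> is the lower one at
    \<open>1 - t\<close>.\<close>
  have "\<bar>h t - t * h 1\<bar> \<le> h 1 / real (Suc n)" for n
  proof -
    have "h t + h (1 - t) = h 1" using add[of t "1 - t"] t by simp
    moreover have "(1 - t - 1 / real (Suc n)) * h 1 \<le> h (1 - t)" using t by (intro low) auto
    moreover have "(t - 1 / real (Suc n)) * h 1 \<le> h t" using t by (intro low) auto
    ultimately show ?thesis by (simp add: algebra_simps)
  qed
  moreover have "(\<lambda>n. h 1 / real (Suc n)) \<longlonglongrightarrow> 0"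
    by (rule LIMSEQ_Suc) (rule lim_const_over_n)
  ultimately have "\<bar>h t - t * h 1\<bar> \<le> 0"
    by (intro LIMSEQ_le_const[of _ 0 "\<bar>h t - t * h 1\<bar>"]) auto
  then show ?thesis by simp
qed

section \<open>Order units and linear extension\<close>

context euclidean_jordan_algebra
begin

lemma positive_unit_minus:
  assumes "mult_const * norm x \<le> r" shows "positive (r *\<^sub>R unit - x)"
proof (rule positiveI)
  fix y assume "positive y"
  then obtain z where z: "y = z \<star> z" by (auto simp: positive_def)
  have "x \<bullet> y = (z \<star> x) \<bullet> z" by (simp add: z inner_mult_swap)
  also have "\<dots> \<le> norm (z \<star> x) * norm z" by (rule norm_cauchy_schwarz)
  also have "\<dots> \<le> mult_const * norm z * norm x * norm z"
    by (intro mult_right_mono norm_mult_le) auto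
  also have "\<dots> = mult_const * norm x * (norm z)\<^sup>2" by (simp add: power2_eq_square mult_ac)
  also have "\<dots> \<le> r * (norm z)\<^sup>2" using assms by (intro mult_right_mono) auto
  also have "\<dots> = (r *\<^sub>R unit) \<bullet> y"
    using inner_square_unit[of z] by (simp add: z power2_norm_eq_inner inner_commute)
  finally show "0 \<le> (r *\<^sub>R unit - x) \<bullet> y" by (simp add: inner_diff_left)
qed

lemma positive_unit_plus: "mult_const * norm x \<le> r \<Longrightarrow> positive (r *\<^sub>R unit + x)"
  using positive_unit_minus[of "- x" r] by simp

text \<open>An idempotent is an order unit of its Peirce space. The constant is doubled because
  \<open>p\<close> weighs the 1/2 component of \<open>z\<close> only by one half in its pairing with
  \<open>z \<star> z\<close>.\<close>

lemma positive_idem_minus: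
  assumes p: "idem p" and x: "x \<in> peirce 1 p"
  shows "positive ((2 * mult_const * norm x) *\<^sub>R p - x)"
proof (rule positiveI)
  fix y assume "positive y"
  then obtain z where y: "y = z \<star> z" by (auto simp: positive_def)
  obtain z1 zh z0 where z: "z = z1 + zh + z0"
    and z1: "z1 \<in> peirce 1 p" and zh: "zh \<in> peirce (1/2) p" and z0: "z0 \<in> peirce 0 p"
    using peirce_decomposition[OF p] .
  have o: "z1 \<bullet> zh = 0" "zh \<bullet> z1 = 0" "z1 \<bullet> z0 = 0" "zh \<bullet> z0 = 0"
    using peirce_orthogonal[OF z1 zh] peirce_orthogonal[OF zh z1] peirce_orthogonal[OF z1 z0]
      peirce_orthogonal[OF zh z0] by auto
  have x1: "x \<star> z1 \<in> peirce 1 p" and xh: "x \<star> zh \<in> peirce (1/2) p" and x0: "x \<star> z0 = 0"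
    using peirce_one_mult[OF p x z1] peirce_one_mult[OF p x zh] peirce_one_zero[OF p x z0] by auto
  have ox: "(x \<star> z1) \<bullet> zh = 0" "(x \<star> z1) \<bullet> z0 = 0"
    "(x \<star> zh) \<bullet> z1 = 0" "(x \<star> zh) \<bullet> z0 = 0"
    using peirce_orthogonal[OF x1 zh] peirce_orthogonal[OF x1 z0] peirce_orthogonal[OF xh z1]
      peirce_orthogonal[OF xh z0] by auto
  have q: "w \<bullet> y = (w \<star> z) \<bullet> z" for w
    by (simp add: y inner_mult_swap[symmetric] mult_commute[of w])
  have b: "(x \<star> w) \<bullet> w \<le> mult_const * norm x * (w \<bullet> w)" for w
  proof -
    have "(x \<star> w) \<bullet> w \<le> norm (x \<star> w) * norm w" by (rule norm_cauchy_schwarz)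
    also have "\<dots> \<le> mult_const * norm x * norm w * norm w"
      by (intro mult_right_mono norm_mult_le) auto
    also have "\<dots> = mult_const * norm x * (w \<bullet> w)" by (simp add: dot_square_norm power2_eq_square)
    finally show ?thesis .
  qed
  have "x \<bullet> y = (x \<star> z1) \<bullet> z1 + (x \<star> zh) \<bullet> zh"
    by (simp add: q) (simp add: z mult_add_right x0 ox inner_add_left inner_add_right)
  also have "\<dots> \<le> mult_const * norm x * (z1 \<bullet> z1) + mult_const * norm x * (zh \<bullet> zh)"
    by (intro add_mono b)
  also have "\<dots> \<le> mult_const * norm x * (2 * (z1 \<bullet> z1)) + mult_const * norm x * (zh \<bullet> zh)"
    using mult_const_pos by (intro add_mono mult_left_mono) auto
  also have "\<dots> = (2 * mult_const * norm x) * (p \<bullet> y)"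
  proof -
    have "p \<star> z = z1 + (1/2) *\<^sub>R zh"
      using z1 zh z0 by (simp add: z mult_add_right peirce_def)
    then have "p \<bullet> y = (z1 + (1/2) *\<^sub>R zh) \<bullet> z" by (simp add: q)
    also have "\<dots> = z1 \<bullet> z1 + (zh \<bullet> zh) / 2"
      by (simp add: z inner_add_left inner_add_right o)
    finally show ?thesis by (simp add: algebra_simps)
  qed
  finally show "0 \<le> ((2 * mult_const * norm x) *\<^sub>R p - x) \<bullet> y"
    by (simp add: inner_diff_left)
qed

lemma eq_from_positive:
  assumes "\<And>y. positive y \<Longrightarrow> x \<bullet> y = x' \<bullet> y" shows "x = x'"
proof -
  define z where "z = x - x'"
  have z: "z \<bullet> y = 0" if "positive y" for y using assms[OF that] by (simp add: z_def inner_diff_left)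
  have "z \<bullet> ((mult_const * norm z) *\<^sub>R unit + z) = 0" "z \<bullet> unit = 0"
    using z positive_unit_plus[of z] by auto
  then have "z \<bullet> z = 0" by (simp add: inner_add_right)
  then show ?thesis by (simp add: z_def)
qed

lemma effects_zero: "0 \<in> effects" and effects_unit: "unit \<in> effects"
  by (simp_all add: effects_iff)

lemma effects_scaleR:
  assumes "a \<in> effects" "0 \<le> t" "t \<le> 1" shows "t *\<^sub>R a \<in> effects"
proof -
  have "unit - t *\<^sub>R a = (1 - t) *\<^sub>R unit + t *\<^sub>R (unit - a)" by (simp add: algebra_simps)
  then show ?thesis
    using assms positive_add[OF positive_scaleR[of "1 - t" unit] positive_scaleR[of t "unit - a"]]
    by (simp add: effects_iff positive_scaleR)
qed

lemma effects_normalize: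
  assumes "positive x" "0 < r" "mult_const * norm x \<le> r" shows "(1 / r) *\<^sub>R x \<in> effects"
proof -
  have "unit - (1 / r) *\<^sub>R x = (1 / r) *\<^sub>R (r *\<^sub>R unit - x)" using assms(2)
    by (simp add: scaleR_diff_right)
  then show ?thesis
    using assms positive_scaleR[OF _ positive_unit_minus[OF assms(3)], of "1 / r"]
    by (simp add: effects_iff positive_scaleR)
qed

text \<open>Pairing with a positive element reduces homogeneity to an additive real function, and
  these pairings separate points.\<close>

lemma effect_map_scaleR:
  assumes pos: "\<And>b. b \<in> effects \<Longrightarrow> positive (g b)"
    and add: "\<And>b c. b \<in> effects \<Longrightarrow> c \<in> effects \<Longrightarrow> b + c \<in> effects \<Longrightarrow> g (b + c) = g b + g c"
    and b: "b \<in> effects" and t: "0 \<le> t" "t \<le> 1"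
  shows "g (t *\<^sub>R b) = t *\<^sub>R g b"
proof (rule eq_from_positive)
  fix y assume y: "positive y"
  define h where "h s = g (s *\<^sub>R b) \<bullet> y" for s
  have "h t = t * h 1"
  proof (rule additive_on_unit_interval[OF _ _ t])
    show "0 \<le> h s" if "0 \<le> s" "s \<le> 1" for s
      unfolding h_def using pos[OF effects_scaleR[OF b that]] y by (rule positive_inner)
    show "h (r + s) = h r + h s" if "0 \<le> r" "0 \<le> s" "r + s \<le> 1" for r s
      using add[of "r *\<^sub>R b" "s *\<^sub>R b"] effects_scaleR[OF b] that
      by (simp add: h_def inner_add_left scaleR_add_left[symmetric])
  qed
  then show "g (t *\<^sub>R b) \<bullet> y = (t *\<^sub>R g b) \<bullet> y" by (simp add: h_def)
qed

text \<open>The map extends to the cone by scaling into the effects, and then to the whole space by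
  differences of positive elements.\<close>

lemma effect_map_extension:
  assumes pos: "\<And>b. b \<in> effects \<Longrightarrow> positive (g b)"
    and add: "\<And>b c. b \<in> effects \<Longrightarrow> c \<in> effects \<Longrightarrow> b + c \<in> effects \<Longrightarrow> g (b + c) = g b + g c"
  obtains M where "linear M" "\<And>b. b \<in> effects \<Longrightarrow> M b = g b"
    "\<And>x. positive x \<Longrightarrow> positive (M x)"
proof -
  have scale: "g (t *\<^sub>R b) = t *\<^sub>R g b" if "b \<in> effects" "0 \<le> t" "t \<le> 1" for t b
    using pos add that by (rule effect_map_scaleR)
  \<comment> \<open>Dividing a positive \<open>x\<close> by this number gives an effect; the summand
    1 keeps it positive at \<open>x = 0\<close>.\<close>
  define N where "N x = mult_const * norm x + 1" for x :: 'a
  have N: "0 < N x" "mult_const * norm x \<le> N x" for x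
    using mult_const_pos by (simp_all add: N_def add_nonneg_pos)
  define G where "G x = N x *\<^sub>R g ((1 / N x) *\<^sub>R x)" for x
  have le: "r *\<^sub>R g ((1 / r) *\<^sub>R x) = s *\<^sub>R g ((1 / s) *\<^sub>R x)"
    if "0 < r" "r \<le> s" "(1 / r) *\<^sub>R x \<in> effects" for r s x
  proof -
    have "(1 / s) *\<^sub>R x = (r / s) *\<^sub>R ((1 / r) *\<^sub>R x)" using that(1) by simp
    then have "g ((1 / s) *\<^sub>R x) = (r / s) *\<^sub>R g ((1 / r) *\<^sub>R x)"
      using scale[OF that(3), of "r / s"] that by simp
    then show ?thesis using that(1,2) by simp
  qed
  have G: "r *\<^sub>R g ((1 / r) *\<^sub>R x) = G x" if "positive x" "0 < r" "(1 / r) *\<^sub>R x \<in> effects" for r x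
  proof (cases "r \<le> N x")
    case True
    then show ?thesis using le[OF that(2) _ that(3)] by (simp add: G_def)
  next
    case False
    then show ?thesis
      using le[OF N(1)[of x] _ effects_normalize[OF that(1) N], of r] by (simp add: G_def)
  qed
  have G_add: "G (x + y) = G x + G y" if "positive x" "positive y" for x y
  proof -
    define r where "r = N x + N y"
    have r: "0 < r" "mult_const * norm x \<le> r" "mult_const * norm y \<le> r"
      using N[of x] N[of y] by (simp_all add: r_def)
    have "norm (x + y) \<le> norm x + norm y" by (rule norm_triangle_ineq)
    then have "mult_const * norm (x + y) \<le> mult_const * (norm x + norm y)"
      using mult_const_pos by (intro mult_left_mono) auto
    then have r': "mult_const * norm (x + y) \<le> r" by (simp add: r_def N_def algebra_simps)
    have e: "(1 / r) *\<^sub>R x \<in> effects" "(1 / r) *\<^sub>R y \<in> effects" "(1 / r) *\<^sub>R (x + y) \<in> effects"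
      using that r r' positive_add by (auto intro: effects_normalize)
    have "G (x + y) = r *\<^sub>R g ((1 / r) *\<^sub>R (x + y))" using G[OF positive_add[OF that] r(1) e(3)] by simp
    also have "\<dots> = r *\<^sub>R (g ((1 / r) *\<^sub>R x) + g ((1 / r) *\<^sub>R y))"
      using add[OF e(1,2)] e(3) by (simp add: scaleR_add_right)
    also have "\<dots> = G x + G y"
      unfolding scaleR_add_right using G[OF that(1) r(1) e(1)] G[OF that(2) r(1) e(2)] by simp
    finally show ?thesis .
  qed
  have G_scale: "G (c *\<^sub>R x) = c *\<^sub>R G x" if "positive x" "0 \<le> c" for c x
  proof (cases "c = 0")
    case True
    then show ?thesis using scale[OF effects_zero, of 0] by (simp add: G_def)
  next
    case False
    define r where "r = N x"
    have e: "(1 / (c * r)) *\<^sub>R (c *\<^sub>R x) = (1 / r) *\<^sub>R x" using False by simp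
    have "(1 / r) *\<^sub>R x \<in> effects" unfolding r_def using that(1) N by (rule effects_normalize)
    moreover have "0 < c * r" using False that(2) N by (simp add: r_def)
    ultimately have "G (c *\<^sub>R x) = (c * r) *\<^sub>R g ((1 / (c * r)) *\<^sub>R (c *\<^sub>R x))"
      using positive_scaleR[OF that(2,1)] by (intro G[symmetric]) (simp_all only: e)
    also have "\<dots> = c *\<^sub>R G x" unfolding e by (simp add: G_def r_def)
    finally show ?thesis .
  qed
  have G_effect: "G b = g b" if "b \<in> effects" for b
    using G[of b 1] that by (simp add: effects_iff)
  have G_pos: "positive (G x)" if "positive x" for x
    unfolding G_def using N[of x] effects_normalize[OF that N] by (intro positive_scaleR pos) auto
  define M where "M v = G (N v *\<^sub>R unit + v) - G (N v *\<^sub>R unit)" for v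
  have pu: "positive (N v *\<^sub>R unit + v)" "positive (N v *\<^sub>R unit)" for v
    using N[of v] positive_unit_plus[of v "N v"] positive_scaleR[of "N v" unit] by auto
  \<comment> \<open>Shows that the value does not depend on how an element is written as a
    difference of positive ones, which makes linearity immediate.\<close>
  have M: "M (x - y) = G x - G y" if "positive x" "positive y" for x y
  proof -
    define v where "v = x - y"
    have e: "(N v *\<^sub>R unit + v) + y = x + N v *\<^sub>R unit" by (simp add: v_def)
    have "G (N v *\<^sub>R unit + v) + G y = G ((N v *\<^sub>R unit + v) + y)"
      by (rule G_add[OF pu(1) that(2), symmetric])
    also have "\<dots> = G (x + N v *\<^sub>R unit)" by (simp only: e)
    also have "\<dots> = G x + G (N v *\<^sub>R unit)" by (rule G_add[OF that(1) pu(2)])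
    finally have "G (N v *\<^sub>R unit + v) + G y = G x + G (N v *\<^sub>R unit)" .
    then show ?thesis by (simp add: M_def v_def[symmetric] algebra_simps)
  qed
  have split: "\<exists>x y. positive x \<and> positive y \<and> v = x - y" for v
    using pu[of v] by (intro exI[of _ "N v *\<^sub>R unit + v"] exI[of _ "N v *\<^sub>R unit"]) auto
  have "linear M"
  proof (rule linearI)
    fix v w
    obtain x y x' y' where h: "positive x" "positive y" "v = x - y" "positive x'" "positive y'" "w = x' - y'"
      using split by metis
    have e: "v + w = (x + x') - (y + y')" using h by simp
    have "M (v + w) = G (x + x') - G (y + y')"
      unfolding e by (rule M) (use h positive_add in auto)
    also have "\<dots> = (G x - G y) + (G x' - G y')" using G_add h by simp
    also have "\<dots> = M v + M w" unfolding h(3,6) using M h by simp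
    finally show "M (v + w) = M v + M w" .
  next
    fix c v
    obtain x y where h: "positive x" "positive y" "v = x - y" using split by metis
    show "M (c *\<^sub>R v) = c *\<^sub>R M v"
    proof (cases "0 \<le> c")
      case True
      have "M (c *\<^sub>R v) = G (c *\<^sub>R x) - G (c *\<^sub>R y)"
        unfolding h(3) scaleR_diff_right by (rule M) (use h positive_scaleR True in auto)
      also have "\<dots> = c *\<^sub>R M v"
        unfolding h(3) M[OF h(1,2)] using G_scale h True by (simp add: scaleR_diff_right)
      finally show ?thesis .
    next
      case False
      have e: "c *\<^sub>R v = (- c) *\<^sub>R y - (- c) *\<^sub>R x" by (simp add: h(3) scaleR_diff_right)
      have "M (c *\<^sub>R v) = G ((- c) *\<^sub>R y) - G ((- c) *\<^sub>R x)"
        unfolding e by (rule M) (use h(1,2) False in \<open>auto intro!: positive_scaleR simp del: scaleR_minus_left\<close>)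
      also have "\<dots> = (- c) *\<^sub>R G y - (- c) *\<^sub>R G x"
        using G_scale[OF h(1), of "- c"] G_scale[OF h(2), of "- c"] False by (simp only: neg_0_le_iff_le)
      also have "\<dots> = c *\<^sub>R M v" unfolding h(3) M[OF h(1,2)] by (simp add: scaleR_diff_right)
      finally show ?thesis .
    qed
  qed
  moreover have MG: "M x = G x" if "positive x" for x
    using M[OF that positive_zero] G_effect[OF effects_zero] scale[OF effects_zero, of 0] by simp
  moreover have "M b = g b" if "b \<in> effects" for b
    using MG[of b] G_effect[OF that] that by (simp add: effects_iff)
  ultimately show thesis using that G_pos by metis
qed

lemma linear_eq_on_effects:
  assumes f: "linear f" and g: "linear (g :: 'a \<Rightarrow> 'a)"
    and eq: "\<And>b. b \<in> effects \<Longrightarrow> f b = g b"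
  shows "f x = g x"
proof -
  define r where "r = mult_const * norm x + 1"
  have r: "0 < r" "mult_const * norm x \<le> r" using mult_const_pos by (simp_all add: r_def add_nonneg_pos)
  define y where "y = r *\<^sub>R unit + x"
  define s where "s = mult_const * norm y + 1"
  have s: "0 < s" "mult_const * norm y \<le> s" using mult_const_pos by (simp_all add: s_def add_nonneg_pos)
  have "(1 / s) *\<^sub>R y \<in> effects"
    using positive_unit_plus[OF r(2)] s unfolding y_def[symmetric] by (rule effects_normalize)
  then have "f ((1 / s) *\<^sub>R y) = g ((1 / s) *\<^sub>R y)" by (rule eq)
  then have "f y = g y" using s by (simp add: linear_scale[OF f] linear_scale[OF g])
  moreover have "f unit = g unit" by (rule eq) (rule effects_unit)
  moreover have "x = y - r *\<^sub>R unit" by (simp add: y_def)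
  ultimately show ?thesis
    by (simp add: linear_diff[OF f] linear_diff[OF g] linear_scale[OF f] linear_scale[OF g])
qed

text \<open>Membership is expressed by projections of idempotents because these will be operators of
  the sequential product, with which other product operators commute.\<close>

lemma mem_offdiagI:
  assumes f: "idem f" and g: "idem g" and fg: "f \<star> g = 0"
    and "quad_rep (f + g) y = y" "quad_rep f y = 0" "quad_rep g y = 0"
  shows "y \<in> offdiag f g"
proof -
  have "(f + g) \<star> y = y"
    using quad_rep_in_peirce_one[OF idem_add[OF f g fg], of y] assms(4) by (simp add: peirce_def)
  then have gy: "g \<star> y = y - f \<star> y" by (simp add: mult_linear algebra_simps)
  have half: "a = (1/2) *\<^sub>R b" if "2 *\<^sub>R a = b" for a b :: 'a using that by auto
  have ff: "f \<star> (f \<star> y) = (1/2) *\<^sub>R (f \<star> y)"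
    using assms(5) by (intro half) (simp add: quad_rep_idem[OF f])
  have gg: "g \<star> (g \<star> y) = (1/2) *\<^sub>R (g \<star> y)"
    using assms(6) by (intro half) (simp add: quad_rep_idem[OF g])
  have "g \<star> (f \<star> y) = f \<star> (g \<star> y)" by (simp add: orthogonal_idem_commute[OF f fg])
  also have "\<dots> = f \<star> y - f \<star> (f \<star> y)" by (simp add: gy mult_diff_right)
  also have "\<dots> = (1 - 1/2) *\<^sub>R (f \<star> y)" by (simp only: ff scaleR_left_diff_distrib scaleR_one)
  finally have gf: "g \<star> (f \<star> y) = (1/2) *\<^sub>R (f \<star> y)" by simp
  have "(1/2) *\<^sub>R (g \<star> y) = g \<star> (y - f \<star> y)" using gg gy by simp
  also have "\<dots> = g \<star> y - (1/2) *\<^sub>R (f \<star> y)" by (simp add: mult_diff_right gf)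
  finally have "(1/2) *\<^sub>R (g \<star> y) + (1/2) *\<^sub>R (f \<star> y) = g \<star> y" by simp
  moreover have "(1/2) *\<^sub>R (g \<star> y) + (1/2) *\<^sub>R (f \<star> y) = (1/2) *\<^sub>R y"
    by (simp add: gy flip: scaleR_add_right)
  ultimately have g': "g \<star> y = (1/2) *\<^sub>R y" by simp
  have "f \<star> y = y - (1/2) *\<^sub>R y" using gy g' by (simp add: algebra_simps)
  also have "\<dots> = (1 - 1/2) *\<^sub>R y" by (simp only: scaleR_left_diff_distrib scaleR_one)
  finally have "f \<star> y = (1/2) *\<^sub>R y" by simp
  then show ?thesis using g' by (simp add: offdiag_def peirce_def)
qed

end

subsection \<open>Sequential products\<close>

locale euclidean_jordan_sequential_product =
  euclidean_jordan_algebra mult unit + sequential_product mult unit sprod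
  for mult :: "'a::{real_inner, complete_space} \<Rightarrow> 'a \<Rightarrow> 'a"  (infixl "\<star>" 70)
    and unit :: 'a
    and sprod :: "'a \<Rightarrow> 'a \<Rightarrow> 'a"  (infixl "\<diamondop>" 70)
begin

section \<open>Products with idempotents and with scalars\<close>

lemma effects_jle: "b \<in> effects \<Longrightarrow> c \<in> effects \<Longrightarrow> b + c \<in> effects \<longleftrightarrow> b + c \<preceq> unit"
  by (simp add: effects_iff jle_def positive_add)

lemma sprod_zero: "a \<in> effects \<Longrightarrow> a \<diamondop> 0 = 0"
  using sprod_add[of a 0 0] by (simp add: effects_zero jle_def)

lemma zero_sprod: "a \<in> effects \<Longrightarrow> 0 \<diamondop> a = 0"
  using sprod_eq_zero[of a 0] by (simp add: effects_zero sprod_zero)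

text \<open>The effect \<open>a\<close> commutes with 0, hence with the complement of 0.\<close>

lemma sprod_unit: "a \<in> effects \<Longrightarrow> a \<diamondop> unit = a"
  using commutes_compl[of a 0] by (simp add: effects_zero sprod_zero zero_sprod unit_sprod)

lemma sprod_op_ex:
  assumes a: "a \<in> effects"
  shows "\<exists>M. linear M \<and> (\<forall>b\<in>effects. M b = a \<diamondop> b) \<and> (\<forall>x. positive x \<longrightarrow> positive (M x))"
proof -
  have "positive (a \<diamondop> b)" if "b \<in> effects" for b
    using sprod_closed[OF a that] by (simp add: effects_iff)
  moreover have "a \<diamondop> (b + c) = a \<diamondop> b + a \<diamondop> c"
    if "b \<in> effects" "c \<in> effects" "b + c \<in> effects" for b c
    using sprod_add[OF a that(1,2)] effects_jle[OF that(1,2)] that(3) by blast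
  ultimately obtain M where "linear M" "\<And>b. b \<in> effects \<Longrightarrow> M b = a \<diamondop> b"
    "\<And>x. positive x \<Longrightarrow> positive (M x)"
    using effect_map_extension[of "\<lambda>b. a \<diamondop> b"] by blast
  then show ?thesis by blast
qed

definition sprod_op :: "'a \<Rightarrow> 'a \<Rightarrow> 'a" where
  "sprod_op a = (SOME M. linear M \<and> (\<forall>b\<in>effects. M b = a \<diamondop> b) \<and> (\<forall>x. positive x \<longrightarrow> positive (M x)))"

lemma linear_sprod_op: "a \<in> effects \<Longrightarrow> linear (sprod_op a)"
  and sprod_op: "a \<in> effects \<Longrightarrow> b \<in> effects \<Longrightarrow> sprod_op a b = a \<diamondop> b"
  and positive_sprod_op: "a \<in> effects \<Longrightarrow> positive x \<Longrightarrow> positive (sprod_op a x)"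
  using someI_ex[OF sprod_op_ex] unfolding sprod_op_def by blast+

lemma sprod_scaleR:
  assumes "a \<in> effects" "b \<in> effects" "0 \<le> t"
    "t \<le> 1" shows "a \<diamondop> (t *\<^sub>R b) = t *\<^sub>R (a \<diamondop> b)"
  using assms effects_scaleR[of b t] linear_scale[OF linear_sprod_op[OF assms(1)], of t b]
  by (simp flip: sprod_op)

text \<open>The element \<open>c\<close> lies below both \<open>p\<close> and its complement. These
  are orthogonal, so pairing each difference with the other idempotent shows that
  \<open>c \<bullet> unit\<close> cannot be positive.\<close>

lemma idem_sprod_self:
  assumes p: "idem p"
  shows "p \<diamondop> (unit - p) = 0" "p \<diamondop> p = p"
proof -
  have e: "p \<in> effects" "unit - p \<in> effects" using idem_effect p idem_compl by auto
  define c where "c = p \<diamondop> (unit - p)"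
  have c': "c = (unit - p) \<diamondop> p" using commutes_compl[OF e(1) e(1)] by (simp add: c_def)
  have c: "c \<in> effects" using sprod_closed[OF e] by (simp add: c_def)
  have sum: "p \<diamondop> p + c = p" "(unit - p) \<diamondop> (unit - p) + c = unit - p"
    using sprod_add[OF e(1) e] sprod_add[OF e(2) e(2,1)] e sprod_unit
    by (simp_all add: c_def[symmetric] c'[symmetric] jle_def)
  have "positive (p - c)" "positive ((unit - p) - c)"
    using sum sprod_closed[OF e(1) e(1)] sprod_closed[OF e(2) e(2)]
    by (simp_all add: effects_iff flip: eq_diff_eq)
  then have "0 \<le> (p - c) \<bullet> (unit - p)" "0 \<le> ((unit - p) - c) \<bullet> p"
    using e by (auto intro!: positive_inner simp: effects_iff)
  moreover have pp: "p \<bullet> unit = p \<bullet> p"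
    using p inner_square_unit[of p] by (simp add: idem_def)
  ultimately have "c \<bullet> unit \<le> 0"
    by (simp add: inner_diff_left inner_diff_right inner_commute[of unit p])
  moreover have "0 \<le> c \<bullet> unit" using c by (auto intro!: positive_inner simp: effects_iff)
  ultimately have "c = 0" using c by (intro positive_inner_unit_zero) (auto simp: effects_iff)
  then show "p \<diamondop> (unit - p) = 0" "p \<diamondop> p = p" using sum by (simp_all add: c_def)
qed

text \<open>Both \<open>y\<close> and \<open>-y\<close> lie below multiples of
  \<open>unit - p\<close>, which the positive operator kills.\<close>

lemma sprod_op_idem_zero:
  assumes p: "idem p" and y: "y \<in> peirce 0 p" shows "sprod_op p y = 0"
proof -
  have e: "p \<in> effects" using p by (rule idem_effect)
  note lin = linear_sprod_op[OF e]
  have q: "idem (unit - p)" using p by (rule idem_compl)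
  have M0: "sprod_op p (unit - p) = 0"
    using idem_sprod_self(1)[OF p] by (simp add: sprod_op e idem_effect[OF q])
  have nonneg: "positive (- sprod_op p x)" if x: "x \<in> peirce 0 p" for x
  proof -
    have "x \<in> peirce 1 (unit - p)" using x by (simp add: peirce_compl_iff)
    then have "positive (sprod_op p ((2 * mult_const * norm x) *\<^sub>R (unit - p) - x))"
      using positive_sprod_op[OF e positive_idem_minus[OF q]] by blast
    moreover have "sprod_op p (c *\<^sub>R (unit - p) - x) = - sprod_op p x" for c
      by (subst linear_diff[OF lin], subst linear_scale[OF lin]) (simp add: M0)
    ultimately show ?thesis by simp
  qed
  have "- y \<in> peirce 0 p" using y subspace_peirce subspace_neg by blast
  then have "positive (sprod_op p y)" using nonneg[of "- y"] by (simp add: linear_neg[OF lin])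
  then show ?thesis using nonneg[OF y] by (rule positive_antisym)
qed

text \<open>The product of \<open>x\<close> with the complement of \<open>p\<close> vanishes in one
  order, hence in the other. So \<open>x\<close> commutes with that complement, and then with
  \<open>p\<close>.\<close>

lemma idem_commute_effect:
  assumes p: "idem p" and x: "x \<in> effects" "x \<in> peirce 1 p"
  shows "p \<diamondop> x = x" "x \<diamondop> p = x"
proof -
  have e: "p \<in> effects" "unit - p \<in> effects" using idem_effect p idem_compl by auto
  have "x \<in> peirce 0 (unit - p)" using x(2) by (simp add: peirce_compl_iff)
  then have "(unit - p) \<diamondop> x = 0"
    using sprod_op_idem_zero[OF idem_compl[OF p], of x] by (simp add: sprod_op[OF e(2) x(1)])
  then have z: "x \<diamondop> (unit - p) = 0" using sprod_eq_zero[OF e(2) x(1)] by simp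
  have "x \<diamondop> (unit - (unit - p)) = (unit - (unit - p)) \<diamondop> x"
    using z \<open>(unit - p) \<diamondop> x = 0\<close> by (intro commutes_compl[OF x(1) e(2)]) simp
  moreover have "x \<diamondop> p = x"
    using sprod_add[OF x(1) e] z sprod_unit[OF x(1)] by (simp add: jle_def)
  ultimately show "p \<diamondop> x = x" "x \<diamondop> p = x" by simp_all
qed

lemma sprod_op_idem:
  assumes p: "idem p" shows "sprod_op p x = quad_rep p x"
proof -
  have e: "p \<in> effects" using p by (rule idem_effect)
  note lin = linear_sprod_op[OF e]
  have Mp: "sprod_op p p = p" using idem_sprod_self(2)[OF p] by (simp add: sprod_op e)
  have one: "sprod_op p y = y" if y: "y \<in> peirce 1 p" for y
  proof -
    \<comment> \<open>A shift by a multiple of \<open>p\<close> makes \<open>y\<close> positive, so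
      that it can be scaled to an effect.\<close>
    define z where "z = (2 * mult_const * norm y) *\<^sub>R p + y"
    have pz: "z \<in> peirce 1 p"
      using y p by (simp add: z_def peirce_def idem_def mult_linear)
    have "positive z"
      using positive_idem_minus[OF p, of "- y"] y subspace_neg[OF subspace_peirce y] by (simp add: z_def)
    define r where "r = mult_const * norm z + 1"
    have r: "0 < r" "mult_const * norm z \<le> r" using mult_const_pos by (simp_all add: r_def add_nonneg_pos)
    have ez: "(1 / r) *\<^sub>R z \<in> effects" using \<open>positive z\<close> r by (rule effects_normalize)
    moreover have "(1 / r) *\<^sub>R z \<in> peirce 1 p" using pz subspace_peirce subspace_scale by blast
    ultimately have "sprod_op p ((1 / r) *\<^sub>R z) = (1 / r) *\<^sub>R z"
      using idem_commute_effect(1)[OF p] by (simp add: sprod_op[OF e])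
    then have "sprod_op p z = z" using r by (simp add: linear_scale[OF lin])
    then show ?thesis by (simp add: z_def linear_add[OF lin] linear_scale[OF lin] Mp)
  qed
  have half: "sprod_op p y = 0" if y: "y \<in> peirce (1/2) p" for y
  proof -
    \<comment> \<open>The square of \<open>(unit - p) + t y\<close> has an image with no constant
      term, so for small \<open>t\<close> its sign is decided by the linear term. Applied to
      \<open>y\<close> and \<open>-y\<close> this gives 0.\<close>
    have nonneg: "positive (sprod_op p y)" if y: "y \<in> peirce (1/2) p" for y
    proof (rule positiveI)
      fix w assume w: "positive w"
      define k where "k = sprod_op p (y \<star> y) \<bullet> w"
      have qy: "(unit - p) \<star> y = (1/2) *\<^sub>R y" "y \<star> (unit - p) = (1/2) *\<^sub>R y"
        using y peirce_compl_iff[of y "1/2" p] by (simp_all add: peirce_def mult_commute[of y])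
      have qq: "(unit - p) \<star> (unit - p) = unit - p" using idem_compl[OF p] by (simp add: idem_def)
      have M0: "sprod_op p (unit - p) = 0"
        by (rule sprod_op_idem_zero[OF p]) (use p in \<open>simp add: peirce_def idem_def mult_linear\<close>)
      have "- (t * k) \<le> sprod_op p y \<bullet> w" if t: "0 < t" for t
      proof -
        have "((unit - p) + t *\<^sub>R y) \<star> ((unit - p) + t *\<^sub>R y)
            = (unit - p) + (t *\<^sub>R ((1/2) *\<^sub>R y) + t *\<^sub>R ((1/2) *\<^sub>R y)) + (t * t) *\<^sub>R (y \<star> y)"
          by (simp add: mult_add_left mult_add_right mult_scaleR_left mult_scaleR_right qq qy
              scaleR_add_right)
        also have "t *\<^sub>R ((1/2) *\<^sub>R y) + t *\<^sub>R ((1/2) *\<^sub>R y) = t *\<^sub>R y"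
          by (simp flip: scaleR_add_left)
        finally have "positive ((unit - p) + t *\<^sub>R y + (t * t) *\<^sub>R (y \<star> y))"
          using positive_square by metis
        then have "positive (sprod_op p ((unit - p) + t *\<^sub>R y + (t * t) *\<^sub>R (y \<star> y)))"
          by (rule positive_sprod_op[OF e])
        then have "positive (t *\<^sub>R sprod_op p y + (t * t) *\<^sub>R sprod_op p (y \<star> y))"
          by (simp only: linear_add[OF lin] linear_scale[OF lin] M0 add_0)
        then have "0 \<le> t * (sprod_op p y \<bullet> w) + t * t * k"
          using positive_inner[OF _ w] by (fastforce simp: k_def inner_add_left)
        then have "0 \<le> t * (sprod_op p y \<bullet> w + t * k)" by (simp add: algebra_simps)
        then have "0 \<le> sprod_op p y \<bullet> w + t * k" using t by (simp add: zero_le_mult_iff)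
        then show ?thesis by simp
      qed
      note b = this
      show "0 \<le> sprod_op p y \<bullet> w"
      proof (rule ccontr)
        assume "\<not> ?thesis"
        then have neg: "0 < - (sprod_op p y \<bullet> w)" by simp
        define m where "m = - (sprod_op p y \<bullet> w)"
        have m: "0 < m" using neg by (simp add: m_def)
        \<comment> \<open>This \<open>t\<close> is small enough for the quadratic contribution to
          stay below \<open>m\<close>.\<close>
        have "0 < m / (\<bar>k\<bar> + 1)" using m by simp
        then have "m \<le> m / (\<bar>k\<bar> + 1) * k" using b[of "m / (\<bar>k\<bar> + 1)"] by (simp add: m_def)
        also have "\<dots> \<le> m / (\<bar>k\<bar> + 1) * \<bar>k\<bar>" using m by (intro mult_left_mono) auto
        also have "\<dots> < m" using m by (simp add: field_simps)
        finally show False by simp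
      qed
    qed
    have "- y \<in> peirce (1/2) p" using y subspace_neg[OF subspace_peirce] by blast
    then have "positive (- sprod_op p y)" using nonneg[of "- y"] by (simp add: linear_neg[OF lin])
    then show ?thesis using nonneg[OF y] positive_antisym by blast
  qed
  obtain x1 xh x0 where x: "x = x1 + xh + x0"
    "x1 \<in> peirce 1 p" "xh \<in> peirce (1/2) p" "x0 \<in> peirce 0 p"
    using peirce_decomposition[OF p] .
  then show ?thesis
    using one half sprod_op_idem_zero[OF p] quad_rep_peirce[OF p]
    by (simp add: linear_add[OF lin] linear_add[OF linear_quad_rep])
qed

lemma commute_peirce_sum:
  assumes p: "idem p" and x: "x \<in> effects" "x \<in> peirce 1 p" and y: "y \<in> effects" "y \<in> peirce 0 p"
    and xy: "x + y \<in> effects"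
  shows "p \<diamondop> (x + y) = (x + y) \<diamondop> p" "p \<diamondop> (x + y) = x"
proof -
  have e: "p \<in> effects" using p by (rule idem_effect)
  have py: "p \<diamondop> y = 0" using sprod_op_idem_zero[OF p y(2)] by (simp add: sprod_op e y)
  then have yp: "y \<diamondop> p = 0" using sprod_eq_zero[OF e y(1)] by simp
  show "p \<diamondop> (x + y) = (x + y) \<diamondop> p"
    using idem_commute_effect[OF p x] py yp xy x y e
    by (intro commutes_add) (auto simp: effects_iff jle_def)
  show "p \<diamondop> (x + y) = x"
    using sprod_add[OF e x(1) y(1)] xy idem_commute_effect[OF p x] py by (simp add: effects_iff jle_def)
qed

text \<open>An idempotent \<open>p\<close> commutes with \<open>t *\<^sub>R unit\<close>, so the
  product can be computed in the known order; frames then carry the result to all elements.\<close>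

lemma sprod_op_scalar:
  assumes t: "0 \<le> t" "t \<le> 1" shows "sprod_op (t *\<^sub>R unit) x = t *\<^sub>R x"
proof -
  have et: "t *\<^sub>R unit \<in> effects" using effects_unit t by (rule effects_scaleR)
  have idem: "sprod_op (t *\<^sub>R unit) p = t *\<^sub>R p" if p: "idem p" for p
  proof -
    have e: "p \<in> effects" "unit - p \<in> effects" using idem_effect p idem_compl by auto
    have s: "t *\<^sub>R p + t *\<^sub>R (unit - p) = t *\<^sub>R unit" by (simp flip: scaleR_add_right)
    have "t *\<^sub>R p \<in> peirce 1 p" "t *\<^sub>R (unit - p) \<in> peirce 0 p"
      using p by (simp_all add: peirce_def idem_def mult_linear)
    then have "p \<diamondop> (t *\<^sub>R unit) = (t *\<^sub>R unit) \<diamondop> p"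
      "p \<diamondop> (t *\<^sub>R unit) = t *\<^sub>R p"
      using commute_peirce_sum[OF p, of "t *\<^sub>R p" "t *\<^sub>R (unit - p)"] effects_scaleR[OF e(1) t]
        effects_scaleR[OF e(2) t] et s by auto
    then show ?thesis by (simp add: sprod_op[OF et e(1)])
  qed
  obtain F c where F: "frame F" "x = (\<Sum>p\<in>F. c p *\<^sub>R p)" using exists_frame .
  have lin: "linear (sprod_op (t *\<^sub>R unit))" using et by (rule linear_sprod_op)
  have "sprod_op (t *\<^sub>R unit) x = (\<Sum>p\<in>F. c p *\<^sub>R (t *\<^sub>R p))"
    unfolding F(2) linear_sum[OF lin] linear_scale[OF lin]
    by (rule sum.cong[OF refl]) (simp only: idem frame_idem[OF F(1)])
  then show ?thesis by (simp add: F(2) scaleR_sum_right mult.commute)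
qed

text \<open>A scalar effect commutes with \<open>b\<close>, so the associativity axiom turns
  homogeneity of the second argument into that of the first.\<close>

lemma scaleR_sprod:
  assumes b: "b \<in> effects" and c: "c \<in> effects" and t: "0 \<le> t" "t \<le> 1"
  shows "(t *\<^sub>R b) \<diamondop> c = t *\<^sub>R (b \<diamondop> c)"
proof -
  have et: "t *\<^sub>R unit \<in> effects" using effects_unit t by (rule effects_scaleR)
  have T: "(t *\<^sub>R unit) \<diamondop> x = t *\<^sub>R x" if "x \<in> effects" for x
    using sprod_op_scalar[OF t, of x] by (simp add: sprod_op et that)
  have "(t *\<^sub>R unit) \<diamondop> b = b \<diamondop> (t *\<^sub>R unit)"
    using sprod_scaleR[OF b effects_unit t] sprod_unit[OF b] T[OF b] by simp
  then have "(t *\<^sub>R unit) \<diamondop> (b \<diamondop> c) = ((t *\<^sub>R unit) \<diamondop> b) \<diamondop> c"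
    by (rule commutes_assoc[OF et b c])
  then show ?thesis using T b sprod_closed[OF b c] by simp
qed

lemma sprod_op_commuting:
  assumes a: "a \<in> effects" and b: "b \<in> effects" and ab: "a \<diamondop> b = b \<diamondop> a"
  shows "sprod_op a (sprod_op b x) = sprod_op (a \<diamondop> b) x"
proof (rule linear_eq_on_effects[where f = "\<lambda>x. sprod_op a (sprod_op b x)" and g = "sprod_op (a \<diamondop> b)"])
  show "linear (\<lambda>x. sprod_op a (sprod_op b x))"
    using linear_compose[OF linear_sprod_op[OF b] linear_sprod_op[OF a]] by (simp add: o_def)
  show "linear (sprod_op (a \<diamondop> b))" using sprod_closed[OF a b] by (rule linear_sprod_op)
  show "sprod_op a (sprod_op b c) = sprod_op (a \<diamondop> b) c" if c: "c \<in> effects" for c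
    using commutes_assoc[OF a b c ab] sprod_op[OF b c] sprod_op[OF a sprod_closed[OF b c]]
      sprod_op[OF sprod_closed[OF a b] c] by simp
qed

section \<open>Elements diagonal in a frame\<close>

lemma frame_coefficient_bounds:
  assumes F: "frame F" and a: "(\<Sum>p\<in>F. c p *\<^sub>R p) \<in> effects" and p: "p \<in> F"
  shows "0 \<le> c p" "c p \<le> 1"
proof -
  define a' where "a' = (\<Sum>p\<in>F. c p *\<^sub>R p)"
  have ip: "p \<star> p = p" using frame_idem[OF F p] by (simp add: idem_def)
  have pa: "p \<star> a' = c p *\<^sub>R p"
    using orth_idems_mult_sum[of F F p c] F p by (simp add: a'_def frame_def)
  have "a' \<bullet> p = (p \<star> a') \<bullet> p" by (simp add: inner_mult_swap ip)
  then have ap: "a' \<bullet> p = c p * (p \<bullet> p)" by (simp add: pa)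
  have up: "unit \<bullet> p = p \<bullet> p"
    using inner_square_unit[of p] by (simp add: ip inner_commute[of unit p])
  have pp: "0 < p \<bullet> p" using frame_nonzero[OF F p] by simp
  have pos: "positive a'" "positive (unit - a')" "positive p"
    using a positive_idem[OF frame_idem[OF F p]] by (simp_all add: effects_iff a'_def)
  have "0 \<le> a' \<bullet> p" "0 \<le> (unit - a') \<bullet> p"
    using positive_inner[OF pos(1,3)] positive_inner[OF pos(2,3)] .
  then show "0 \<le> c p" "c p \<le> 1"
    using pp by (simp_all add: inner_diff_left ap up zero_le_mult_iff)
qed

lemma positive_frame_sum:
  assumes F: "frame F" and G: "G \<subseteq> F" and c: "\<And>p. p \<in> G \<Longrightarrow> 0 \<le> c p"
  shows "positive (\<Sum>p\<in>G. c p *\<^sub>R p)"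
  using G c frame_idem[OF F] positive_idem by (intro positive_sum positive_scaleR) auto

lemma frame_partial_sum_effect:
  assumes F: "frame F" and a: "(\<Sum>p\<in>F. c p *\<^sub>R p) \<in> effects" and G: "G \<subseteq> F"
  shows "(\<Sum>p\<in>G. c p *\<^sub>R p) \<in> effects"
proof -
  note b = frame_coefficient_bounds[OF F a]
  have "(\<Sum>p\<in>F. c p *\<^sub>R p) = (\<Sum>p\<in>F - G. c p *\<^sub>R p) + (\<Sum>p\<in>G. c p *\<^sub>R p)"
    using G frame_finite[OF F] by (rule sum.subset_diff)
  then have e: "unit - (\<Sum>p\<in>G. c p *\<^sub>R p) = (unit - (\<Sum>p\<in>F. c p *\<^sub>R p)) + (\<Sum>p\<in>F - G. c p *\<^sub>R p)"
    by (simp add: algebra_simps)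
  have "positive (unit - (\<Sum>p\<in>F. c p *\<^sub>R p))" using a by (simp add: effects_iff)
  moreover have "positive (\<Sum>p\<in>F - G. c p *\<^sub>R p)" using b by (intro positive_frame_sum[OF F]) auto
  moreover have "positive (\<Sum>p\<in>G. c p *\<^sub>R p)" using b G by (intro positive_frame_sum[OF F]) auto
  ultimately show ?thesis unfolding effects_iff e using positive_add by blast
qed

lemma frame_sum_mult_offdiag:
  assumes F: "frame F" and fg: "f \<in> F" "g \<in> F" "f \<noteq> g" and x: "x \<in> offdiag f g"
  shows "(\<Sum>p\<in>F. c p *\<^sub>R p) \<star> x = ((c f + c g) / 2) *\<^sub>R x"
proof -
  have "(\<Sum>p\<in>F. c p *\<^sub>R p) \<star> x = (\<Sum>p\<in>F. c p *\<^sub>R (p \<star> x))"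
    by (simp add: mult_sum_left mult_scaleR_left)
  also have "\<dots> = (\<Sum>p\<in>{f, g}. c p *\<^sub>R (p \<star> x))"
  proof (rule sum.mono_neutral_right[OF frame_finite[OF F]])
    show "\<forall>p\<in>F - {f, g}. c p *\<^sub>R (p \<star> x) = 0"
      using offdiag_annihilate[OF F fg(1,2) _ fg(3) _ _ x] by auto
  qed (use fg in auto)
  also have "\<dots> = c f *\<^sub>R (f \<star> x) + c g *\<^sub>R (g \<star> x)" using fg(3) by simp
  also have "\<dots> = ((c f + c g) / 2) *\<^sub>R x"
    using offdiag_mult[OF x] by (simp add: add_divide_distrib scaleR_add_left)
  finally show ?thesis .
qed

lemma jsqrt_frame_sum:
  assumes F: "frame F" and c: "\<And>p. p \<in> F \<Longrightarrow> 0 \<le> c p"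
  shows "jsqrt (\<Sum>p\<in>F. c p *\<^sub>R p) = (\<Sum>p\<in>F. sqrt (c p) *\<^sub>R p)"
proof (rule jsqrt_eqI)
  show "positive (\<Sum>p\<in>F. sqrt (c p) *\<^sub>R p)" using c by (intro positive_frame_sum[OF F]) auto
  have o: "orth_idems F" using F by (simp add: frame_def)
  have "(\<Sum>p\<in>F. sqrt (c p) *\<^sub>R p) \<star> (\<Sum>p\<in>F. sqrt (c p) *\<^sub>R p)
      = (\<Sum>p\<in>F. sqrt (c p) *\<^sub>R (p \<star> (\<Sum>p\<in>F. sqrt (c p) *\<^sub>R p)))"
    by (simp only: mult_sum_left mult_scaleR_left)
  also have "\<dots> = (\<Sum>p\<in>F. c p *\<^sub>R p)"
    using orth_idems_mult_sum[OF o order_refl, of _ "\<lambda>p. sqrt (c p)"] c by (intro sum.cong) auto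
  finally show "(\<Sum>p\<in>F. sqrt (c p) *\<^sub>R p) \<star> (\<Sum>p\<in>F. sqrt (c p) *\<^sub>R p) = (\<Sum>p\<in>F. c p *\<^sub>R p)" .
qed

lemma quad_rep_sqrt_frame:
  assumes F: "frame F" and c: "\<And>p. p \<in> F \<Longrightarrow> 0 \<le> c p"
  defines "s \<equiv> \<Sum>p\<in>F. sqrt (c p) *\<^sub>R p"
  shows "p \<in> F \<Longrightarrow> quad_rep s p = c p *\<^sub>R p"
    and "f \<in> F \<Longrightarrow> g \<in> F \<Longrightarrow> f \<noteq> g \<Longrightarrow> x \<in> offdiag f g \<Longrightarrow> quad_rep s x = sqrt (c f * c g) *\<^sub>R x"
proof -
  have o: "orth_idems F" using F by (simp add: frame_def)
  have ss: "s \<star> s = (\<Sum>p\<in>F. c p *\<^sub>R p)"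
  proof -
    have "s \<star> s = (\<Sum>p\<in>F. sqrt (c p) *\<^sub>R (p \<star> s))"
      by (subst (1) s_def) (simp only: mult_sum_left mult_scaleR_left)
    also have "\<dots> = (\<Sum>p\<in>F. c p *\<^sub>R p)"
      unfolding s_def using orth_idems_mult_sum[OF o order_refl, of _ "\<lambda>p. sqrt (c p)"] c
      by (intro sum.cong) auto
    finally show ?thesis .
  qed
  show "quad_rep s p = c p *\<^sub>R p" if p: "p \<in> F"
  proof -
    have "s \<star> p = sqrt (c p) *\<^sub>R p" "(s \<star> s) \<star> p = c p *\<^sub>R p"
      unfolding ss unfolding s_def
      using orth_idems_mult_sum[OF o order_refl p, of "\<lambda>p. sqrt (c p)"] orth_idems_mult_sum[OF o order_refl p, of c] p
      by (simp_all add: mult_commute[of _ p])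
    then show ?thesis using c[OF p] by (simp add: quad_rep_def mult_scaleR_right flip: scaleR_left_diff_distrib)
  qed
  show "quad_rep s x = sqrt (c f * c g) *\<^sub>R x"
    if fg: "f \<in> F" "g \<in> F" "f \<noteq> g" and x: "x \<in> offdiag f g"
  proof -
    have sx: "s \<star> x = ((sqrt (c f) + sqrt (c g)) / 2) *\<^sub>R x"
      unfolding s_def by (rule frame_sum_mult_offdiag[OF F fg x])
    have ssx: "(s \<star> s) \<star> x = ((c f + c g) / 2) *\<^sub>R x"
      unfolding ss by (rule frame_sum_mult_offdiag[OF F fg x])
    define k where "k = (sqrt (c f) + sqrt (c g)) / 2"
    have "quad_rep s x = (2 * (k * k) - (c f + c g) / 2) *\<^sub>R x"
      unfolding quad_rep_def ssx sx k_def[symmetric] mult_scaleR_right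
      by (simp add: scaleR_left_diff_distrib)
    \<comment> \<open>Twice the squared mean of two roots minus the mean of their squares is their
      product.\<close>
    also have "2 * (k * k) - (c f + c g) / 2 = sqrt (c f * c g)"
      using c[OF fg(1)] c[OF fg(2)]
      by (simp add: k_def real_sqrt_mult field_simps)
    finally show ?thesis .
  qed
qed

end

context euclidean_jordan_sequential_product
begin

text \<open>Splitting the sum along \<open>G\<close> is its Peirce decomposition for the idempotent
  \<open>\<Sum>G\<close>, without 1/2 part.\<close>

lemma sprod_partial_sum:
  assumes F: "frame F" and a: "(\<Sum>p\<in>F. c p *\<^sub>R p) \<in> effects" and G: "G \<subseteq> F"
    and e: "idem (\<Sum>G)"
  shows "\<Sum>G \<diamondop> (\<Sum>p\<in>F. c p *\<^sub>R p) = (\<Sum>p\<in>F. c p *\<^sub>R p) \<diamondop> \<Sum>G"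
    and "\<Sum>G \<diamondop> (\<Sum>p\<in>F. c p *\<^sub>R p) = (\<Sum>p\<in>G. c p *\<^sub>R p)"
proof -
  have o: "orth_idems F" using F by (simp add: frame_def)
  define x y where "x = (\<Sum>p\<in>G. c p *\<^sub>R p)" and "y = (\<Sum>p\<in>F - G. c p *\<^sub>R p)"
  have xy: "(\<Sum>p\<in>F. c p *\<^sub>R p) = x + y"
    using sum.subset_diff[OF G frame_finite[OF F], of "\<lambda>p. c p *\<^sub>R p"] by (simp add: x_def y_def)
  have "\<Sum>G \<star> x = x"
    unfolding mult_sum_left x_def
    by (rule sum.cong[OF refl]) (use orth_idems_mult_sum[OF o G] G in auto)
  moreover have "\<Sum>G \<star> y = 0"
    unfolding mult_sum_left y_def
    by (rule sum.neutral) (use orth_idems_mult_sum[OF o, of "F - G" _ c] G in auto)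
  ultimately have "x \<in> peirce 1 (\<Sum>G)" "y \<in> peirce 0 (\<Sum>G)" by (simp_all add: peirce_def)
  moreover have "x \<in> effects" "y \<in> effects"
    unfolding x_def y_def using frame_partial_sum_effect[OF F a] G by auto
  ultimately show "\<Sum>G \<diamondop> (\<Sum>p\<in>F. c p *\<^sub>R p) = (\<Sum>p\<in>F. c p *\<^sub>R p) \<diamondop> \<Sum>G"
    "\<Sum>G \<diamondop> (\<Sum>p\<in>F. c p *\<^sub>R p) = (\<Sum>p\<in>G. c p *\<^sub>R p)"
    using commute_peirce_sum[OF e, of x y] a unfolding xy by (simp_all add: x_def)
qed

lemma sprod_op_frame:
  assumes F: "frame F" and a: "(\<Sum>p\<in>F. c p *\<^sub>R p) \<in> effects" and p: "p \<in> F"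
  shows "sprod_op (\<Sum>p\<in>F. c p *\<^sub>R p) p = c p *\<^sub>R p"
  using sprod_partial_sum[OF F a, of "{p}"] p frame_idem[OF F p]
  by (simp add: sprod_op[OF a idem_effect])

text \<open>The operator of \<open>f + g\<close> fixes \<open>x\<close> and may be inserted before
  it. It commutes with the whole sum, so the two operators merge into that of the truncated
  sum.\<close>

lemma sprod_op_reduce:
  assumes F: "frame F" and a: "(\<Sum>p\<in>F. c p *\<^sub>R p) \<in> effects"
    and fg: "f \<in> F" "g \<in> F" "f \<noteq> g" and x: "x \<in> offdiag f g"
  shows "sprod_op (\<Sum>p\<in>F. c p *\<^sub>R p) x = sprod_op (c f *\<^sub>R f + c g *\<^sub>R g) x"
proof -
  define A where "A = (\<Sum>p\<in>F. c p *\<^sub>R p)"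
  have s: "\<Sum>{f, g} = f + g" "(\<Sum>p\<in>{f, g}. c p *\<^sub>R p) = c f *\<^sub>R f + c g *\<^sub>R g"
    using fg(3) by simp_all
  have e: "idem (f + g)" by (rule frame_idem_add[OF F fg])
  have c: "A \<diamondop> (f + g) = (f + g) \<diamondop> A" "(f + g) \<diamondop> A = c f *\<^sub>R f + c g *\<^sub>R g"
    using sprod_partial_sum[OF F a, of "{f, g}"] e fg unfolding s A_def by auto
  have "sprod_op (f + g) x = x"
    using offdiag_mult(3)[OF x] by (simp add: sprod_op_idem[OF e] quad_rep_peirce_one[OF e] peirce_def)
  then have "sprod_op A x = sprod_op A (sprod_op (f + g) x)" by simp
  also have "\<dots> = sprod_op (c f *\<^sub>R f + c g *\<^sub>R g) x"
    using sprod_op_commuting[OF _ idem_effect[OF e] c(1)] a c by (simp add: A_def)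
  finally show ?thesis by (simp add: A_def)
qed

section \<open>Two orthogonal idempotents\<close>

lemma pair_effect:
  assumes f: "idem f" and g: "idem g" and fg: "f \<star> g = 0"
    and s: "0 \<le> s" "s \<le> 1" and t: "0 \<le> t" "t \<le> 1"
  shows "s *\<^sub>R f + t *\<^sub>R g \<in> effects"
proof -
  have e: "unit - (s *\<^sub>R f + t *\<^sub>R g) = (unit - (f + g)) + ((1 - s) *\<^sub>R f + (1 - t) *\<^sub>R g)"
    by (simp add: algebra_simps)
  have "positive (unit - (f + g))" using f g fg idem_add idem_compl positive_idem by blast
  moreover have "positive ((1 - s) *\<^sub>R f + (1 - t) *\<^sub>R g)" "positive (s *\<^sub>R f + t *\<^sub>R g)"
    using s t positive_idem[OF f] positive_idem[OF g] by (simp_all add: positive_add positive_scaleR)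
  ultimately show ?thesis unfolding effects_iff e using positive_add by blast
qed

lemma pair_sprod_idem:
  assumes f: "idem f" and g: "idem g" and fg: "f \<star> g = 0"
    and s: "0 \<le> s" "s \<le> 1" and t: "0 \<le> t" "t \<le> 1"
  shows "f \<diamondop> (s *\<^sub>R f + t *\<^sub>R g) = (s *\<^sub>R f + t *\<^sub>R g) \<diamondop> f"
    "f \<diamondop> (s *\<^sub>R f + t *\<^sub>R g) = s *\<^sub>R f"
    "g \<diamondop> (s *\<^sub>R f + t *\<^sub>R g) = (s *\<^sub>R f + t *\<^sub>R g) \<diamondop> g"
      "g \<diamondop> (s *\<^sub>R f + t *\<^sub>R g) = t *\<^sub>R g"
proof -
  have gf: "g \<star> f = 0" using fg by (simp add: mult_commute)
  have e: "s *\<^sub>R f \<in> effects" "t *\<^sub>R g \<in> effects" using effects_scaleR idem_effect f g s t by auto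
  have p: "s *\<^sub>R f \<in> peirce 1 f" "t *\<^sub>R g \<in> peirce 0 f" "t *\<^sub>R g \<in> peirce 1 g"
    "s *\<^sub>R f \<in> peirce 0 g"
    using f g fg gf by (auto simp: peirce_def idem_def mult_scaleR_right)
  have x: "s *\<^sub>R f + t *\<^sub>R g \<in> effects" "t *\<^sub>R g + s *\<^sub>R f \<in> effects"
    using pair_effect[OF assms] by (simp_all add: add.commute)
  show "f \<diamondop> (s *\<^sub>R f + t *\<^sub>R g) = (s *\<^sub>R f + t *\<^sub>R g) \<diamondop> f"
    "f \<diamondop> (s *\<^sub>R f + t *\<^sub>R g) = s *\<^sub>R f"
    using commute_peirce_sum[OF f e(1) p(1) e(2) p(2) x(1)] .
  show "g \<diamondop> (s *\<^sub>R f + t *\<^sub>R g) = (s *\<^sub>R f + t *\<^sub>R g) \<diamondop> g"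
    "g \<diamondop> (s *\<^sub>R f + t *\<^sub>R g) = t *\<^sub>R g"
    using commute_peirce_sum[OF g e(2) p(3) e(1) p(4) x(2)] by (simp_all add: add.commute)
qed

text \<open>Combinations of \<open>f\<close> and \<open>g\<close> multiply coefficientwise, so they
  commute, and the associativity axiom turns products into compositions.\<close>

lemma pair_sprod_op_mult:
  assumes fg: "idem f" "idem g" "f \<star> g = 0"
    and s: "0 \<le> s" "s \<le> 1" and t: "0 \<le> t" "t \<le> 1"
    and s': "0 \<le> s'" "s' \<le> 1" and t': "0 \<le> t'" "t' \<le> 1"
  shows "sprod_op (s *\<^sub>R f + t *\<^sub>R g) (sprod_op (s' *\<^sub>R f + t' *\<^sub>R g) x)
    = sprod_op ((s * s') *\<^sub>R f + (t * t') *\<^sub>R g) x"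
proof -
  have e: "f \<in> effects" "g \<in> effects" using idem_effect fg by auto
  have prod: "(a *\<^sub>R f + b *\<^sub>R g) \<diamondop> (a' *\<^sub>R f + b' *\<^sub>R g) = (a * a') *\<^sub>R f + (b * b') *\<^sub>R g"
    if a: "0 \<le> a" "a \<le> 1" and b: "0 \<le> b" "b \<le> 1" and a': "0 \<le> a'"
      "a' \<le> 1" and b': "0 \<le> b'" "b' \<le> 1"
    for a b a' b'
  proof -
    define z where "z = a *\<^sub>R f + b *\<^sub>R g"
    have z: "z \<in> effects" unfolding z_def by (rule pair_effect[OF fg a b])
    have zf: "z \<diamondop> f = a *\<^sub>R f" "z \<diamondop> g = b *\<^sub>R g"
      unfolding z_def using pair_sprod_idem[OF fg a b] by simp_all
    have sum: "a' *\<^sub>R f + b' *\<^sub>R g \<preceq> unit"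
      using pair_effect[OF fg a' b'] by (simp add: effects_iff jle_def)
    have "z \<diamondop> (a' *\<^sub>R f + b' *\<^sub>R g) = a' *\<^sub>R (a *\<^sub>R f) + b' *\<^sub>R (b *\<^sub>R g)"
      using sprod_add[OF z effects_scaleR[OF e(1) a'] effects_scaleR[OF e(2) b'] sum]
        sprod_scaleR[OF z e(1) a'] sprod_scaleR[OF z e(2) b'] zf by simp
    then show ?thesis unfolding z_def[symmetric] by (simp add: mult.commute)
  qed
  have "(s *\<^sub>R f + t *\<^sub>R g) \<diamondop> (s' *\<^sub>R f + t' *\<^sub>R g) = (s' *\<^sub>R f + t' *\<^sub>R g) \<diamondop> (s *\<^sub>R f + t *\<^sub>R g)"
    using prod[OF s t s' t'] prod[OF s' t' s t] by (simp add: mult.commute)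
  then show ?thesis
    using sprod_op_commuting[OF pair_effect[OF fg s t] pair_effect[OF fg s' t']] prod[OF s t s' t'] by simp
qed

lemma pair_sprod_op_diag:
  assumes fg: "idem f" "idem g" "f \<star> g = 0" and t: "0 \<le> t" "t \<le> 1" and x: "x \<in> offdiag f g"
  shows "sprod_op (t *\<^sub>R f + t *\<^sub>R g) x = t *\<^sub>R x"
proof -
  have i: "idem (f + g)" using fg by (rule idem_add)
  have e: "f + g \<in> effects" using i by (rule idem_effect)
  have "sprod_op (t *\<^sub>R (f + g)) y = t *\<^sub>R sprod_op (f + g) y" for y
  proof (rule linear_eq_on_effects[where f = "sprod_op (t *\<^sub>R (f + g))" and g = "\<lambda>y. t *\<^sub>R sprod_op (f + g) y"])
    show "linear (sprod_op (t *\<^sub>R (f + g)))" using effects_scaleR[OF e t] by (rule linear_sprod_op)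
    show "linear (\<lambda>y. t *\<^sub>R sprod_op (f + g) y)" using linear_sprod_op[OF e]
      by (rule linear_compose_scale_right)
    show "sprod_op (t *\<^sub>R (f + g)) b = t *\<^sub>R sprod_op (f + g) b" if b: "b \<in> effects" for b
      using scaleR_sprod[OF e b t] by (simp add: sprod_op[OF e b] sprod_op[OF effects_scaleR[OF e t] b])
  qed
  moreover have "sprod_op (f + g) x = x"
    using offdiag_mult(3)[OF x] by (simp add: sprod_op_idem[OF i] quad_rep_peirce_one[OF i] peirce_def)
  ultimately show ?thesis by (simp add: scaleR_add_right)
qed

text \<open>The operator commutes with the projections of \<open>f\<close>, \<open>g\<close> and
  \<open>f + g\<close>, which together determine the block.\<close>

lemma pair_sprod_op_offdiag:
  assumes fg: "idem f" "idem g" "f \<star> g = 0" and s: "0 \<le> s" "s \<le> 1" and t: "0 \<le> t" "t \<le> 1"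
    and x: "x \<in> offdiag f g"
  shows "sprod_op (s *\<^sub>R f + t *\<^sub>R g) x \<in> offdiag f g"
proof -
  have i: "idem (f + g)" using fg by (rule idem_add)
  define z where "z = s *\<^sub>R f + t *\<^sub>R g"
  have z: "z \<in> effects" unfolding z_def by (rule pair_effect[OF fg s t])
  have com: "quad_rep h (sprod_op z x) = sprod_op z (quad_rep h x)"
    if h: "idem h" "h \<diamondop> z = z \<diamondop> h" for h
    using sprod_op_commuting[OF z idem_effect[OF h(1)], of x] sprod_op_commuting[OF idem_effect[OF h(1)] z, of x] h
    by (simp add: sprod_op_idem)
  have q: "quad_rep (f + g) x = x" "quad_rep f x = 0" "quad_rep g x = 0"
    using x offdiag_mult(3)[OF x] fg quad_rep_peirce_one[OF i] quad_rep_peirce_half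
    by (auto simp: offdiag_def peirce_def[of 1])
  have z0: "sprod_op z 0 = 0" using linear_0[OF linear_sprod_op[OF z]] .
  have "f \<diamondop> z = z \<diamondop> f" "g \<diamondop> z = z \<diamondop> g" unfolding z_def
    using pair_sprod_idem[OF fg s t] by simp_all
  moreover have "(f + g) \<diamondop> z = z \<diamondop> (f + g)"
    using idem_commute_effect[OF i z] fg
    by (simp add: z_def peirce_def idem_def mult_linear mult_commute[of g f])
  ultimately show ?thesis
    unfolding z_def[symmetric] using com[of f] com[of g] com[of "f + g"] fg i q z0
    by (intro mem_offdiagI) auto
qed

lemma order_iso_sprod_op:
  assumes inv: invariant and \<Phi>: "unital_order_iso \<Phi>" and a: "a \<in> effects"
  shows "\<Phi> (sprod_op a x) = sprod_op (\<Phi> a) (\<Phi> x)"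
proof -
  have lin: "linear \<Phi>" and u: "\<Phi> unit = unit"
    and pos: "\<And>v. positive v \<longleftrightarrow> positive (\<Phi> v)"
    using \<Phi> by (simp_all add: unital_order_iso_def)
  have eff: "\<Phi> b \<in> effects" if "b \<in> effects" for b
    using that pos[of b] pos[of "unit - b"] by (simp add: effects_iff linear_diff[OF lin] u)
  show ?thesis
  proof (rule linear_eq_on_effects[where f = "\<lambda>x. \<Phi> (sprod_op a x)" and g = "\<lambda>x. sprod_op (\<Phi> a) (\<Phi> x)"])
    show "linear (\<lambda>x. \<Phi> (sprod_op a x))"
      using linear_compose[OF linear_sprod_op[OF a] lin] by (simp add: o_def)
    show "linear (\<lambda>x. sprod_op (\<Phi> a) (\<Phi> x))"
      using linear_compose[OF lin linear_sprod_op[OF eff[OF a]]] by (simp add: o_def)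
    show "\<Phi> (sprod_op a b) = sprod_op (\<Phi> a) (\<Phi> b)" if b: "b \<in> effects" for b
      using inv \<Phi> a b by (simp add: sprod_op[OF a b] sprod_op[OF eff[OF a] eff[OF b]] invariant_def)
  qed
qed

text \<open>Two orthogonal reflections combine to an automorphism that fixes \<open>f\<close>, \<open>g\<close> and \<open>u\<close>; when
  the block has no room for this, the transposition takes their place.\<close>

lemma pair_sprod_op_perp:
  assumes inv: invariant and F: "frame F" and fg: "f \<in> F" "g \<in> F" "f \<noteq> g"
    and s: "0 \<le> s" "s \<le> 1" and t: "0 \<le> t" "t \<le> 1"
    and u: "u \<in> offdiag f g" "u \<noteq> 0" and v: "v \<in> offdiag f g" "v \<bullet> u = 0"
  shows "sprod_op (s *\<^sub>R f + t *\<^sub>R g) u \<bullet> v = 0"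
proof (cases "v = 0")
  case False
  have i: "idem f" "idem g" "f \<star> g = 0" using frame_idem[OF F] frame_orthogonal[OF F] fg by auto
  have prim: "primitive f" "primitive g" using frame_primitive[OF F] fg by auto
  define x where "x = s *\<^sub>R f + t *\<^sub>R g"
  have x: "x \<in> effects" unfolding x_def by (rule pair_effect[OF i s t])
  define y where "y = sprod_op x u"
  have y: "y \<in> offdiag f g" unfolding y_def x_def by (rule pair_sprod_op_offdiag[OF i s t u(1)])
  show ?thesis
  proof (cases "\<exists>w \<in> offdiag f g. w \<noteq> 0 \<and> w \<bullet> u = 0 \<and> w \<bullet> v = 0")
    case True
    then obtain w where w: "w \<in> offdiag f g" "w \<noteq> 0" "w \<bullet> u = 0" "w \<bullet> v = 0" by blast
    obtain \<Psi> where \<Psi>: "unital_order_iso \<Psi>" "\<Psi> f = g" "\<Psi> g = f" "\<Psi> v = v"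
      "\<And>z. z \<in> offdiag f g \<Longrightarrow> z \<bullet> v = 0 \<Longrightarrow> \<Psi> z = - z"
      using offdiag_reflection[OF prim i(3) v(1) False] by blast
    obtain \<Phi> where \<Phi>: "unital_order_iso \<Phi>" "\<Phi> f = g" "\<Phi> g = f" "\<Phi> w = w"
      "\<And>z. z \<in> offdiag f g \<Longrightarrow> z \<bullet> w = 0 \<Longrightarrow> \<Phi> z = - z"
      using offdiag_reflection[OF prim i(3) w(1,2)] by blast
    have l\<Psi>: "linear \<Psi>" and l\<Phi>: "linear \<Phi>" using \<Psi>(1) \<Phi>(1)
      by (simp_all add: unital_order_iso_def)
    have "\<Phi> x = s *\<^sub>R g + t *\<^sub>R f"
      by (simp add: x_def linear_add[OF l\<Phi>] linear_scale[OF l\<Phi>] \<Phi>)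
    then have \<Psi>\<Phi>x: "\<Psi> (\<Phi> x) = x"
      by (simp add: x_def linear_add[OF l\<Psi>] linear_scale[OF l\<Psi>] \<Psi>)
    have \<Phi>x: "\<Phi> x \<in> effects"
      using \<open>\<Phi> x = _\<close> pair_effect[OF i(1,2,3) t s] by (simp add: add.commute)
    have "\<Phi> u = - u" using \<Phi>(5)[OF u(1)] w(3) by (simp add: inner_commute)
    moreover have "\<Psi> u = - u" using \<Psi>(5)[OF u(1)] v(2) by (simp add: inner_commute)
    ultimately have \<Psi>\<Phi>u: "\<Psi> (\<Phi> u) = u" by (simp add: linear_neg[OF l\<Psi>])
    \<comment> \<open>The composite exchanges \<open>f\<close> and \<open>g\<close> twice and
      negates \<open>u\<close> twice, so it fixes the image \<open>y\<close>. It negates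
      \<open>v\<close>, so \<open>y\<close> has no component along \<open>v\<close>.\<close>
    have \<Psi>\<Phi>y: "\<Psi> (\<Phi> y) = y"
      unfolding y_def order_iso_sprod_op[OF inv \<Phi>(1) x] order_iso_sprod_op[OF inv \<Psi>(1) \<Phi>x] \<Psi>\<Phi>x \<Psi>\<Phi>u ..
    define a where "a = (y \<bullet> v) / (v \<bullet> v)"
    define b where "b = (y \<bullet> w) / (w \<bullet> w)"
    define z where "z = y - a *\<^sub>R v - b *\<^sub>R w"
    have z: "z \<in> offdiag f g"
      using y v(1) w(1) subspace_offdiag[of f g] by (simp add: z_def subspace_diff subspace_scale)
    have zv: "z \<bullet> v = 0" "z \<bullet> w = 0"
      using False w by (simp_all add: z_def a_def b_def inner_diff_left inner_commute[of v w])
    have yz: "y = a *\<^sub>R v + b *\<^sub>R w + z" by (simp add: z_def)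
    have \<Phi>v: "\<Phi> v = - v" using \<Phi>(5)[OF v(1)] w(4) by (simp add: inner_commute)
    have \<Psi>w: "\<Psi> w = - w" using \<Psi>(5)[OF w(1)] w(4) by simp
    have \<Phi>z: "\<Phi> z = - z" and \<Psi>z: "\<Psi> z = - z" using \<Phi>(5)[OF z] \<Psi>(5)[OF z] zv by auto
    have "\<Phi> y = a *\<^sub>R (- v) + b *\<^sub>R w + (- z)"
      by (simp only: yz linear_add[OF l\<Phi>] linear_scale[OF l\<Phi>] \<Phi>(4) \<Phi>v \<Phi>z)
    then have "\<Psi> (\<Phi> y) = a *\<^sub>R (- v) + b *\<^sub>R (- w) + (- (- z))"
      by (simp only: linear_add[OF l\<Psi>] linear_scale[OF l\<Psi>] linear_neg[OF l\<Psi>] \<Psi>(4) \<Psi>w \<Psi>z)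
    then have y': "\<Psi> (\<Phi> y) = - (a *\<^sub>R v) - b *\<^sub>R w + z" by simp
    have "- (a *\<^sub>R v) - b *\<^sub>R w + z = a *\<^sub>R v + b *\<^sub>R w + z"
      by (rule trans[OF y'[symmetric] trans[OF \<Psi>\<Phi>y yz]])
    then have "(- (a *\<^sub>R v) - b *\<^sub>R w + z) \<bullet> v = (a *\<^sub>R v + b *\<^sub>R w + z) \<bullet> v"
      by (rule arg_cong)
    then have "a * (v \<bullet> v) = 0"
      using zv w(4) by (simp add: inner_add_left inner_diff_left)
    then have "y \<bullet> v = 0" using False by (simp add: a_def)
    then show ?thesis by (simp add: y_def x_def)
  next
    case no: False
    have two: "\<exists>a b. w = a *\<^sub>R u + b *\<^sub>R v" if w: "w \<in> offdiag f g" for w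
    proof -
      define a where "a = (w \<bullet> u) / (u \<bullet> u)"
      define b where "b = (w \<bullet> v) / (v \<bullet> v)"
      define z where "z = w - a *\<^sub>R u - b *\<^sub>R v"
      have "z \<in> offdiag f g"
        using w u(1) v(1) subspace_offdiag[of f g] by (simp add: z_def subspace_diff subspace_scale)
      moreover have "z \<bullet> u = 0" "z \<bullet> v = 0"
        using False u(2) v(2) by (simp_all add: z_def a_def b_def inner_diff_left inner_commute[of u v])
      ultimately have "z = 0" using no by blast
      then have "w = a *\<^sub>R u + b *\<^sub>R v" by (simp add: z_def algebra_simps)
      then show ?thesis by blast
    qed
    obtain \<Psi> where \<Psi>: "unital_order_iso \<Psi>" "\<Psi> f = f" "\<Psi> g = g" "\<Psi> u = u" "\<Psi> v = - v"
      using offdiag_transposition[OF F fg u v two] by blast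
    have l\<Psi>: "linear \<Psi>" using \<Psi>(1) by (simp add: unital_order_iso_def)
    have \<Psi>x: "\<Psi> x = x" by (simp add: x_def linear_add[OF l\<Psi>] linear_scale[OF l\<Psi>] \<Psi>)
    have \<Psi>y: "\<Psi> y = y" unfolding y_def order_iso_sprod_op[OF inv \<Psi>(1) x] \<Psi>x \<Psi>(4) ..
    obtain a b where ab: "y = a *\<^sub>R u + b *\<^sub>R v" using two[OF y] by blast
    have y': "\<Psi> y = a *\<^sub>R u - b *\<^sub>R v"
      by (simp add: ab linear_add[OF l\<Psi>] linear_scale[OF l\<Psi>] \<Psi>)
    have "a *\<^sub>R u - b *\<^sub>R v = a *\<^sub>R u + b *\<^sub>R v"
      by (rule trans[OF y'[symmetric] trans[OF \<Psi>y ab]])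
    then have "(a *\<^sub>R u - b *\<^sub>R v) \<bullet> v = (a *\<^sub>R u + b *\<^sub>R v) \<bullet> v" by (rule arg_cong)
    then have "b * (v \<bullet> v) = 0" by (simp add: inner_add_left inner_diff_left)
    then have "y \<bullet> v = 0" using v(2) by (simp add: ab inner_add_left inner_commute[of u v])
    then show ?thesis by (simp add: y_def x_def)
  qed
qed simp

text \<open>The part of the image perpendicular to \<open>u\<close> is orthogonal to the image
  itself, by \<open>pair_sprod_op_perp\<close>, and hence zero.\<close>

lemma pair_sprod_op_eigen:
  assumes inv: invariant and F: "frame F" and fg: "f \<in> F" "g \<in> F" "f \<noteq> g"
    and s: "0 \<le> s" "s \<le> 1" and t: "0 \<le> t" "t \<le> 1"
    and u: "u \<in> offdiag f g" "u \<noteq> 0"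
  obtains k where "sprod_op (s *\<^sub>R f + t *\<^sub>R g) u = k *\<^sub>R u"
proof
  have i: "idem f" "idem g" "f \<star> g = 0" using frame_idem[OF F] frame_orthogonal[OF F] fg by auto
  define y where "y = sprod_op (s *\<^sub>R f + t *\<^sub>R g) u"
  have y: "y \<in> offdiag f g" unfolding y_def by (rule pair_sprod_op_offdiag[OF i s t u(1)])
  define k where "k = (y \<bullet> u) / (u \<bullet> u)"
  define v where "v = y - k *\<^sub>R u"
  have "v \<in> offdiag f g" using y u(1) subspace_offdiag[of f g] by (simp add: v_def subspace_diff subspace_scale)
  moreover have vu: "v \<bullet> u = 0" using u(2) by (simp add: v_def k_def inner_diff_left)
  ultimately have "y \<bullet> v = 0"
    unfolding y_def by (rule pair_sprod_op_perp[OF inv F fg s t u])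
  moreover have "v \<bullet> v = y \<bullet> v - k * (v \<bullet> u)"
    by (subst (1) v_def) (simp add: inner_diff_left inner_commute[of u])
  ultimately have "v = 0" using vu by simp
  then have "y = k *\<^sub>R u" by (simp add: v_def)
  then show "sprod_op (s *\<^sub>R f + t *\<^sub>R g) u = k *\<^sub>R u" by (simp only: y_def)
qed

lemma pair_sprod_op_value:
  assumes inv: invariant and F: "frame F" and fg: "f \<in> F" "g \<in> F" "f \<noteq> g"
    and s: "0 \<le> s" "s \<le> 1" and t: "0 \<le> t" "t \<le> 1" and u: "u \<in> offdiag f g"
  shows "sprod_op (s *\<^sub>R f + t *\<^sub>R g) u = sqrt (s * t) *\<^sub>R u"
proof (cases "u = 0")
  case True
  have i: "idem f" "idem g" "f \<star> g = 0" using frame_idem[OF F] frame_orthogonal[OF F] fg by auto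
  show ?thesis using linear_0[OF linear_sprod_op[OF pair_effect[OF i s t]]] True by simp
next
  case False
  have i: "idem f" "idem g" "f \<star> g = 0" using frame_idem[OF F] frame_orthogonal[OF F] fg by auto
  have prim: "primitive f" "primitive g" using frame_primitive[OF F] fg by auto
  define x where "x a b = a *\<^sub>R f + b *\<^sub>R g" for a b
  have x: "x a b \<in> effects" if "0 \<le> a" "a \<le> 1" "0 \<le> b" "b \<le> 1" for a b
    unfolding x_def using pair_effect[OF i] that by blast
  have mul: "sprod_op (x a b) (sprod_op (x a' b') z) = sprod_op (x (a * a') (b * b')) z"
    if "0 \<le> a" "a \<le> 1" "0 \<le> b" "b \<le> 1" "0 \<le> a'" "a' \<le> 1" "0 \<le> b'" "b' \<le> 1" for a b a' b' z
    unfolding x_def using pair_sprod_op_mult[OF i] that by blast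
  obtain k where k: "sprod_op (x s t) u = k *\<^sub>R u"
    using pair_sprod_op_eigen[OF inv F fg s t u False] by (auto simp: x_def)
  have rs: "0 \<le> sqrt s" "sqrt s \<le> 1" "0 \<le> sqrt t" "sqrt t \<le> 1" using s t by auto
  obtain m where m: "sprod_op (x (sqrt s) (sqrt t)) u = m *\<^sub>R u"
    using pair_sprod_op_eigen[OF inv F fg rs u False] by (auto simp: x_def)
  have "sprod_op (x s t) u = sprod_op (x (sqrt s) (sqrt t)) (m *\<^sub>R u)"
    using mul[OF rs rs, of u] s t by (simp add: m)
  also have "\<dots> = (m * m) *\<^sub>R u" by (simp add: linear_scale[OF linear_sprod_op[OF x[OF rs]]] m)
  finally have "k = m * m" using k False by simp
  then have k0: "0 \<le> k" by simp
  obtain \<Psi> where \<Psi>: "unital_order_iso \<Psi>" "\<Psi> f = g" "\<Psi> g = f" "\<Psi> u = u"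
    using offdiag_reflection[OF prim i(3) u False] by blast
  have l\<Psi>: "linear \<Psi>" using \<Psi>(1) by (simp add: unital_order_iso_def)
  have \<Psi>x: "\<Psi> (x s t) = x t s" by (simp add: x_def linear_add[OF l\<Psi>] linear_scale[OF l\<Psi>] \<Psi> add.commute)
  \<comment> \<open>The reflection fixes \<open>u\<close>, so exchanging \<open>s\<close> and
    \<open>t\<close> keeps the eigenvalue. The two operators compose to that of a multiple of
    \<open>f + g\<close>, which is known.\<close>
  have "sprod_op (x t s) u = k *\<^sub>R u"
    using order_iso_sprod_op[OF inv \<Psi>(1) x[OF s t], of u] by (simp add: k \<Psi>x \<Psi>(4) linear_scale[OF l\<Psi>])
  then have "sprod_op (x s t) (sprod_op (x t s) u) = (k * k) *\<^sub>R u"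
    by (simp add: linear_scale[OF linear_sprod_op[OF x[OF s t]]] k)
  moreover have "sprod_op (x s t) (sprod_op (x t s) u) = (s * t) *\<^sub>R u"
  proof -
    have st: "0 \<le> s * t" "s * t \<le> 1" using s t by (auto intro: mult_le_one)
    show ?thesis
      using mul[OF s t t s, of u] pair_sprod_op_diag[OF i st u] by (simp add: x_def mult.commute)
  qed
  ultimately have "k * k = s * t" using False by simp
  then have "k = sqrt (s * t)" using k0 by (metis abs_of_nonneg real_sqrt_abs2)
  then show ?thesis using k by (simp add: x_def)
qed

lemma sprod_eq_quad_rep:
  assumes inv: invariant and a: "a \<in> effects" and b: "b \<in> effects"
  shows "a \<diamondop> b = quad_rep (jsqrt a) b"
proof -
  obtain F c where F: "frame F" and ac: "a = (\<Sum>p\<in>F. c p *\<^sub>R p)" using exists_frame[of a] by blast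
  have ea: "(\<Sum>p\<in>F. c p *\<^sub>R p) \<in> effects" using a ac by simp
  note c = frame_coefficient_bounds[OF F ea]
  have s: "jsqrt a = (\<Sum>p\<in>F. sqrt (c p) *\<^sub>R p)" unfolding ac using F c(1) by (rule jsqrt_frame_sum)
  have "sprod_op a b = quad_rep (jsqrt a) b"
  proof (rule frame_linear_eqI[OF F linear_sprod_op[OF a] linear_quad_rep])
    show "sprod_op a p = quad_rep (jsqrt a) p" if p: "p \<in> F" for p
      unfolding s using quad_rep_sqrt_frame(1)[OF F c(1) p] sprod_op_frame[OF F ea p] by (simp add: ac)
    show "sprod_op a x = quad_rep (jsqrt a) x"
      if fg: "f \<in> F" "g \<in> F" "f \<noteq> g" and x: "x \<in> offdiag f g" for f g x
      unfolding s unfolding ac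
      using quad_rep_sqrt_frame(2)[OF F c(1) fg x] sprod_op_reduce[OF F ea fg x]
        pair_sprod_op_value[OF inv F fg c[OF fg(1)] c[OF fg(2)] x] by simp
  qed
  then show ?thesis by (simp add: sprod_op[OF a b])
qed

end

theorem theorem5p11:
  fixes mult :: "'a::{real_inner, complete_space} \<Rightarrow> 'a \<Rightarrow> 'a"
    and unit :: 'a
    and sprod :: "'a \<Rightarrow> 'a \<Rightarrow> 'a"
  assumes "euclidean_jordan_algebra mult unit"
    and "sequential_product mult unit sprod"
    and "sequential_product.invariant mult unit sprod"
    and "sequential_product.norm_continuous_fst mult unit sprod"
    and "a \<in> jordan_algebra.effects mult unit"
    and "b \<in> jordan_algebra.effects mult unit"
  shows "sprod a b = jordan_algebra.quad_rep mult (jordan_algebra.jsqrt mult a) b"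
proof -
  interpret euclidean_jordan_algebra mult unit by (rule assms(1))
  interpret sequential_product mult unit sprod by (rule assms(2))
  interpret euclidean_jordan_sequential_product mult unit sprod by unfold_locales
  show ?thesis using assms(3,5,6) by (rule sprod_eq_quad_rep)
qed

end
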